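(* Let $\mathcal{A}=\bigcup_{i=1}^d V(\alpha_i)\subseteq\mathbb{P}^2$ be an arrangement of distinct lines which is a $(k,m)$-net with $k\ge m$, and let $I\subseteq R=\mathbb{C}[y_1,\dots,y_d]$ be its Orlik–Terao ideal. Then $I$ contains the $2\times2$ minors of a $1$-generic $2\times\bigl(km-\binom{m+1}{2}\bigr)$ matrix of linear forms in $R$. Thus the (minimal graded free) resolution of $I$ contains an Eagon–Northcott complex (the one resolving the ideal of these minors) as a subcomplex.
   Context: Orlik–Terao ideal: $\alpha_1,\dots,\alpha_d\in\mathbb{C}[x,y,z]$ are pairwise non-proportional nonzero linear forms. For each linear dependency $\Lambda:\ \sum_{j=1}^k c_{i_j}\alpha_{i_j}=0$ put $f_\Lambda=\sum_{j=1}^k c_{i_j}\,(y_{i_1}\cdots\widehat{y_{i_j}}\cdots y_{i_k})\in R$; $I$ is the ideal generated by all the $f_\Lambda$, and the Orlik–Terao algebra is $C(\mathcal{A})=R/I$. Nets: let $k\ge3$ be an integer. A $k$-net in $\mathbb{P}^2$ is a pair $(\mathcal{A},Z)$ where $\mathcal{A}$ is a finite set of distinct lines partitioned into $k$ (nonempty) subsets $\mathcal{A}=\bigcup_{i=1}^k\mathcal{A}_i$ and $Z$ is a finite set of points, such that: (1) for every $i\ne j$ and every $L\in\mathcal{A}_i$, $L'\in\mathcal{A}_j$, one has $L\cap L'\in Z$; (2) for every $p\in Z$ and every $i\in\{1,\dots,k\}$ there exists a unique $L\in\mathcal{A}_i$ containing $p$. For a $k$-net, $|\mathcal{A}_i|=|L\cap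 Z|$ for any block $\mathcal{A}_i$ and any line $L\in\mathcal{A}$; this common number is denoted $m$ and called the order of the net, which is then called a $(k,m)$-net (so $d=km$ and $|Z|=m^2$). The arrangement $\mathcal{A}$ "is a $(k,m)$-net" if such a $Z$ and partition exist. A matrix of linear forms is $1$-generic if it has no zero entry and cannot be transformed by (scalar, invertible) row and column operations to have a zero entry. *)

theory Defs
  imports Complex_Main "HOL-Library.Poly_Mapping" "Jordan_Normal_Form.Matrix"
begin

section \<open>The polynomial ring and its ideals\<close>

text \<open>The ring \<open>R\<close>, with one variable for each element of the finite index type of the arrangement
  (so the number of variables is \<open>d = CARD('n)\<close>).\<close>

type_synonym 'n ring_R = "('n \<Rightarrow>\<^sub>0 nat) \<Rightarrow>\<^sub>0 complex"

definition Var :: "'n \<Rightarrow> 'n ring_R" where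
  "Var i = Poly_Mapping.single (Poly_Mapping.single i 1) 1"

definition Const :: "complex \<Rightarrow> 'n ring_R" where
  "Const c = Poly_Mapping.single 0 c"

definition total_deg :: "('n::finite \<Rightarrow>\<^sub>0 nat) \<Rightarrow> nat" where
  "total_deg t = (\<Sum>i\<in>UNIV. Poly_Mapping.lookup t i)"

text \<open>The zero polynomial is homogeneous of every degree, and the only one of negative degree.\<close>

definition homogeneous :: "int \<Rightarrow> 'n::finite ring_R \<Rightarrow> bool" where
  "homogeneous e p \<longleftrightarrow> (\<forall>t\<in>Poly_Mapping.keys p. int (total_deg t) = e)"

text \<open>A commutative ring as a module over itself: \<open>ideal.span S\<close> is the ideal generated by \<open>S\<close>.\<close>

interpretation ideal: Modules.module "(*) :: 'a::comm_ring_1 \<Rightarrow> 'a \<Rightarrow> 'a"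
  by standard (simp_all add: algebra_simps)

section \<open>The Orlik-Terao ideal\<close>

text \<open>A linear form on \<open>\<complex>\<^sup>3\<close> is given by its coefficient vector. The coefficients of a dependency
  are allowed to vanish; this does not change the ideal generated.\<close>

definition dependency :: "('n \<Rightarrow> complex vec) \<Rightarrow> 'n set \<Rightarrow> ('n \<Rightarrow> complex) \<Rightarrow> bool" where
  "dependency \<alpha> S c \<longleftrightarrow> (\<forall>x<3. (\<Sum>i\<in>S. c i * (\<alpha> i $ x)) = 0)"

definition OT_relation :: "'n set \<Rightarrow> ('n \<Rightarrow> complex) \<Rightarrow> 'n ring_R" where
  "OT_relation S c = (\<Sum>i\<in>S. Const (c i) * (\<Prod>j\<in>S - {i}. Var j))"

definition OT_ideal :: "('n::finite \<Rightarrow> complex vec) \<Rightarrow> 'n ring_R set" where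
  "OT_ideal \<alpha> = ideal.span {OT_relation S c | S c. dependency \<alpha> S c}"

section \<open>Nets in the projective plane\<close>

text \<open>Points of the projective plane are the one-dimensional subspaces of \<open>\<complex>\<^sup>3\<close>; lines are sets of
  points.\<close>

type_synonym point = "complex vec set"

definition proj_plane :: "point set" where
  "proj_plane = {{c \<cdot>\<^sub>v v | c. True} | v. v \<in> carrier_vec 3 \<and> v \<noteq> 0\<^sub>v 3}"

definition proj_line :: "complex vec \<Rightarrow> point set" where
  "proj_line a = {p \<in> proj_plane. \<forall>v\<in>p. a \<bullet> v = 0}"

definition is_proj_line :: "point set \<Rightarrow> bool" where
  "is_proj_line L \<longleftrightarrow> (\<exists>a. a \<in> carrier_vec 3 \<and> a \<noteq> 0\<^sub>v 3 \<and> L = proj_line a)"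

definition net :: "nat \<Rightarrow> (nat \<Rightarrow> point set set) \<Rightarrow> point set \<Rightarrow> bool" where
  "net k \<A> Z \<longleftrightarrow>
     k \<ge> 3 \<and>
     (\<forall>i<k. finite (\<A> i) \<and> \<A> i \<noteq> {} \<and> (\<forall>L\<in>\<A> i. is_proj_line L)) \<and>
     (\<forall>i<k. \<forall>j<k. i \<noteq> j \<longrightarrow> \<A> i \<inter> \<A> j = {}) \<and>
     finite Z \<and> Z \<subseteq> proj_plane \<and>
     (\<forall>i<k. \<forall>j<k. i \<noteq> j \<longrightarrow> (\<forall>L\<in>\<A> i. \<forall>L'\<in>\<A> j. \<exists>p\<in>Z. L \<inter> L' = {p})) \<and>
     (\<forall>p\<in>Z. \<forall>i<k. \<exists>!L. L \<in> \<A> i \<and> p \<in> L)"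

text \<open>The order of a net is the common cardinality of its blocks, which is also the
  number of points of \<open>Z\<close> on each line.\<close>

definition is_net :: "nat \<Rightarrow> nat \<Rightarrow> point set set \<Rightarrow> bool" where
  "is_net k m Ls \<longleftrightarrow>
     (\<exists>\<A> Z. net k \<A> Z \<and> (\<Union>i<k. \<A> i) = Ls \<and> (\<forall>i<k. card (\<A> i) = m))"

section \<open>Matrices of linear forms\<close>

definition linear_form_matrix :: "'n::finite ring_R mat \<Rightarrow> bool" where
  "linear_form_matrix M \<longleftrightarrow> (\<forall>i<dim_row M. \<forall>j<dim_col M. homogeneous 1 (M $$ (i, j)))"

definition no_zero_entry :: "'a::zero mat \<Rightarrow> bool" where
  "no_zero_entry M \<longleftrightarrow> (\<forall>i<dim_row M. \<forall>j<dim_col M. M $$ (i, j) \<noteq> 0)"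

definition one_generic :: "'n::finite ring_R mat \<Rightarrow> bool" where
  "one_generic M \<longleftrightarrow> no_zero_entry M \<and>
     (\<forall>P Q. P \<in> carrier_mat (dim_row M) (dim_row M) \<and> invertible_mat P \<and>
            Q \<in> carrier_mat (dim_col M) (dim_col M) \<and> invertible_mat Q \<longrightarrow>
            no_zero_entry (map_mat Const P * M * map_mat Const Q))"

definition minor2 :: "'a::comm_ring_1 mat \<Rightarrow> nat \<Rightarrow> nat \<Rightarrow> 'a" where
  "minor2 M a b = M $$ (0, a) * M $$ (1, b) - M $$ (0, b) * M $$ (1, a)"

definition minors2 :: "'a::comm_ring_1 mat \<Rightarrow> 'a set" where
  "minors2 M = {minor2 M a b | a b. a < b \<and> b < dim_col M}"

section \<open>Graded free complexes and resolutions\<close>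

text \<open>A sequence \<open>F\<^sub>0 \<leftarrow> F\<^sub>1 \<leftarrow> \<dots>\<close> of graded free \<open>R\<close>-modules with chosen homogeneous bases:
  \<open>F\<^sub>i\<close> has basis \<open>gens F i\<close>, the generator \<open>b\<close> has degree \<open>gdeg F i b\<close>, and \<open>dmat F i\<close> is the
  matrix (row index first) of the differential from \<open>F\<^sub>i\<^sub>+\<^sub>1\<close> to \<open>F\<^sub>i\<close>. Elements of \<open>F\<^sub>i\<close> are
  coordinate functions vanishing off \<open>gens F i\<close>.\<close>

record ('b, 'n) free_seq =
  gens :: "nat \<Rightarrow> 'b set"
  gdeg :: "nat \<Rightarrow> 'b \<Rightarrow> int"
  dmat :: "nat \<Rightarrow> 'b \<Rightarrow> 'b \<Rightarrow> 'n ring_R"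

definition free_mod :: "('b, 'n) free_seq \<Rightarrow> nat \<Rightarrow> ('b \<Rightarrow> 'n ring_R) set" where
  "free_mod F i = {v. \<forall>b. b \<notin> gens F i \<longrightarrow> v b = 0}"

definition mat_act ::
    "'b set \<Rightarrow> 'c set \<Rightarrow> ('b \<Rightarrow> 'c \<Rightarrow> 'n ring_R) \<Rightarrow> ('c \<Rightarrow> 'n ring_R) \<Rightarrow> 'b \<Rightarrow> 'n ring_R" where
  "mat_act B C A v = (\<lambda>r. if r \<in> B then \<Sum>c\<in>C. A r c * v c else 0)"

definition boundary :: "('b, 'n) free_seq \<Rightarrow> nat \<Rightarrow> ('b \<Rightarrow> 'n ring_R) \<Rightarrow> 'b \<Rightarrow> 'n ring_R" where
  "boundary F i = mat_act (gens F i) (gens F (Suc i)) (dmat F i)"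

definition graded_free_complex :: "('b, 'n::finite) free_seq \<Rightarrow> bool" where
  "graded_free_complex F \<longleftrightarrow>
     (\<forall>i. finite (gens F i)) \<and>
     (\<forall>i. \<forall>r\<in>gens F i. \<forall>c\<in>gens F (Suc i).
        homogeneous (gdeg F (Suc i) c - gdeg F i r) (dmat F i r c)) \<and>
     (\<forall>i. \<forall>v\<in>free_mod F (Suc (Suc i)). boundary F i (boundary F (Suc i) v) = (\<lambda>_. 0))"

text \<open>Graded free resolution \<open>R = F\<^sub>0 \<leftarrow> F\<^sub>1 \<leftarrow> \<dots>\<close> of \<open>R/J\<close>, that is, \<open>F\<^sub>0 = R\<close> and the modules
  \<open>F\<^sub>1 \<leftarrow> F\<^sub>2 \<leftarrow> \<dots>\<close> resolve \<open>J\<close>.\<close>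

definition graded_free_resolution :: "('b, 'n::finite) free_seq \<Rightarrow> 'n ring_R set \<Rightarrow> bool" where
  "graded_free_resolution F J \<longleftrightarrow>
     graded_free_complex F \<and>
     (\<exists>e. gens F 0 = {e} \<and> gdeg F 0 e = 0 \<and> {boundary F 0 v e | v. v \<in> free_mod F 1} = J) \<and>
     (\<forall>i. {v \<in> free_mod F (Suc i). boundary F i v = (\<lambda>_. 0)} =
          boundary F (Suc i) ` free_mod F (Suc (Suc i)))"

text \<open>Minimality: the entries of all differentials lie in the irrelevant maximal ideal.\<close>

definition minimal_graded_free_resolution ::
    "('b, 'n::finite) free_seq \<Rightarrow> 'n ring_R set \<Rightarrow> bool" where
  "minimal_graded_free_resolution F J \<longleftrightarrow>
     graded_free_resolution F J \<and>
     (\<forall>i. \<forall>r\<in>gens F i. \<forall>c\<in>gens F (Suc i). Poly_Mapping.lookup (dmat F i r c) 0 = 0)"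

text \<open>\<open>E\<close> is isomorphic to a subcomplex of \<open>F\<close>: there is a degree-preserving, degreewise injective
  chain map \<open>\<phi>\<close> from \<open>E\<close> to \<open>F\<close>.\<close>

definition embeds_as_subcomplex ::
    "('c, 'n::finite) free_seq \<Rightarrow> ('b, 'n) free_seq \<Rightarrow> bool" where
  "embeds_as_subcomplex E F \<longleftrightarrow>
     (\<exists>\<phi> :: nat \<Rightarrow> 'b \<Rightarrow> 'c \<Rightarrow> 'n ring_R.
        (\<forall>i. \<forall>r\<in>gens F i. \<forall>c\<in>gens E i. homogeneous (gdeg E i c - gdeg F i r) (\<phi> i r c)) \<and>
        (\<forall>i. \<forall>v\<in>free_mod E (Suc i).
           boundary F i (mat_act (gens F (Suc i)) (gens E (Suc i)) (\<phi> (Suc i)) v) =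
           mat_act (gens F i) (gens E i) (\<phi> i) (boundary E i v)) \<and>
        (\<forall>i. inj_on (mat_act (gens F i) (gens E i) (\<phi> i)) (free_mod E i)))"

section \<open>The Eagon-Northcott complex of a \<open>2 \<times> n\<close> matrix\<close>

text \<open>For a \<open>2 \<times> n\<close> matrix \<open>M\<close> of linear forms: \<open>EN\<^sub>0 = R\<close>, and for \<open>i \<ge> 1\<close>,
  \<open>EN\<^sub>i = \<Lambda>\<^sup>i\<^sup>+\<^sup>1 R\<^sup>n \<otimes> D\<^sub>i\<^sub>-\<^sub>1 R\<^sup>2\<close>, generated in degree \<open>i + 1\<close>, where \<open>D\<close> denotes divided powers,
  the dual of \<open>Sym\<close>. The pair \<open>(S, u)\<close> stands for
  the basis element \<open>e\<^sub>S \<otimes> a\<^sup>(\<^sup>u\<^sup>) b\<^sup>(\<^sup>i\<^sup>-\<^sup>1\<^sup>-\<^sup>u\<^sup>)\<close>. The first differential sends \<open>e\<^sub>p \<and> e\<^sub>q\<close> (\<open>p < q\<close>)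
  to the minor on the columns \<open>p, q\<close>; the others are
  \<open>e\<^sub>S \<otimes> a\<^sup>(\<^sup>u\<^sup>) b\<^sup>(\<^sup>v\<^sup>) \<mapsto> \<Sum>\<^sub>j\<^sub>\<in>\<^sub>S \<plusminus> e\<^sub>S\<^sub>-\<^sub>{\<^sub>j\<^sub>} \<otimes> (M\<^sub>0\<^sub>j a\<^sup>(\<^sup>u\<^sup>-\<^sup>1\<^sup>) b\<^sup>(\<^sup>v\<^sup>) + M\<^sub>1\<^sub>j a\<^sup>(\<^sup>u\<^sup>) b\<^sup>(\<^sup>v\<^sup>-\<^sup>1\<^sup>))\<close>,
  with the Koszul sign and with terms of negative exponent omitted.\<close>

definition eagon_northcott :: "'n ring_R mat \<Rightarrow> (nat set \<times> nat, 'n) free_seq" where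
  "eagon_northcott M = \<lparr>
     gens = (\<lambda>i. if i = 0 then {({}, 0)}
                 else {(S, u). S \<subseteq> {..<dim_col M} \<and> card S = Suc i \<and> u < i}),
     gdeg = (\<lambda>i _. if i = 0 then 0 else int (Suc i)),
     dmat = (\<lambda>i (T, v) (S, u).
       if i = 0 then minor2 M (Min S) (Max S)
       else \<Sum>j\<in>S. if T = S - {j}
         then (- 1) ^ card {s\<in>S. s < j} *
              ((if u = Suc v then M $$ (0, j) else 0) + (if u = v then M $$ (1, j) else 0))
         else 0)\<rparr>"

end

theory Submission
  imports Defs "Jordan_Normal_Form.Determinant" "HOL-Computational_Algebra.Polynomial"
begin

text \<open>
  Let \<open>Q\<^sub>0\<close> and \<open>Q\<^sub>1\<close> be the products of the forms of two blocks of the net. Both have degree \<open>m\<close> and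
  vanish at the \<open>m\<close> base points on each line \<open>\<alpha>\<^sub>i = 0\<close>, so some combination of them vanishes on the line:
  \<open>u\<^sub>i Q\<^sub>1 - w\<^sub>i Q\<^sub>0 = \<alpha>\<^sub>i h\<^sub>i\<close>. If \<open>\<Sum> t\<^sub>i h\<^sub>i = 0\<close>, then \<open>Q\<^sub>1 \<Sum> t\<^sub>i u\<^sub>i / \<alpha>\<^sub>i = Q\<^sub>0 \<Sum> t\<^sub>i w\<^sub>i / \<alpha>\<^sub>i\<close>; hence
  the columns \<open>(\<Sum> t\<^sub>i u\<^sub>i y\<^sub>i, \<Sum> t\<^sub>i w\<^sub>i y\<^sub>i)\<close> form a matrix whose minors vanish at \<open>y\<^sub>i = 1 / \<alpha>\<^sub>i\<close>. As the
  \<open>h\<^sub>i\<close> are ternary forms of degree \<open>m - 1\<close>, there are \<open>k m - (m + 1 choose 2)\<close> independent such columns.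

  A quadric vanishing at \<open>y\<^sub>i = 1 / \<alpha>\<^sub>i\<close> is reduced to zero by three-term relations, which one finds by
  taking residues along the lines. The values at points off the arrangement are coordinates in which
  the matrix degenerates to one with columns \<open>x\<^sub>j (1, c\<^sub>j)\<close>, the \<open>c\<^sub>j\<close> being distinct. The
  Eagon-Northcott complex of the latter splits by multidegree into complexes of scalars, which are
  contracted by means of two columns, and exactness passes to the original matrix. Finally, the
  complex is linear and the ideal \<open>I\<close> has no elements of degree less than two, so the comparison
  map to a minimal resolution of \<open>I\<close> has constant entries; exactness and linearity make it injective.
\<close>

text \<open>As a rewrite rule in every commutative ring, \<open>ideal.scale_scale\<close> undoes \<open>mult.assoc\<close> and makes
  the simplifier loop with \<open>mult_ac\<close>.\<close>

declare ideal.scale_scale [simp del]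

section \<open>Koszul operators and complexes of scalars\<close>

text \<open>Exactness is not derived from a count of depth: preimages are constructed. The bridge is
  a dual basis. Solutions \<open>t j\<close> and points \<open>p i\<close> off the arrangement are
  chosen one at a time so that the first row of column \<open>j\<close> has the value 1 at
  \<open>p j\<close> and 0 at the other chosen points. Since the two rows of any column have the
  ratio \<open>Q1 / Q0\<close> at every point, the second row then has the values
  \<open>c j = Q1 (p j) / Q0 (p j)\<close> and 0, and as the pencil is not constant all
  \<open>c j\<close> can be made different. The points are completed to coordinates on all linear
  forms. The order in the extra coordinates is the filtration along which cycles are lifted, and the
  total degree bounds the number of rounds. The same values give 1-genericity: a combination of rows
  and columns is, at the reciprocals, the first row of a nonzero solution times
  \<open>(a * Q0 + b * Q1) / Q0\<close>.\<close>

definition ksign :: "nat \<Rightarrow> nat set \<Rightarrow> 'a::comm_ring_1" where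
  "ksign j T = (- 1) ^ card {s \<in> T. s < j}"

text \<open>Elements of the exterior algebra are coordinate functions on sets, \<open>v T\<close>
  being the coefficient of \<open>e_T\<close>. This is contraction with the covector
  \<open>X\<close>, read off at the target \<open>T\<close>, so the sum runs over the indices that
  can be put back.\<close>

definition contr ::
    "nat set \<Rightarrow> (nat \<Rightarrow> 'a::comm_ring_1) \<Rightarrow> (nat set \<Rightarrow> 'a) \<Rightarrow> nat set \<Rightarrow> 'a" where
  "contr A X v T = (\<Sum>j\<in>A - T. ksign j T * X j * v (insert j T))"

definition wedge :: "nat \<Rightarrow> (nat set \<Rightarrow> 'a::comm_ring_1) \<Rightarrow> nat set \<Rightarrow> 'a" where
  "wedge p y S = (if p \<in> S then ksign p (S - {p}) * y (S - {p}) else 0)"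

lemma ksign_square: "ksign j T * ksign j T = 1"
  by (simp add: ksign_def flip: power_mult_distrib)

lemma ksign_insert:
  assumes "j \<notin> T"
  shows "ksign l (insert j T) = (if j < l then - ksign l T else ksign l T)"
proof -
  have fin: "finite {s \<in> T. s < l}" by (rule finite_subset[of _ "{..<l}"]) auto
  have "{s \<in> insert j T. s < l} = (if j < l then insert j {s \<in> T. s < l} else {s \<in> T. s < l})"
    by auto
  then show ?thesis using assms fin by (simp add: ksign_def)
qed

text \<open>Of the signs for removing two indices, only that of the larger one depends on whether
  the other is still present.\<close>

lemma ksign_swap:
  assumes "j \<notin> T" "l \<notin> T" "j \<noteq> l"
  shows "ksign j T * ksign l (insert j T) = - (ksign l T * ksign j (insert l T))"
  using assms mult.commute[of "ksign j T" "ksign l T"]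
  by (cases "j < l") (simp_all add: ksign_insert)

text \<open>The diagonal is treated separately because antisymmetry alone gives only
  \<open>f j j + f j j = 0\<close>, and the group may have 2-torsion.\<close>

lemma sum_antisym:
  fixes f :: "'i \<Rightarrow> 'i \<Rightarrow> 'a::ab_group_add"
  assumes "finite A" "\<And>j l. j \<in> A \<Longrightarrow> l \<in> A \<Longrightarrow> f j l = - f l j" "\<And>j. f j j = 0"
  shows "(\<Sum>j\<in>A. \<Sum>l\<in>A. f j l) = 0"
  using assms
proof (induction A)
  case (insert a A)
  have 1: "(\<Sum>l\<in>A. f a l) = (\<Sum>j\<in>A. - f j a)"
    by (rule sum.cong[OF refl], rule insert.prems(1)) auto
  have 2: "(\<Sum>j\<in>A. \<Sum>l\<in>A. f j l) = 0"
    by (rule insert.IH) (use insert.prems in blast)+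
  show ?case using 1 2 insert.hyps insert.prems(2) by (simp add: sum.distrib sum_negf)
qed simp

text \<open>One antisymmetric double sum serves twice: exchanging \<open>X\<close> and
  \<open>Y\<close> gives anticommutation, and \<open>X = Y\<close> gives square zero. The second
  does not follow from the first where 2 is a zero divisor.\<close>

lemma contr_contr_sum:
  assumes "finite A"
  obtains f where
    "\<And>X Y. contr A X (contr A Y v) T = (\<Sum>j\<in>A - T. \<Sum>l\<in>A - T. f X Y j l)"
    "\<And>X Y j l. j \<in> A - T \<Longrightarrow> l \<in> A - T \<Longrightarrow> f X Y j l = - f Y X l j"
    "\<And>X Y j. f X Y j j = 0"
proof -
  define f where "f X Y j l = (if j = l then 0 else
      ksign j T * X j * (ksign l (insert j T) * Y l * v (insert l (insert j T))))"
    for X Y :: "nat \<Rightarrow> 'a" and j l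
  have *: "contr A X (contr A Y v) T = (\<Sum>j\<in>A - T. \<Sum>l\<in>A - T. f X Y j l)" for X Y
    unfolding contr_def sum_distrib_left
  proof (rule sum.cong[OF refl])
    fix j assume j: "j \<in> A - T"
    have "(\<Sum>l\<in>A - T. f X Y j l) = f X Y j j + (\<Sum>l\<in>A - insert j T. f X Y j l)"
      by (subst Diff_insert, rule sum.remove) (use assms j in auto)
    also have "f X Y j j = 0" by (simp add: f_def)
    also have "(\<Sum>l\<in>A - insert j T. f X Y j l)
        = (\<Sum>l\<in>A - insert j T. ksign j T * X j * (ksign l (insert j T) * Y l * v (insert l (insert j T))))"
      by (rule sum.cong[OF refl]) (simp add: f_def)
    finally show "(\<Sum>l\<in>A - insert j T. ksign j T * X j * (ksign l (insert j T) * Y l * v (insert l (insert j T))))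
        = (\<Sum>l\<in>A - T. f X Y j l)" by simp
  qed
  have "f X Y j l = - f Y X l j" if "j \<in> A - T" "l \<in> A - T" for X Y j l
  proof (cases "j = l")
    case False
    have "f X Y j l = (ksign j T * ksign l (insert j T)) * (X j * Y l * v (insert l (insert j T)))"
      using False by (simp add: f_def mult_ac)
    also have "\<dots> = - (ksign l T * ksign j (insert l T)) * (X j * Y l * v (insert j (insert l T)))"
      using that False by (subst ksign_swap) (auto simp: insert_commute)
    also have "\<dots> = - f Y X l j"
      using False by (simp add: f_def mult_ac)
    finally show ?thesis .
  qed (simp add: f_def)
  then show ?thesis by (rule that[of f, OF *]) (simp_all add: f_def)
qed

lemma contr_contr:
  assumes "finite A"
  shows "contr A X (contr A Y v) T = - contr A Y (contr A X v) T"
proof (rule contr_contr_sum[OF assms, of v T])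
  fix f assume f: "\<And>X Y. contr A X (contr A Y v) T = (\<Sum>j\<in>A - T. \<Sum>l\<in>A - T. f X Y j l)"
    "\<And>X Y j l. j \<in> A - T \<Longrightarrow> l \<in> A - T \<Longrightarrow> f X Y j l = - f Y X l j"
  have "(\<Sum>j\<in>A - T. \<Sum>l\<in>A - T. f X Y j l) = (\<Sum>j\<in>A - T. \<Sum>l\<in>A - T. - f Y X l j)"
    by (intro sum.cong refl f(2))
  also have "\<dots> = (\<Sum>l\<in>A - T. \<Sum>j\<in>A - T. - f Y X l j)"
    by (rule sum.swap)
  finally show ?thesis by (simp add: f(1) sum_negf)
qed

lemma contr_contr_same:
  assumes "finite A"
  shows "contr A X (contr A X v) T = 0"
proof (rule contr_contr_sum[OF assms, of v T])
  fix f assume f: "\<And>X Y. contr A X (contr A Y v) T = (\<Sum>j\<in>A - T. \<Sum>l\<in>A - T. f X Y j l)"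
    "\<And>X Y j l. j \<in> A - T \<Longrightarrow> l \<in> A - T \<Longrightarrow> f X Y j l = - f Y X l j" "\<And>X Y j. f X Y j j = 0"
  show ?thesis unfolding f(1) by (rule sum_antisym, use assms in simp, rule f(2), assumption+, rule f(3))
qed

lemma contr_0 [simp]: "contr A X (\<lambda>_. 0) = (\<lambda>_. 0)"
  by (simp add: contr_def fun_eq_iff)

lemma contr_add: "contr A X (\<lambda>S. v S + w S) T = contr A X v T + contr A X w T"
  by (simp add: contr_def algebra_simps sum.distrib)

lemma contr_diff: "contr A X (\<lambda>S. v S - w S) T = contr A X v T - contr A X w T"
  by (simp add: contr_def algebra_simps sum_subtractf)

lemma contr_scale: "contr A X (\<lambda>S. a * v S) T = a * contr A X v T"
  by (simp add: contr_def algebra_simps sum_distrib_left)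

lemma wedge_0 [simp]: "wedge p (\<lambda>_. 0) = (\<lambda>_. 0)"
  by (simp add: wedge_def fun_eq_iff)

lemma wedge_add: "wedge p (\<lambda>S. v S + w S) T = wedge p v T + wedge p w T"
  by (simp add: wedge_def algebra_simps)

lemma wedge_diff: "wedge p (\<lambda>S. v S - w S) T = wedge p v T - wedge p w T"
  by (simp add: wedge_def algebra_simps)

lemma wedge_scale: "wedge p (\<lambda>S. a * v S) T = a * wedge p v T"
  by (simp add: wedge_def algebra_simps)

text \<open>Contraction is an antiderivation, so multiplication by \<open>e_p\<close> is a
  contracting homotopy up to the factor \<open>X p\<close>. For \<open>p \<in> T\<close> the term
  \<open>X p * y T\<close> is the summand of index \<open>p\<close> inside the inner
  contraction.\<close>

lemma contr_wedge:
  assumes "finite A" "p \<in> A"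
  shows "contr A X (wedge p y) T = X p * y T - wedge p (contr A X y) T"
proof (cases "p \<in> T")
  case False
  have "contr A X (wedge p y) T = ksign p T * X p * wedge p y (insert p T)"
    unfolding contr_def
    by (subst sum.remove[of _ p]) (use assms False in \<open>auto simp: wedge_def intro!: sum.neutral\<close>)
  also have "\<dots> = (ksign p T * ksign p T) * (X p * y T)"
    using False by (simp add: wedge_def algebra_simps)
  finally show ?thesis using False by (simp add: wedge_def ksign_square)
next
  case True
  define T' where "T' = T - {p}"
  have T: "T = insert p T'" and p: "p \<notin> T'" using True by (auto simp: T'_def)
  have 1: "contr A X (wedge p y) T = (\<Sum>j\<in>A - T. - (ksign p T' * (ksign j T' * X j * y (insert j T'))))"
    unfolding contr_def
  proof (rule sum.cong[OF refl])
    fix j assume j: "j \<in> A - T"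
    then have jp: "j \<noteq> p" "j \<notin> T'" using T by auto
    have "insert j T - {p} = insert j T'" using jp p by (auto simp: T'_def)
    then have "ksign j T * X j * wedge p y (insert j T)
        = (ksign j (insert p T') * ksign p (insert j T')) * (X j * y (insert j T'))"
      using True T by (simp add: wedge_def algebra_simps)
    also have "ksign j (insert p T') * ksign p (insert j T') = - (ksign p T' * ksign j T' :: 'a)"
      using jp p mult.commute[of "ksign p T' :: 'a" "ksign j T'"]
      by (cases "p < j") (simp_all add: ksign_insert)
    finally show "ksign j T * X j * wedge p y (insert j T)
        = - (ksign p T' * (ksign j T' * X j * y (insert j T')))"
      by (simp add: algebra_simps)
  qed
  have "wedge p (contr A X y) T = ksign p T' * contr A X y T'"
    using True by (simp add: wedge_def T'_def)
  also have "contr A X y T' = ksign p T' * X p * y T + (\<Sum>j\<in>A - T. ksign j T' * X j * y (insert j T'))"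
    unfolding contr_def
    by (subst sum.remove[of _ p]) (use assms p in \<open>auto simp: T intro!: sum.cong\<close>)
  also have "ksign p T' * \<dots> = (ksign p T' * ksign p T') * (X p * y T)
      + (\<Sum>j\<in>A - T. ksign p T' * (ksign j T' * X j * y (insert j T')))"
    by (simp add: algebra_simps sum_distrib_left)
  finally show ?thesis by (simp add: 1 sum_negf ksign_square)
qed

lemma contr_wedge':
  assumes "finite A" "p \<in> A"
  shows "contr A X (wedge p y) = (\<lambda>T. X p * y T - wedge p (contr A X y) T)"
  using contr_wedge[OF assms] by blast

lemma contr_cong:
  assumes "\<And>j. j \<in> A - T \<Longrightarrow> v (insert j T) = w (insert j T)"
  shows "contr A X v T = contr A X w T"
  unfolding contr_def by (rule sum.cong) (use assms in auto)

section \<open>Chains of fixed rank and the differential on them\<close>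

definition chain_on :: "nat set \<Rightarrow> nat \<Rightarrow> (nat set \<Rightarrow> 'a::zero) \<Rightarrow> bool" where
  "chain_on A r v \<longleftrightarrow> (\<forall>S. v S \<noteq> 0 \<longrightarrow> S \<subseteq> A \<and> card S = r)"

lemma chain_on_contr:
  assumes "finite A" "chain_on A (Suc r) v"
  shows "chain_on A r (contr A X v)"
  unfolding chain_on_def
proof (intro allI impI)
  fix S assume "contr A X v S \<noteq> 0"
  then have "(\<Sum>j\<in>A - S. ksign j S * X j * v (insert j S)) \<noteq> 0" by (simp add: contr_def)
  then obtain j where j: "j \<in> A - S" "ksign j S * X j * v (insert j S) \<noteq> 0"
    by (rule sum.not_neutral_contains_not_neutral)
  then have "v (insert j S) \<noteq> 0" by auto
  then have "insert j S \<subseteq> A" "card (insert j S) = Suc r" using assms(2) unfolding chain_on_def by blast+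
  moreover from this(1) have "finite S" using finite_subset[OF _ assms(1), of "insert j S"] by simp
  ultimately show "S \<subseteq> A \<and> card S = r" using j by simp
qed

lemma chain_on_wedge:
  assumes "finite A" "p \<in> A" "chain_on A r v"
  shows "chain_on A (Suc r) (wedge p v)"
  unfolding chain_on_def
proof (intro allI impI)
  fix S assume "wedge p v S \<noteq> 0"
  then have p: "p \<in> S" "v (S - {p}) \<noteq> 0" by (auto simp: wedge_def split: if_splits)
  then have S: "S - {p} \<subseteq> A" "card (S - {p}) = r" using assms(3) by (auto simp: chain_on_def)
  then have "S \<subseteq> A" using assms by auto
  then show "S \<subseteq> A \<and> card S = Suc r"
    using S p card_Suc_Diff1[of S p] finite_subset[OF _ assms(1), of S] by simp
qed

lemma chain_on_add: "chain_on A r v \<Longrightarrow> chain_on A r w \<Longrightarrow> chain_on A r (\<lambda>S. v S + w S :: 'a::monoid_add)"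
  unfolding chain_on_def by force

lemma chain_on_diff: "chain_on A r v \<Longrightarrow> chain_on A r w \<Longrightarrow> chain_on A r (\<lambda>S. v S - w S :: 'a::group_add)"
  unfolding chain_on_def by force

lemma chain_on_scale: "chain_on A r v \<Longrightarrow> chain_on A r (\<lambda>S. a * v S :: 'a::mult_zero)"
  unfolding chain_on_def by (metis mult_zero_right)

text \<open>The differential of the tail \<open>\<Lambda>\<^sup>i\<^sup>+\<^sup>1 \<otimes> D\<^sub>i\<^sub>-\<^sub>1\<close> of the Eagon-Northcott complex; the index \<open>u\<close> is the
  exponent of \<open>a\<close> in \<open>D\<close>, the exponent of \<open>b\<close> being determined by the degree.\<close>

definition en_diff :: "nat set \<Rightarrow> (nat \<Rightarrow> 'a::comm_ring_1) \<Rightarrow> (nat \<Rightarrow> 'a) \<Rightarrow>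
    (nat \<Rightarrow> nat set \<Rightarrow> 'a) \<Rightarrow> nat \<Rightarrow> nat set \<Rightarrow> 'a" where
  "en_diff A X Y v u T = contr A X (v (Suc u)) T + contr A Y (v u) T"

text \<open>The squares of both contractions vanish, and the two mixed terms, both taken at exponent
  \<open>Suc u\<close>, cancel by anticommutation.\<close>

lemma en_diff_en_diff:
  assumes "finite A"
  shows "en_diff A X Y (en_diff A X Y v) u T = 0"
proof -
  have "contr A X (en_diff A X Y v (Suc u)) T = contr A X (contr A Y (v (Suc u))) T"
    unfolding en_diff_def by (simp add: contr_add contr_contr_same[OF assms])
  moreover have "contr A Y (en_diff A X Y v u) T = contr A Y (contr A X (v (Suc u))) T"
    unfolding en_diff_def by (simp add: contr_add contr_contr_same[OF assms])
  ultimately show ?thesis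
    unfolding en_diff_def[of A X Y "en_diff A X Y v"] by (simp add: contr_contr[OF assms, of X Y])
qed

text \<open>The double contraction is, up to sign, the map to the minors. After the differential
  each term contracts twice with \<open>X\<close> or twice with \<open>Y\<close>, up to
  reordering.\<close>

lemma augmentation_en_diff:
  assumes "finite A"
  shows "contr A X (contr A Y (en_diff A X Y v u)) T = 0"
proof -
  have "contr A Y (en_diff A X Y v u) = contr A Y (contr A X (v (Suc u)))"
    unfolding en_diff_def by (simp add: contr_add contr_contr_same[OF assms] fun_eq_iff)
  also have "\<dots> = (\<lambda>T. (- 1) * contr A X (contr A Y (v (Suc u))) T)"
    using contr_contr[OF assms, of Y X] by (simp add: fun_eq_iff)
  finally show ?thesis
    by (simp only: contr_scale contr_contr_same[OF assms] mult_zero_right)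
qed

lemma en_diff_wedge:
  assumes "finite A" "p \<in> A"
  shows "en_diff A X Y (\<lambda>u. wedge p (y u)) u T
    = X p * y (Suc u) T + Y p * y u T - wedge p (en_diff A X Y y u) T"
proof -
  have "wedge p (en_diff A X Y y u) T = wedge p (contr A X (y (Suc u))) T + wedge p (contr A Y (y u)) T"
    unfolding en_diff_def by (rule wedge_add)
  then show ?thesis by (simp add: en_diff_def contr_wedge[OF assms])
qed

lemma en_diff_diff:
  "en_diff A X Y (\<lambda>u S. v u S - w u S) u T = en_diff A X Y v u T - en_diff A X Y w u T"
  by (simp add: en_diff_def contr_diff)

lemma en_diff_add:
  "en_diff A X Y (\<lambda>u S. v u S + w u S) u T = en_diff A X Y v u T + en_diff A X Y w u T"
  by (simp add: en_diff_def contr_add)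

text \<open>Two columns \<open>p\<close>, \<open>q\<close> with \<open>c p \<noteq> c q\<close> make the complex of scalars contractible: the
  contraction by \<open>(1, c p)\<close>, which sends \<open>f\<close> to \<open>\<lambda>u. f (Suc u) + c p * f u\<close>, is onto on divided powers,
  the contraction by \<open>(1, c q)\<close> is onto on its kernel, and their common kernel is \<open>D\<^sub>0\<close>.\<close>

lemma scalar_en_exact:
  fixes c :: "nat \<Rightarrow> 'a::field" and v :: "nat \<Rightarrow> nat set \<Rightarrow> 'a"
  assumes B: "finite B" "p \<in> B" "q \<in> B" "c p \<noteq> c q" and i: "1 \<le> i"
    and chain: "\<And>u. u < i \<Longrightarrow> chain_on B (Suc i) (v u)"
    and cycle: "\<And>u T. Suc u < i \<Longrightarrow> en_diff B (\<lambda>_. 1) c v u T = 0"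
    and aug: "i = 1 \<Longrightarrow> contr B (\<lambda>_. 1) (contr B c (v 0)) {} = 0"
  shows "\<exists>w. (\<forall>u<Suc i. chain_on B (Suc (Suc i)) (w u)) \<and>
             (\<forall>u<i. \<forall>T. en_diff B (\<lambda>_. 1) c w u T = v u T)"
proof -
  let ?D = "en_diff B (\<lambda>_. 1) c"
  let ?e = "c q - c p"
  have e: "?e \<noteq> 0" using B by simp
  \<comment> \<open>Solves \<open>y (Suc u) + c p * y u = v u\<close> by recursion, which inverts
    the contraction with column \<open>p\<close> on divided powers; the initial value is free and
    taken to be zero.\<close>
  define y where "y = rec_nat (\<lambda>_. 0) (\<lambda>u f S. v u S - c p * f S)"
  have y0: "y 0 = (\<lambda>_. 0)" and ySuc: "y (Suc u) = (\<lambda>S. v u S - c p * y u S)" for u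
    by (simp_all add: y_def)
  have y_chain: "chain_on B (Suc i) (y u)" if "u \<le> i" for u
    using that
  proof (induction u)
    case (Suc u)
    then show ?case unfolding ySuc by (intro chain_on_diff chain_on_scale chain) auto
  qed (simp add: y0 chain_on_def)
  \<comment> \<open>\<open>g\<close> measures how far \<open>wedge p y\<close> is from being a
    preimage. As \<open>v\<close> is a cycle, \<open>g\<close> lies in the kernel of the contraction
    with column \<open>p\<close>, hence is geometric in \<open>u\<close> with ratio
    \<open>- c p\<close>.\<close>
  define g where "g = ?D y"
  have g_chain: "chain_on B i (g u)" if "u < i" for u
    unfolding g_def en_diff_def using that y_chain[of u] y_chain[of "Suc u"]
    by (intro chain_on_add chain_on_contr B) auto
  have Dg: "?D g u T = 0" for u T unfolding g_def by (rule en_diff_en_diff[OF B(1)])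
  have Dwy: "?D (\<lambda>u. wedge p (y u)) u T = v u T - wedge p (g u) T" for u T
    by (simp add: en_diff_wedge[OF B(1,2)] ySuc g_def)
  have v_eq: "v u = (\<lambda>T. ?D (\<lambda>u. wedge p (y u)) u T + wedge p (g u) T)" for u
    by (simp add: Dwy)
  have g_step: "g (Suc u) T = - c p * g u T" if "Suc u < i" for u T
  proof -
    have "0 = ?D v u T" using cycle[OF that] by simp
    also have "\<dots> = ?D (\<lambda>u T. ?D (\<lambda>u. wedge p (y u)) u T + wedge p (g u) T) u T"
      by (rule arg_cong[where f = "\<lambda>f. ?D f u T"], rule ext, rule v_eq)
    also have "\<dots> = ?D (?D (\<lambda>u. wedge p (y u))) u T + ?D (\<lambda>u. wedge p (g u)) u T"
      by (rule en_diff_add)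
    also have "\<dots> = g (Suc u) T + c p * g u T - wedge p (?D g u) T"
      by (simp only: en_diff_en_diff[OF B(1)] en_diff_wedge[OF B(1,2)]) simp
    also have "?D g u = (\<lambda>_. 0)" by (simp add: Dg fun_eq_iff)
    finally show ?thesis by (simp add: eq_neg_iff_add_eq_0)
  qed
  have g_pow: "g u T = (- c p) ^ u * g 0 T" if "u < i" for u T
    using that by (induction u) (simp_all add: g_step)
  \<comment> \<open>On geometric sequences of ratio \<open>- c p\<close> the contraction with column
    \<open>q\<close> is multiplication by \<open>c q - c p\<close>, so dividing by it gives a
    preimage of \<open>g\<close>.\<close>
  define z where "z u T = (- c p) ^ u / ?e * g 0 T" for u T
  have z_chain: "chain_on B i (z u)" for u
    unfolding z_def using g_chain[of 0] i by (intro chain_on_scale) auto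
  have z_p: "z (Suc u) T + c p * z u T = 0" for u T
    by (simp add: z_def)
  have z_q: "z (Suc u) T + c q * z u T = g u T" if "u < i" for u T
  proof -
    have "z (Suc u) T + c q * z u T = ?e * z u T" using z_p[of u T] by (simp add: algebra_simps eq_neg_iff_add_eq_0)
    also have "\<dots> = (- c p) ^ u * g 0 T" using e by (simp add: z_def)
    finally show ?thesis using g_pow[OF that] by simp
  qed
  have Dwwz: "?D (\<lambda>u. wedge p (wedge q (z u))) u T = - wedge p (g u) T + wedge p (wedge q (?D z u)) T"
    if "u < i" for u T
  proof -
    have 1: "wedge q (z (Suc u)) T + c p * wedge q (z u) T = 0"
      using z_p by (simp flip: wedge_scale wedge_add)
    have 2: "?D (\<lambda>u. wedge q (z u)) u = (\<lambda>T. g u T - wedge q (?D z u) T)"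
      using z_q[OF that] by (simp add: en_diff_wedge[OF B(1,3)] fun_eq_iff)
    show ?thesis
      unfolding en_diff_wedge[OF B(1,2)] 2 wedge_diff using 1 by simp
  qed
  define w where "w u S = wedge p (y u) S - wedge p (wedge q (z u)) S" for u S
  have w_chain: "chain_on B (Suc (Suc i)) (w u)" if "u < Suc i" for u
    unfolding w_def using y_chain[of u] z_chain[of u] that
    by (intro chain_on_diff chain_on_wedge B) auto
  have Dw: "?D w u T = v u T - wedge p (wedge q (?D z u)) T" if "u < i" for u T
    unfolding w_def en_diff_diff using that by (simp add: Dwy Dwwz)
  \<comment> \<open>The last error term vanishes: for \<open>i > 1\<close> because
    \<open>?D z u\<close> is a multiple of \<open>?D g 0\<close>, for \<open>i = 1\<close> because
    it is a scalar in rank 0 which the augmentation multiplies by \<open>c p - c q\<close>.\<close>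
  have Dz: "?D z u = (\<lambda>_. 0)" if "u < i" for u
  proof (cases "i = 1")
    case False
    have "?D z u T = (- c p) ^ u / ?e * (contr B (\<lambda>_. 1) (\<lambda>S. - c p * g 0 S) T + contr B c (g 0) T)" for T
    proof -
      have "z (Suc u) = (\<lambda>S. (- c p) ^ u / ?e * (- c p * g 0 S))" "z u = (\<lambda>S. (- c p) ^ u / ?e * g 0 S)"
        by (simp_all add: z_def fun_eq_iff)
      then show ?thesis unfolding en_diff_def by (simp only: contr_scale distrib_left)
    qed
    moreover have "g (Suc 0) = (\<lambda>S. - c p * g 0 S)" using g_step[of 0] False i by (auto simp: fun_eq_iff)
    ultimately have "?D z u T = (- c p) ^ u / ?e * ?D g 0 T" for T by (simp add: en_diff_def)
    then show ?thesis by (simp add: Dg fun_eq_iff)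
  next
    case True
    define s where "s = ?D z 0"
    have u: "u = 0" using that True by simp
    have "chain_on B 0 s"
      unfolding s_def en_diff_def using z_chain True by (intro chain_on_add chain_on_contr B) auto
    then have s: "s T = 0" if "T \<noteq> {}" for T
      using that finite_subset[OF _ B(1)] by (auto simp: chain_on_def)
    have cs: "contr B X s = (\<lambda>_. 0)" for X
      by (rule ext) (simp add: contr_def s)
    have "v 0 = (\<lambda>T. ?D w 0 T + wedge p (wedge q s) T)"
      using Dw[of 0] True by (simp add: s_def)
    then have "contr B c (v 0) T = contr B c (?D w 0) T + contr B c (wedge p (wedge q s)) T" for T
      by (simp only: contr_add)
    then have "contr B c (v 0) = (\<lambda>T. contr B c (?D w 0) T + contr B c (wedge p (wedge q s)) T)" ..
    then have "contr B (\<lambda>_. 1) (contr B c (v 0)) {}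
        = contr B (\<lambda>_. 1) (contr B c (wedge p (wedge q s))) {}"
      by (simp add: contr_add augmentation_en_diff[OF B(1)])
    also have "contr B c (wedge p (wedge q s)) = (\<lambda>T. c p * wedge q s T - c q * wedge p s T)"
      unfolding contr_wedge'[OF B(1,2)] contr_wedge'[OF B(1,3)] cs by (simp add: wedge_diff wedge_scale fun_eq_iff)
    also have "contr B (\<lambda>_. 1) \<dots> {}
        = c p * contr B (\<lambda>_. 1) (wedge q s) {} - c q * contr B (\<lambda>_. 1) (wedge p s) {}"
      by (simp only: contr_diff contr_scale)
    also have "contr B (\<lambda>_. 1) (wedge q s) {} = s {}"
      by (simp add: contr_wedge[OF B(1,3)] cs)
    also have "contr B (\<lambda>_. 1) (wedge p s) {} = s {}"
      by (simp add: contr_wedge[OF B(1,2)] cs)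
    also have "c p * s {} - c q * s {} = (c p - c q) * s {}"
      by (rule left_diff_distrib[symmetric])
    finally have "s {} = 0" using aug True B by simp
    then have "s T = 0" for T using s by (cases "T = {}") simp_all
    then have "s = (\<lambda>_. 0)" ..
    then show ?thesis unfolding u s_def .
  qed
  have "?D w u T = v u T" if "u < i" for u T
    using Dw[OF that] Dz[OF that] by simp
  with w_chain show ?thesis by blast
qed

section \<open>Coefficients and degrees of polynomials\<close>

lemma Const_0 [simp]: "Const 0 = 0" by (simp add: Const_def)
lemma Const_1 [simp]: "Const 1 = 1" by (simp add: Const_def)
lemma Const_add: "Const (a + b) = Const a + Const b" by (simp add: Const_def single_add)
lemma Const_diff: "Const (a - b) = Const a - Const b" by (simp add: Const_def single_diff)
lemma Const_uminus: "Const (- a) = - Const a" by (simp add: Const_def single_uminus)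
lemma Const_mult: "Const (a * b) = Const a * Const b" by (simp add: Const_def mult_single)
lemma Const_sum: "Const (sum f A) = (\<Sum>x\<in>A. Const (f x))"
  by (induction A rule: infinite_finite_induct) (simp_all add: Const_add)

lemma lookup_Const: "Poly_Mapping.lookup (Const a) t = (if t = 0 then a else 0)"
  by (simp add: Const_def lookup_single when_def)

lemma lookup_Const_mult: "Poly_Mapping.lookup (Const a * p) t = a * Poly_Mapping.lookup p t"
  unfolding Const_def mult_map_scale_conv_mult[symmetric] by (simp add: Poly_Mapping.map.rep_eq when_def)

lemma poly_mapping_sum_monomials:
  "p = (\<Sum>t\<in>Poly_Mapping.keys p. Poly_Mapping.single t (Poly_Mapping.lookup p t))"
  by (rule poly_mapping_eqI)
     (auto simp: lookup_sum lookup_single when_def in_keys_iff if_distrib[of "\<lambda>f. f _"] cong: if_cong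
       intro!: sum.neutral)

lemma lookup_single_mult:
  fixes s :: "'a::cancel_comm_monoid_add" and a :: "'b::comm_semiring_0"
  shows "Poly_Mapping.lookup (Poly_Mapping.single s a * p) (s + t) = a * Poly_Mapping.lookup p t"
proof -
  have "Poly_Mapping.single s a * p =
      (\<Sum>t'\<in>Poly_Mapping.keys p. Poly_Mapping.single (s + t') (a * Poly_Mapping.lookup p t'))"
    by (subst poly_mapping_sum_monomials[of p]) (simp add: sum_distrib_left mult_single)
  then show ?thesis
    by (simp add: lookup_sum lookup_single when_def in_keys_iff)
qed

lemma lookup_Var_mult:
  "Poly_Mapping.lookup (Var i * p) t =
    (if Poly_Mapping.lookup t i \<ge> 1 then Poly_Mapping.lookup p (t - Poly_Mapping.single i 1) else 0)"
proof (cases "Poly_Mapping.lookup t i \<ge> 1")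
  case True
  then have t: "t = Poly_Mapping.single i 1 + (t - Poly_Mapping.single i 1)"
    by (intro poly_mapping_eqI) (auto simp: lookup_add lookup_minus lookup_single when_def)
  show ?thesis using True unfolding Var_def
    by (subst t, subst lookup_single_mult) simp
next
  case False
  have "t \<notin> Poly_Mapping.keys (Var i * p)"
  proof
    assume "t \<in> Poly_Mapping.keys (Var i * p)"
    then obtain s where "t = Poly_Mapping.single i 1 + s"
      using keys_mult[of "Var i" p] by (auto simp: Var_def)
    then show False using False by (simp add: lookup_add)
  qed
  then show ?thesis using False by (simp add: in_keys_iff)
qed

section \<open>Degree and order with respect to a set of variables\<close>

definition wdeg :: "'n set \<Rightarrow> ('n::finite \<Rightarrow>\<^sub>0 nat) \<Rightarrow> nat" where
  "wdeg W t = (\<Sum>i\<in>W. Poly_Mapping.lookup t i)"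

lemma total_deg_eq_wdeg: "total_deg t = wdeg UNIV t"
  by (simp add: total_deg_def wdeg_def)

lemma wdeg_add [simp]: "wdeg W (s + t) = wdeg W s + wdeg W t"
  by (simp add: wdeg_def lookup_add sum.distrib)

lemma wdeg_0 [simp]: "wdeg W 0 = 0"
  by (simp add: wdeg_def)

lemma wdeg_single [simp]: "wdeg W (Poly_Mapping.single i a) = (if i \<in> W then a else 0)"
  by (simp add: wdeg_def lookup_single when_def)

lemma wdeg_mono: "W \<subseteq> W' \<Longrightarrow> wdeg W t \<le> wdeg W' t"
  unfolding wdeg_def by (rule sum_mono2) auto

lemma wdeg_sum: "wdeg W (sum f A) = (\<Sum>x\<in>A. wdeg W (f x))"
  by (induction A rule: infinite_finite_induct) simp_all

text \<open>Membership in the \<open>k\<close>-th power of the ideal generated by the variables in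
  \<open>W\<close>: the irrelevant ideal for \<open>W = UNIV\<close>, the lifting filtration for the
  set of extra coordinates.\<close>

definition order_ge :: "'n set \<Rightarrow> nat \<Rightarrow> 'n::finite ring_R \<Rightarrow> bool" where
  "order_ge W k p \<longleftrightarrow> (\<forall>t\<in>Poly_Mapping.keys p. k \<le> wdeg W t)"

definition degree_le :: "nat \<Rightarrow> 'n::finite ring_R \<Rightarrow> bool" where
  "degree_le D p \<longleftrightarrow> (\<forall>t\<in>Poly_Mapping.keys p. wdeg UNIV t \<le> D)"

lemma order_ge_0 [simp]: "order_ge W k 0" by (simp add: order_ge_def)
lemma degree_le_0 [simp]: "degree_le D 0" by (simp add: degree_le_def)
lemma order_ge_zero [simp]: "order_ge W 0 p" by (simp add: order_ge_def)

lemma order_ge_add: "order_ge W k p \<Longrightarrow> order_ge W k q \<Longrightarrow> order_ge W k (p + q)"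
  unfolding order_ge_def using keys_add[of p q] by blast
lemma degree_le_add: "degree_le k p \<Longrightarrow> degree_le k q \<Longrightarrow> degree_le k (p + q)"
  unfolding degree_le_def using keys_add[of p q] by blast
lemma order_ge_diff: "order_ge W k p \<Longrightarrow> order_ge W k q \<Longrightarrow> order_ge W k (p - q)"
  unfolding order_ge_def using Poly_Mapping.keys_diff[of p q] by blast
lemma degree_le_diff: "degree_le k p \<Longrightarrow> degree_le k q \<Longrightarrow> degree_le k (p - q)"
  unfolding degree_le_def using Poly_Mapping.keys_diff[of p q] by blast
lemma order_ge_sum: "(\<And>x. x \<in> A \<Longrightarrow> order_ge W k (f x)) \<Longrightarrow> order_ge W k (sum f A)"
  by (induction A rule: infinite_finite_induct) (auto intro: order_ge_add)
lemma degree_le_sum: "(\<And>x. x \<in> A \<Longrightarrow> degree_le k (f x)) \<Longrightarrow> degree_le k (sum f A)"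
  by (induction A rule: infinite_finite_induct) (auto intro: degree_le_add)

lemma order_ge_mult:
  assumes "order_ge W k p" "order_ge W l q"
  shows "order_ge W (k + l) (p * q)"
  unfolding order_ge_def
proof
  fix t assume "t \<in> Poly_Mapping.keys (p * q)"
  then obtain a b where "t = a + b" "a \<in> Poly_Mapping.keys p" "b \<in> Poly_Mapping.keys q"
    using keys_mult[of p q] by auto
  then show "k + l \<le> wdeg W t" using assms by (auto simp: order_ge_def intro: add_mono)
qed

lemma degree_le_mult:
  assumes "degree_le k p" "degree_le l q"
  shows "degree_le (k + l) (p * q)"
  unfolding degree_le_def
proof
  fix t assume "t \<in> Poly_Mapping.keys (p * q)"
  then obtain a b where "t = a + b" "a \<in> Poly_Mapping.keys p" "b \<in> Poly_Mapping.keys q"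
    using keys_mult[of p q] by auto
  then show "wdeg UNIV t \<le> k + l" using assms by (auto simp: degree_le_def intro: add_mono)
qed

lemma order_ge_lookup: "order_ge W k p \<Longrightarrow> wdeg W t < k \<Longrightarrow> Poly_Mapping.lookup p t = 0"
  unfolding order_ge_def by (meson in_keys_iff not_less)

lemma keys_ksign_mult: "Poly_Mapping.keys (ksign j T * p) = Poly_Mapping.keys (p :: 'n ring_R)"
  unfolding ksign_def by (cases "even (card {s \<in> T. s < j})") simp_all

lemma lookup_ksign_mult:
  "Poly_Mapping.lookup (ksign j T * p) t = ksign j T * Poly_Mapping.lookup (p :: 'n ring_R) t"
  unfolding ksign_def by (cases "even (card {s \<in> T. s < j})") simp_all

lemma order_ge_contr:
  assumes "\<And>S. order_ge W k (f S)"
  shows "order_ge W k (contr A L f T)"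
  unfolding contr_def
proof (rule order_ge_sum)
  fix j
  have "order_ge W (0 + k) (L j * f (insert j T))" by (rule order_ge_mult) (simp_all add: assms)
  then show "order_ge W k (ksign j T * L j * f (insert j T))"
    unfolding order_ge_def mult.assoc keys_ksign_mult by simp
qed

lemma degree_le_contr:
  assumes "\<And>S. S = {} \<or> degree_le D (f S)" "\<And>j. j \<in> A \<Longrightarrow> degree_le 1 (L j)"
  shows "degree_le (Suc D) (contr A L f T)"
  unfolding contr_def
proof (rule degree_le_sum)
  fix j assume "j \<in> A - T"
  then have "degree_le (1 + D) (L j * f (insert j T))"
    by (intro degree_le_mult) (use assms(1)[of "insert j T"] assms(2) in auto)
  then show "degree_le (Suc D) (ksign j T * L j * f (insert j T))"
    unfolding degree_le_def mult.assoc keys_ksign_mult by simp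
qed

section \<open>Degeneration to a matrix of monomials\<close>

text \<open>Modulo the variables in \<open>Z\<close>, column \<open>j\<close> is \<open>Var (\<kappa> j)\<close> times the vector \<open>(1, c j)\<close>. A cycle is
  corrected in its component of lowest degree in \<open>Z\<close>, where only this leading matrix matters.\<close>

locale en_degeneration =
  fixes n :: nat and \<kappa> :: "nat \<Rightarrow> 'n::finite" and Z :: "'n set" and c :: "nat \<Rightarrow> complex"
    and X Y X' Y' :: "nat \<Rightarrow> 'n ring_R"
  assumes inj_\<kappa>: "inj_on \<kappa> {..<n}" and \<kappa>_Z: "\<And>j. j < n \<Longrightarrow> \<kappa> j \<notin> Z"
    and inj_c: "inj_on c {..<n}"
    and X: "\<And>j. j < n \<Longrightarrow> X j = Const 1 * Var (\<kappa> j) + X' j"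
    and Y: "\<And>j. j < n \<Longrightarrow> Y j = Const (c j) * Var (\<kappa> j) + Y' j"
    and XY': "\<And>j. j < n \<Longrightarrow> order_ge Z 1 (X' j)" "\<And>j. j < n \<Longrightarrow> order_ge Z 1 (Y' j)"
    and deg: "\<And>j. j < n \<Longrightarrow> degree_le 1 (X j)" "\<And>j. j < n \<Longrightarrow> degree_le 1 (Y j)"
begin

definition mon :: "nat set \<Rightarrow> ('n \<Rightarrow>\<^sub>0 nat)" where
  "mon S = (\<Sum>j\<in>S. Poly_Mapping.single (\<kappa> j) 1)"

text \<open>The columns whose variable divides \<open>\<mu>\<close>; a set \<open>S\<close> of
  columns can occur in multidegree \<open>\<mu>\<close> exactly when it is contained in this
  set.\<close>

definition supp :: "('n \<Rightarrow>\<^sub>0 nat) \<Rightarrow> nat set" where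
  "supp \<mu> = {j. j < n \<and> Poly_Mapping.lookup \<mu> (\<kappa> j) \<ge> 1}"

text \<open>The part of multidegree \<open>\<mu>\<close>, where the basis vector \<open>e\<^sub>S\<close> has multidegree \<open>mon S\<close>.\<close>

definition comp :: "('n \<Rightarrow>\<^sub>0 nat) \<Rightarrow> (nat set \<Rightarrow> 'n ring_R) \<Rightarrow> nat set \<Rightarrow> complex" where
  "comp \<mu> f S = (if S \<subseteq> supp \<mu> then Poly_Mapping.lookup (f S) (\<mu> - mon S) else 0)"

lemma finite_supp [simp]: "finite (supp \<mu>)"
  by (rule finite_subset[of _ "{..<n}"]) (auto simp: supp_def)

lemma supp_subset: "supp \<mu> \<subseteq> {..<n}"
  by (auto simp: supp_def)

lemma mon_insert: "j \<notin> S \<Longrightarrow> finite S \<Longrightarrow> mon (insert j S) = Poly_Mapping.single (\<kappa> j) 1 + mon S"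
  by (simp add: mon_def)

lemma lookup_mon: "S \<subseteq> {..<n} \<Longrightarrow> j < n \<Longrightarrow> Poly_Mapping.lookup (mon S) (\<kappa> j) = (if j \<in> S then 1 else 0)"
proof -
  assume S: "S \<subseteq> {..<n}" "j < n"
  have "Poly_Mapping.lookup (mon S) (\<kappa> j) = (\<Sum>i\<in>S. if i = j then 1 else 0)"
    unfolding mon_def lookup_sum
    by (rule sum.cong) (use S inj_\<kappa> in \<open>auto simp: lookup_single when_def inj_on_def\<close>)
  then show ?thesis using finite_subset[OF S(1)] by simp
qed

lemma lookup_mon_0: "S \<subseteq> {..<n} \<Longrightarrow> i \<notin> \<kappa> ` S \<Longrightarrow> Poly_Mapping.lookup (mon S) i = 0"
  by (auto simp: mon_def lookup_sum lookup_single when_def intro!: sum.neutral)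

lemma wdeg_mon_Z: "S \<subseteq> {..<n} \<Longrightarrow> wdeg Z (mon S) = 0"
  using \<kappa>_Z by (auto simp: mon_def wdeg_sum intro!: sum.neutral)

lemma wdeg_mon_UNIV: "wdeg UNIV (mon S) = card S"
  by (simp add: mon_def wdeg_sum)

lemma mon_add_diff: "S \<subseteq> supp \<mu> \<Longrightarrow> (\<mu> - mon S) + mon S = \<mu>"
proof (rule poly_mapping_eqI)
  fix i assume S: "S \<subseteq> supp \<mu>"
  then have S': "S \<subseteq> {..<n}" using supp_subset by blast
  show "Poly_Mapping.lookup ((\<mu> - mon S) + mon S) i = Poly_Mapping.lookup \<mu> i"
  proof (cases "i \<in> \<kappa> ` S")
    case True
    then obtain j where j: "j \<in> S" "i = \<kappa> j" by blast
    then have "j < n" "Poly_Mapping.lookup \<mu> i \<ge> 1" using S by (auto simp: supp_def)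
    then show ?thesis using j lookup_mon[OF S' \<open>j < n\<close>] by (simp add: lookup_add lookup_minus)
  next
    case False
    then show ?thesis using lookup_mon_0[OF S'] by (simp add: lookup_add lookup_minus)
  qed
qed

lemma subset_supp_add_mon: "S \<subseteq> {..<n} \<Longrightarrow> S \<subseteq> supp (t + mon S)"
  using lookup_mon[of S] unfolding supp_def by (force simp: lookup_add)

lemma comp_nonzero: "comp \<mu> f S \<noteq> 0 \<Longrightarrow> S \<subseteq> supp \<mu> \<and> f S \<noteq> 0"
  by (cases "f S = 0") (auto simp: comp_def split: if_splits)

lemma comp_add: "comp \<mu> (\<lambda>S. f S + g S) S = comp \<mu> f S + comp \<mu> g S"
  by (simp add: comp_def lookup_add)

lemma comp_diff: "comp \<mu> (\<lambda>S. f S - g S) S = comp \<mu> f S - comp \<mu> g S"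
  by (simp add: comp_def lookup_minus)

text \<open>In lowest order \<open>k\<close> the terms with \<open>L'\<close> contribute nothing,
  their order being above \<open>k\<close>. The leading term multiplies by one variable, which the
  multidegree of \<open>e_j\<close> compensates, so only the scalars \<open>a j\<close>
  remain.\<close>

lemma comp_contr:
  assumes k: "wdeg Z \<mu> = k" and f: "\<And>S. order_ge Z k (f S)"
    and L: "\<And>j. j < n \<Longrightarrow> L j = Const (a j) * Var (\<kappa> j) + L' j" "\<And>j. j < n \<Longrightarrow> order_ge Z 1 (L' j)"
  shows "comp \<mu> (contr {..<n} L f) T = contr (supp \<mu>) a (comp \<mu> f) T"
proof (cases "T \<subseteq> supp \<mu>")
  case False
  then show ?thesis by (auto simp: comp_def contr_def intro!: sum.neutral)
next
  case True
  then have T: "T \<subseteq> {..<n}" "finite T" using supp_subset finite_subset[OF True] by auto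
  let ?t = "\<mu> - mon T"
  have wt: "wdeg Z ?t = k"
    using arg_cong[OF mon_add_diff[OF True], of "wdeg Z"] k wdeg_mon_Z[OF T(1)] by simp
  have summand: "Poly_Mapping.lookup (ksign j T * L j * f (insert j T)) ?t
      = ksign j T * a j * comp \<mu> f (insert j T)" if j: "j \<in> {..<n} - T" for j
  proof -
    have "order_ge Z (1 + k) (L' j * f (insert j T))"
      by (rule order_ge_mult) (use L(2) j f in auto)
    then have z: "Poly_Mapping.lookup (L' j * f (insert j T)) ?t = 0"
      by (rule order_ge_lookup) (simp add: wt)
    have v: "Poly_Mapping.lookup (Var (\<kappa> j) * f (insert j T)) ?t = comp \<mu> f (insert j T)"
    proof (cases "j \<in> supp \<mu>")
      case True': True
      have "mon (insert j T) = mon T + Poly_Mapping.single (\<kappa> j) 1"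
        using j T by (simp add: mon_insert add.commute)
      then have "?t - Poly_Mapping.single (\<kappa> j) 1 = \<mu> - mon (insert j T)"
        by (simp add: diff_diff_add)
      moreover have "Poly_Mapping.lookup ?t (\<kappa> j) \<ge> 1"
        using True' j lookup_mon[OF T(1), of j] by (auto simp: lookup_minus supp_def)
      ultimately show ?thesis using True True' by (simp add: lookup_Var_mult comp_def)
    next
      case False
      then have "Poly_Mapping.lookup ?t (\<kappa> j) = 0" using j by (auto simp: lookup_minus supp_def)
      then show ?thesis using False by (simp add: lookup_Var_mult comp_def)
    qed
    have "Poly_Mapping.lookup (ksign j T * L j * f (insert j T)) ?t
        = ksign j T * Poly_Mapping.lookup (Const (a j) * (Var (\<kappa> j) * f (insert j T)) + L' j * f (insert j T)) ?t"
      using L(1)[of j] j by (simp add: mult.assoc lookup_ksign_mult distrib_right)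
    also have "\<dots> = ksign j T * (a j * comp \<mu> f (insert j T))"
      by (simp add: lookup_add lookup_Const_mult z v)
    finally show ?thesis by (simp add: mult.assoc)
  qed
  have "comp \<mu> (contr {..<n} L f) T = (\<Sum>j\<in>{..<n} - T. ksign j T * a j * comp \<mu> f (insert j T))"
    using True by (simp add: comp_def[of _ "contr {..<n} L f"] contr_def lookup_sum summand)
  also have "\<dots> = contr (supp \<mu>) a (comp \<mu> f) T"
    unfolding contr_def
    by (rule sum.mono_neutral_right) (use supp_subset in \<open>auto simp: comp_def\<close>)
  finally show ?thesis .
qed

lemmas comp_contr_X = comp_contr[where L = X and a = "\<lambda>_. 1" and L' = X', OF _ _ X XY'(1)]
lemmas comp_contr_Y = comp_contr[where L = Y and a = c and L' = Y', OF _ _ Y XY'(2)]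

abbreviation "\<delta> \<equiv> en_diff {..<n} X Y"

lemma comp_en_diff:
  assumes k: "wdeg Z \<mu> = k" and f: "\<And>S. order_ge Z k (v (Suc u) S)" "\<And>S. order_ge Z k (v u S)"
  shows "comp \<mu> (\<delta> v u) T = en_diff (supp \<mu>) (\<lambda>_. 1) c (\<lambda>u. comp \<mu> (v u)) u T"
proof -
  have "comp \<mu> (\<delta> v u) T = comp \<mu> (contr {..<n} X (v (Suc u))) T + comp \<mu> (contr {..<n} Y (v u)) T"
    unfolding comp_add[symmetric] by (simp add: comp_def en_diff_def)
  then show ?thesis
    using comp_contr_X[OF k, of "v (Suc u)" T] comp_contr_Y[OF k, of "v u" T] f
    by (simp add: en_diff_def)
qed

text \<open>A chain here has rank at least 2, so a multidegree supported on fewer than two columns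
  carries none. Two columns in the support have different values of \<open>c\<close> and make the
  scalar complex contractible.\<close>

lemma lift_component:
  assumes i: "1 \<le> i" and k: "wdeg Z \<mu> = k"
    and chain: "\<And>u. u < i \<Longrightarrow> chain_on {..<n} (Suc i) (v u)"
    and cycle: "\<And>u T. Suc u < i \<Longrightarrow> \<delta> v u T = 0"
    and aug: "i = 1 \<Longrightarrow> contr {..<n} X (contr {..<n} Y (v 0)) {} = 0"
    and ord: "\<And>u S. u < i \<Longrightarrow> order_ge Z k (v u S)"
  shows "\<exists>d. (\<forall>u<Suc i. chain_on (supp \<mu>) (Suc (Suc i)) (d u)) \<and>
             (\<forall>u<i. \<forall>T. en_diff (supp \<mu>) (\<lambda>_. 1) c d u T = comp \<mu> (v u) T)"
proof (cases "\<exists>p\<in>supp \<mu>. \<exists>q\<in>supp \<mu>. p \<noteq> q")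
  case True
  then obtain p q where pq: "p \<in> supp \<mu>" "q \<in> supp \<mu>" "p \<noteq> q" by blast
  show ?thesis
  proof (rule scalar_en_exact[OF finite_supp pq(1,2) _ i])
    show "c p \<noteq> c q" using pq inj_c by (auto simp: supp_def inj_on_def)
    show "chain_on (supp \<mu>) (Suc i) (comp \<mu> (v u))" if "u < i" for u
      using chain[OF that] comp_nonzero unfolding chain_on_def by blast
    show "en_diff (supp \<mu>) (\<lambda>_. 1) c (\<lambda>u. comp \<mu> (v u)) u T = 0" if "Suc u < i" for u T
    proof -
      have "comp \<mu> (\<delta> v u) T = 0" using cycle[OF that] by (simp add: comp_def)
      then show ?thesis using comp_en_diff[OF k, of v u T] ord that by simp
    qed
    show "contr (supp \<mu>) (\<lambda>_. 1) (contr (supp \<mu>) c (comp \<mu> (v 0))) {} = 0" if "i = 1"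
    proof -
      have "contr (supp \<mu>) c (comp \<mu> (v 0)) = comp \<mu> (contr {..<n} Y (v 0))"
        using comp_contr_Y[OF k, of "v 0"] ord that by (simp add: fun_eq_iff)
      then show ?thesis
        using comp_contr_X[OF k, of "contr {..<n} Y (v 0)" "{}"] order_ge_contr[of Z k "v 0"] ord that aug
        by (simp add: comp_def)
    qed
  qed
next
  case False
  have "comp \<mu> (v u) S = 0" if "u < i" for u S
  proof (rule ccontr)
    assume "comp \<mu> (v u) S \<noteq> 0"
    then have "S \<subseteq> supp \<mu>" "v u S \<noteq> 0" using comp_nonzero by blast+
    then have S: "S \<subseteq> supp \<mu>" "card S = Suc i" using chain[OF that] by (auto simp: chain_on_def)
    then have "1 < card S" using i by simp
    then obtain p q where "p \<in> S" "q \<in> S" "p \<noteq> q"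
      by (metis One_nat_def card_le_Suc0_iff_eq S(1) finite_supp finite_subset not_less)
    then show False using False S by blast
  qed
  then show ?thesis
    by (intro exI[of _ "\<lambda>_ _. 0"]) (simp add: chain_on_def en_diff_def)
qed

text \<open>Each round subtracts a boundary that cancels the terms of order exactly \<open>k\<close>
  in \<open>Z\<close> and keeps the degree bound \<open>D\<close>. An element of degree at most
  \<open>D\<close> and order above \<open>D\<close> is zero, which ends the induction.\<close>

lemma exact_aux:
  assumes i: "1 \<le> i"
    and chain: "\<And>u. u < i \<Longrightarrow> chain_on {..<n} (Suc i) (v u)"
    and cycle: "\<And>u T. Suc u < i \<Longrightarrow> \<delta> v u T = 0"
    and aug: "i = 1 \<Longrightarrow> contr {..<n} X (contr {..<n} Y (v 0)) {} = 0"
    and ord: "\<And>u S. u < i \<Longrightarrow> order_ge Z k (v u S)"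
    and deg_v: "\<And>u S. u < i \<Longrightarrow> degree_le D (v u S)"
  shows "\<exists>w. (\<forall>u<Suc i. chain_on {..<n} (Suc (Suc i)) (w u)) \<and> (\<forall>u<i. \<forall>T. \<delta> w u T = v u T)"
  using assms(2-)
proof (induction "Suc D - k" arbitrary: k v)
  case 0
  have "v u S = 0" if "u < i" for u S
  proof -
    have "t \<notin> Poly_Mapping.keys (v u S)" for t
      using 0(1) 0(5)[OF that, of S] 0(6)[OF that, of S] wdeg_mono[of Z UNIV t]
      by (fastforce simp: order_ge_def degree_le_def)
    then have "Poly_Mapping.keys (v u S) = {}" by blast
    then show ?thesis by (simp only: Poly_Mapping.keys_eq_empty)
  qed
  then show ?case
    by (intro exI[of _ "\<lambda>_ _. 0"]) (simp add: chain_on_def en_diff_def)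
next
  case (Suc x)
  note chain = Suc.prems(1) and cycle = Suc.prems(2) and aug = Suc.prems(3) and ord = Suc.prems(4)
    and deg_v = Suc.prems(5)
  \<comment> \<open>The multidegrees occurring in the part of order \<open>k\<close>; only these
    finitely many components need a correction.\<close>
  define \<Omega> where "\<Omega> = (\<Union>u<i. \<Union>S\<in>Pow {..<n}.
      (\<lambda>t. t + mon S) ` {t \<in> Poly_Mapping.keys (v u S). wdeg Z t = k})"
  have fin: "finite \<Omega>" unfolding \<Omega>_def by auto
  have \<Omega>: "wdeg Z \<mu> = k" "wdeg UNIV \<mu> \<le> D + Suc i" if \<mu>: "\<mu> \<in> \<Omega>" for \<mu>
  proof -
    obtain u S t where *: "u < i" "S \<subseteq> {..<n}" "t \<in> Poly_Mapping.keys (v u S)" "wdeg Z t = k" "\<mu> = t + mon S"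
      using \<mu> unfolding \<Omega>_def by blast
    then show "wdeg Z \<mu> = k" by (simp add: wdeg_mon_Z)
    have "v u S \<noteq> 0" using * by auto
    then have "card S = Suc i" using chain[OF *(1)] by (auto simp: chain_on_def)
    moreover have "wdeg UNIV t \<le> D" using deg_v[OF *(1), of S] * by (auto simp: degree_le_def)
    ultimately show "wdeg UNIV \<mu> \<le> D + Suc i" using * by (simp add: wdeg_mon_UNIV)
  qed
  have "\<exists>d. (\<forall>u<Suc i. chain_on (supp \<mu>) (Suc (Suc i)) (d u)) \<and>
             (\<forall>u<i. \<forall>T. en_diff (supp \<mu>) (\<lambda>_. 1) c d u T = comp \<mu> (v u) T)" if "\<mu> \<in> \<Omega>" for \<mu>
    using lift_component[OF i \<Omega>(1)[OF that] chain cycle aug ord] by blast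
  then obtain d where d: "\<And>\<mu> u. \<mu> \<in> \<Omega> \<Longrightarrow> u < Suc i \<Longrightarrow> chain_on (supp \<mu>) (Suc (Suc i)) (d \<mu> u)"
      "\<And>\<mu> u T. \<mu> \<in> \<Omega> \<Longrightarrow> u < i \<Longrightarrow> en_diff (supp \<mu>) (\<lambda>_. 1) c (d \<mu>) u T = comp \<mu> (v u) T"
    by metis
  define w where "w u S = (\<Sum>\<mu>\<in>\<Omega>. if S \<subseteq> supp \<mu> then Poly_Mapping.single (\<mu> - mon S) (d \<mu> u S) else 0)" for u S
  have w_keys: "\<exists>\<mu>\<in>\<Omega>. S \<subseteq> supp \<mu> \<and> t = \<mu> - mon S \<and> d \<mu> u S \<noteq> 0" if "t \<in> Poly_Mapping.keys (w u S)" for t u S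
  proof -
    have "(\<Sum>\<mu>\<in>\<Omega>. Poly_Mapping.lookup (if S \<subseteq> supp \<mu> then Poly_Mapping.single (\<mu> - mon S) (d \<mu> u S) else 0) t) \<noteq> 0"
      using that by (simp add: w_def in_keys_iff lookup_sum)
    then obtain \<mu> where "\<mu> \<in> \<Omega>"
      "Poly_Mapping.lookup (if S \<subseteq> supp \<mu> then Poly_Mapping.single (\<mu> - mon S) (d \<mu> u S) else 0) t \<noteq> 0"
      by (rule sum.not_neutral_contains_not_neutral)
    then show ?thesis by (auto simp: lookup_single when_def split: if_splits)
  qed
  have w_chain: "chain_on {..<n} (Suc (Suc i)) (w u)" if "u < Suc i" for u
    unfolding chain_on_def
  proof (intro allI impI)
    fix S assume "w u S \<noteq> 0"
    then obtain t where "t \<in> Poly_Mapping.keys (w u S)" by (metis Poly_Mapping.keys_eq_empty equals0I)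
    then obtain \<mu> where "\<mu> \<in> \<Omega>" "d \<mu> u S \<noteq> 0" using w_keys by blast
    then show "S \<subseteq> {..<n} \<and> card S = Suc (Suc i)"
      using d(1)[OF _ that, of \<mu>] supp_subset[of \<mu>] by (auto simp: chain_on_def)
  qed
  have w_comp: "comp \<mu> (w u) S = (if \<mu> \<in> \<Omega> then d \<mu> u S else 0)" if "u < Suc i" for \<mu> u S
  proof (cases "S \<subseteq> supp \<mu>")
    case True
    have "(if S \<subseteq> supp \<mu>' then Poly_Mapping.lookup (Poly_Mapping.single (\<mu>' - mon S) (d \<mu>' u S)) (\<mu> - mon S) else 0)
        = (if \<mu>' = \<mu> then d \<mu> u S else 0)" for \<mu>'
      using True mon_add_diff[of S \<mu>] mon_add_diff[of S \<mu>']
      by (auto simp: lookup_single when_def)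
    then have "comp \<mu> (w u) S = (\<Sum>\<mu>'\<in>\<Omega>. if \<mu>' = \<mu> then d \<mu> u S else 0)"
      using True by (simp add: comp_def w_def lookup_sum if_distrib[of "\<lambda>p. Poly_Mapping.lookup p _"] cong: if_cong)
    then show ?thesis using fin by simp
  next
    case False
    then show ?thesis using d(1)[OF _ that, of \<mu>] by (auto simp: comp_def chain_on_def)
  qed
  have w_ord: "order_ge Z k (w u S)" for u S
    unfolding order_ge_def
  proof
    fix t assume "t \<in> Poly_Mapping.keys (w u S)"
    then obtain \<mu> where \<mu>: "\<mu> \<in> \<Omega>" "S \<subseteq> supp \<mu>" "t = \<mu> - mon S" using w_keys by blast
    then have "wdeg Z t = k"
      using arg_cong[OF mon_add_diff[OF \<mu>(2)], of "wdeg Z"] \<Omega>(1)[OF \<mu>(1)] wdeg_mon_Z[of S] supp_subset[of \<mu>] by simp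
    then show "k \<le> wdeg Z t" by simp
  qed
  \<comment> \<open>Within one multidegree, passing to sets with one more element costs one degree
    in the coefficient, which leaves room for the linear entries of the matrix. For
    \<open>D = 0\<close> it forces \<open>w\<close> to vanish.\<close>
  have w_deg: "wdeg UNIV t + 1 \<le> D" if u: "u < Suc i" and t: "t \<in> Poly_Mapping.keys (w u S)" for t u S
  proof -
    obtain \<mu> where \<mu>: "\<mu> \<in> \<Omega>" "S \<subseteq> supp \<mu>" "t = \<mu> - mon S" "d \<mu> u S \<noteq> 0" using w_keys[OF t] by blast
    then have "card S = Suc (Suc i)" using d(1)[OF \<mu>(1) u] by (auto simp: chain_on_def)
    then show ?thesis
      using arg_cong[OF mon_add_diff[OF \<mu>(2)], of "wdeg UNIV"] \<Omega>(2)[OF \<mu>(1)] \<mu>(3) by (simp add: wdeg_mon_UNIV)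
  qed
  have contr_deg: "degree_le D (contr {..<n} L (w u) T)" if "u < Suc i" "\<And>j. j < n \<Longrightarrow> degree_le 1 (L j)" for u L T
  proof (cases D)
    case 0
    then have "Poly_Mapping.keys (w u S) = {}" for S using w_deg[OF that(1)] by fastforce
    then have "w u = (\<lambda>_. 0)" by (simp add: fun_eq_iff)
    then show ?thesis by simp
  next
    case (Suc D')
    have "degree_le D' (w u S)" for S using w_deg[OF that(1)] Suc by (force simp: degree_le_def)
    then show ?thesis unfolding Suc by (intro degree_le_contr) (use that in auto)
  qed
  define v' where "v' u S = v u S - \<delta> w u S" for u S
  have "\<exists>w'. (\<forall>u<Suc i. chain_on {..<n} (Suc (Suc i)) (w' u)) \<and> (\<forall>u<i. \<forall>T. \<delta> w' u T = v' u T)"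
  proof (rule Suc.hyps(1))
    show "x = Suc D - Suc k" using Suc.hyps(2) by simp
    show chain': "chain_on {..<n} (Suc i) (v' u)" if "u < i" for u
      unfolding v'_def en_diff_def using that w_chain[of u] w_chain[of "Suc u"]
      by (intro chain_on_diff chain chain_on_add chain_on_contr) auto
    show "\<delta> v' u T = 0" if "Suc u < i" for u T
      unfolding v'_def en_diff_diff using cycle[OF that] by (simp add: en_diff_en_diff)
    show "contr {..<n} X (contr {..<n} Y (v' 0)) {} = 0" if "i = 1"
    proof -
      have "contr {..<n} Y (v' 0) = (\<lambda>T. contr {..<n} Y (v 0) T - contr {..<n} Y (\<delta> w 0) T)"
        unfolding v'_def by (rule ext) (rule contr_diff)
      then show ?thesis using aug[OF that] by (simp add: contr_diff augmentation_en_diff)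
    qed
    have ord': "order_ge Z k (v' u S)" if "u < i" for u S
      unfolding v'_def en_diff_def by (intro order_ge_diff order_ge_add order_ge_contr ord that w_ord)
    show "degree_le D (v' u S)" if "u < i" for u S
      unfolding v'_def en_diff_def using that deg by (intro degree_le_diff degree_le_add contr_deg deg_v) auto
    show "order_ge Z (Suc k) (v' u S)" if u: "u < i" for u S
      unfolding order_ge_def
    proof
      fix t assume t: "t \<in> Poly_Mapping.keys (v' u S)"
      then have "v' u S \<noteq> 0" by auto
      then have S: "S \<subseteq> {..<n}" using chain'[OF u] by (auto simp: chain_on_def)
      have "wdeg Z t \<noteq> k"
      proof
        assume tk: "wdeg Z t = k"
        define \<mu> where "\<mu> = t + mon S"
        have \<mu>: "wdeg Z \<mu> = k" using tk by (simp add: \<mu>_def wdeg_mon_Z[OF S])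
        have S\<mu>: "S \<subseteq> supp \<mu>" unfolding \<mu>_def by (rule subset_supp_add_mon[OF S])
        have "Poly_Mapping.lookup (v' u S) t = comp \<mu> (v' u) S"
          using S\<mu> by (simp add: comp_def \<mu>_def)
        also have "\<dots> = comp \<mu> (v u) S - comp \<mu> (\<delta> w u) S"
          unfolding v'_def comp_diff ..
        also have "comp \<mu> (\<delta> w u) S = en_diff (supp \<mu>) (\<lambda>_. 1) c (\<lambda>u. comp \<mu> (w u)) u S"
          by (rule comp_en_diff[OF \<mu>]) (rule w_ord)+
        also have "\<dots> = en_diff (supp \<mu>) (\<lambda>_. 1) c (\<lambda>u S. if \<mu> \<in> \<Omega> then d \<mu> u S else 0) u S"
          using u unfolding en_diff_def by (simp add: w_comp contr_def)
        also have "\<dots> = comp \<mu> (v u) S"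
        proof (cases "\<mu> \<in> \<Omega>")
          case False
          then have "t \<notin> Poly_Mapping.keys (v u S)" using u S tk unfolding \<Omega>_def \<mu>_def by blast
          then have "comp \<mu> (v u) S = 0" by (simp add: comp_def \<mu>_def in_keys_iff)
          then show ?thesis using False by (simp add: en_diff_def)
        qed (use d(2) u in simp)
        finally show False using t by (simp add: in_keys_iff)
      qed
      moreover have "k \<le> wdeg Z t" using ord'[OF u, of S] t by (auto simp: order_ge_def)
      ultimately show "Suc k \<le> wdeg Z t" by simp
    qed
  qed
  then obtain w' where w': "\<And>u. u < Suc i \<Longrightarrow> chain_on {..<n} (Suc (Suc i)) (w' u)"
      "\<And>u T. u < i \<Longrightarrow> \<delta> w' u T = v' u T" by blast
  show ?case
  proof (intro exI[of _ "\<lambda>u S. w u S + w' u S"] conjI allI impI)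
    show "chain_on {..<n} (Suc (Suc i)) (\<lambda>S. w u S + w' u S)" if "u < Suc i" for u
      by (intro chain_on_add w_chain w' that)
    show "\<delta> (\<lambda>u S. w u S + w' u S) u T = v u T" if "u < i" for u T
      unfolding en_diff_add w'(2)[OF that] v'_def by simp
  qed
qed

text \<open>A common degree bound exists because a chain has finitely many nonzero
  coordinates.\<close>

lemma exact:
  assumes "1 \<le> i"
    and "\<And>u. u < i \<Longrightarrow> chain_on {..<n} (Suc i) (v u)"
    and "\<And>u T. Suc u < i \<Longrightarrow> \<delta> v u T = 0"
    and "i = 1 \<Longrightarrow> contr {..<n} X (contr {..<n} Y (v 0)) {} = 0"
  shows "\<exists>w. (\<forall>u<Suc i. chain_on {..<n} (Suc (Suc i)) (w u)) \<and> (\<forall>u<i. \<forall>T. \<delta> w u T = v u T)"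
proof -
  define E where "E = (\<Union>u<i. \<Union>S\<in>Pow {..<n}. wdeg UNIV ` Poly_Mapping.keys (v u S))"
  have "finite E" unfolding E_def by auto
  then obtain D where D: "\<And>e. e \<in> E \<Longrightarrow> e \<le> D" using finite_nat_set_iff_bounded_le by auto
  have "degree_le D (v u S)" if "u < i" for u S
  proof (cases "S \<subseteq> {..<n}")
    case True
    then show ?thesis using that D unfolding degree_le_def E_def by blast
  next
    case False
    then have "v u S = 0" using assms(2)[OF that] by (auto simp: chain_on_def)
    then show ?thesis by simp
  qed
  then show ?thesis
    by (intro exact_aux[where k = 0 and D = D] assms) simp_all
qed

end

section \<open>The Eagon-Northcott complex\<close>

lemma homogeneous_0 [simp]: "homogeneous e 0"
  by (simp add: homogeneous_def)

lemma homogeneous_add: "homogeneous e p \<Longrightarrow> homogeneous e q \<Longrightarrow> homogeneous e (p + q)"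
  unfolding homogeneous_def using keys_add[of p q] by blast

lemma homogeneous_diff: "homogeneous e p \<Longrightarrow> homogeneous e q \<Longrightarrow> homogeneous e (p - q)"
  unfolding homogeneous_def using Poly_Mapping.keys_diff[of p q] by blast

lemma homogeneous_sum: "(\<And>x. x \<in> A \<Longrightarrow> homogeneous e (f x)) \<Longrightarrow> homogeneous e (sum f A)"
  by (induction A rule: infinite_finite_induct) (auto intro: homogeneous_add)

lemma homogeneous_mult:
  assumes "homogeneous a p" "homogeneous b q"
  shows "homogeneous (a + b) (p * q)"
  unfolding homogeneous_def
proof
  fix t assume "t \<in> Poly_Mapping.keys (p * q)"
  then obtain s r where "t = s + r" "s \<in> Poly_Mapping.keys p" "r \<in> Poly_Mapping.keys q"
    using keys_mult[of p q] by auto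
  then show "int (total_deg t) = a + b" using assms by (auto simp: homogeneous_def total_deg_eq_wdeg)
qed

lemma homogeneous_Const: "homogeneous 0 (Const a)"
  by (simp add: homogeneous_def Const_def total_deg_eq_wdeg)

lemma homogeneous_Var: "homogeneous 1 (Var i)"
  by (simp add: homogeneous_def Var_def total_deg_eq_wdeg)

lemma homogeneous_ksign_mult: "homogeneous e (ksign j T * p) \<longleftrightarrow> homogeneous e p"
  by (simp add: homogeneous_def keys_ksign_mult)

section \<open>Bases and boundaries of the complex in coordinates\<close>

lemma eagon_northcott_sel [simp]:
  "gens (eagon_northcott M) 0 = {({}, 0)}"
  "gens (eagon_northcott M) (Suc i) =
     {(S, u). S \<subseteq> {..<dim_col M} \<and> card S = Suc (Suc i) \<and> u < Suc i}"
  "gdeg (eagon_northcott M) 0 b = 0"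
  "gdeg (eagon_northcott M) (Suc i) b = int (Suc (Suc i))"
  by (auto simp: eagon_northcott_def)

lemma dmat_0: "dmat (eagon_northcott M) 0 r (S, u) = minor2 M (Min S) (Max S)"
  by (cases r) (simp add: eagon_northcott_def)

text \<open>The Koszul sign may be computed in the facet \<open>T = S - {j}\<close>, as
  \<open>j\<close> is not below itself.\<close>

lemma dmat_Suc:
  "dmat (eagon_northcott M) (Suc i) (T, v) (S, u) = (\<Sum>j\<in>S. if T = S - {j} then ksign j T *
     ((if u = Suc v then M $$ (0, j) else 0) + (if u = v then M $$ (1, j) else 0)) else 0)"
proof -
  have "{s \<in> S - {j}. s < j} = {s \<in> S. s < j}" for j by auto
  then show ?thesis
    by (auto simp: eagon_northcott_def ksign_def intro!: sum.cong)
qed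

text \<open>A pair of a set and an element whose removal leaves \<open>T\<close> is the same as an
  element outside \<open>T\<close>. This turns the differential, given on basis vectors, into a
  contraction of coordinate functions.\<close>

lemma sum_facets:
  fixes h :: "nat \<Rightarrow> nat set \<Rightarrow> 'a::comm_monoid_add"
  assumes "finite A" "T \<subseteq> A" "card T = r"
  shows "(\<Sum>S | S \<subseteq> A \<and> card S = Suc r. \<Sum>j\<in>S. if T = S - {j} then h j S else 0)
      = (\<Sum>j\<in>A - T. h j (insert j T))"
proof -
  let ?F = "{S. S \<subseteq> A \<and> card S = Suc r}"
  let ?G = "Sigma ?F (\<lambda>S. S)"
  have finF: "finite ?F" by (rule finite_subset[of _ "Pow A"]) (use assms in auto)
  have finS: "finite S" if "S \<in> ?F" for S using that finite_subset[OF _ assms(1), of S] by simp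
  have finT: "finite T" by (rule finite_subset[OF assms(2,1)])
  have finG: "finite ?G" by (rule finite_SigmaI[OF finF finS])
  have "(\<Sum>S\<in>?F. \<Sum>j\<in>S. if T = S - {j} then h j S else 0)
      = (\<Sum>x\<in>?G. if T = fst x - {snd x} then h (snd x) (fst x) else 0)"
    by (subst sum.Sigma[OF finF]) (use finS in \<open>auto simp: case_prod_beta'\<close>)
  also have "\<dots> = (\<Sum>x\<in>{x \<in> ?G. T = fst x - {snd x}}. h (snd x) (fst x))"
    by (rule sum.inter_filter[symmetric, OF finG])
  also have "\<dots> = (\<Sum>j\<in>A - T. h j (insert j T))"
  proof (rule sum.reindex_bij_witness[of _ "\<lambda>j. (insert j T, j)" snd])
    fix x assume "x \<in> {x \<in> ?G. T = fst x - {snd x}}"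
    then obtain S j where x: "x = (S, j)" "S \<subseteq> A" "j \<in> S" "T = S - {j}" by auto
    then have S: "insert j T = S" by auto
    show "(insert (snd x) T, snd x) = x" "h (snd x) (insert (snd x) T) = h (snd x) (fst x)"
      using S x(1) by simp_all
    show "snd x \<in> A - T" using x by auto
  next
    fix j assume j: "j \<in> A - T"
    then show "(insert j T, j) \<in> {x \<in> ?G. T = fst x - {snd x}}"
      using assms finT by simp
    show "snd (insert j T, j) = j" by simp
  qed
  finally show ?thesis .
qed

lemma en_boundary_Suc:
  assumes "T \<subseteq> {..<dim_col M}" "card T = Suc (Suc i)" "u < Suc i"
  shows "boundary (eagon_northcott M) (Suc i) v (T, u)
    = en_diff {..<dim_col M} (\<lambda>j. M $$ (0, j)) (\<lambda>j. M $$ (1, j)) (\<lambda>u S. v (S, u)) u T"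
proof -
  let ?E = "eagon_northcott M"
  let ?F = "{S. S \<subseteq> {..<dim_col M} \<and> card S = Suc (Suc (Suc i))}"
  let ?h = "\<lambda>j S. ksign j T * M $$ (0, j) * v (S, Suc u) + ksign j T * M $$ (1, j) * v (S, u)"
  have gens: "gens ?E (Suc (Suc i)) = ?F \<times> {..<Suc (Suc i)}" by auto
  have *: "(\<Sum>u'<Suc (Suc i). dmat ?E (Suc i) (T, u) (S, u') * v (S, u'))
      = (\<Sum>j\<in>S. if T = S - {j} then ?h j S else 0)" for S
  proof -
    have "(\<Sum>u'<Suc (Suc i). dmat ?E (Suc i) (T, u) (S, u') * v (S, u'))
        = (\<Sum>u'<Suc (Suc i). \<Sum>j\<in>S. if T = S - {j} then
            (if u' = Suc u then ksign j T * M $$ (0, j) * v (S, Suc u) else 0) +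
            (if u' = u then ksign j T * M $$ (1, j) * v (S, u) else 0) else 0)"
      unfolding dmat_Suc sum_distrib_right by (intro sum.cong refl) (auto simp: algebra_simps)
    also have "\<dots> = (\<Sum>j\<in>S. \<Sum>u'<Suc (Suc i). if T = S - {j} then
            (if u' = Suc u then ksign j T * M $$ (0, j) * v (S, Suc u) else 0) +
            (if u' = u then ksign j T * M $$ (1, j) * v (S, u) else 0) else 0)"
      by (rule sum.swap)
    also have "\<dots> = (\<Sum>j\<in>S. if T = S - {j} then ?h j S else 0)"
      using assms(3) by (intro sum.cong refl) (auto simp: sum.distrib simp del: sum.lessThan_Suc)
    finally show ?thesis .
  qed
  have "boundary ?E (Suc i) v (T, u) = (\<Sum>c\<in>?F \<times> {..<Suc (Suc i)}. dmat ?E (Suc i) (T, u) c * v c)"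
    using assms by (simp only: boundary_def mat_act_def gens) simp
  also have "\<dots> = (\<Sum>S\<in>?F. \<Sum>u'<Suc (Suc i). dmat ?E (Suc i) (T, u) (S, u') * v (S, u'))"
    by (subst sum.cartesian_product) (simp only: case_prod_beta' prod.collapse)
  also have "\<dots> = (\<Sum>S\<in>?F. \<Sum>j\<in>S. if T = S - {j} then ?h j S else 0)"
    by (simp only: *)
  also have "\<dots> = (\<Sum>j\<in>{..<dim_col M} - T. ?h j (insert j T))"
    by (rule sum_facets) (use assms in auto)
  finally show ?thesis by (simp add: en_diff_def contr_def sum.distrib)
qed

lemma boundary_outside: "r \<notin> gens F i \<Longrightarrow> boundary F i v r = 0"
  by (simp add: boundary_def mat_act_def)

lemma card_2_nat: "(S :: nat set) \<subseteq> A \<and> card S = 2 \<longleftrightarrow> (\<exists>p q. S = {p, q} \<and> p < q \<and> p \<in> A \<and> q \<in> A)"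
proof
  assume S: "S \<subseteq> A \<and> card S = 2"
  then obtain p q where pq: "S = {p, q}" "p \<noteq> q" by (auto simp: card_2_iff)
  show "\<exists>p q. S = {p, q} \<and> p < q \<and> p \<in> A \<and> q \<in> A"
  proof (cases "p < q")
    case True
    then show ?thesis using S pq by (intro exI[of _ p] exI[of _ q]) simp
  next
    case False
    then show ?thesis using S pq by (intro exI[of _ q] exI[of _ p]) (simp add: insert_commute)
  qed
qed auto

lemma en_boundary_0_sum:
  "boundary (eagon_northcott M) 0 v ({}, 0) =
    (\<Sum>(p, q)\<in>{(p, q). p < q \<and> q < dim_col M}. minor2 M p q * v ({p, q}, 0))"
proof -
  have "boundary (eagon_northcott M) 0 v ({}, 0) = (\<Sum>c\<in>{(S, u::nat). S \<subseteq> {..<dim_col M} \<and> card S = 2 \<and> u < 1}.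
      dmat (eagon_northcott M) 0 ({}, 0) c * v c)"
    by (simp add: boundary_def mat_act_def numeral_2_eq_2)
  also have "\<dots> = (\<Sum>(p, q)\<in>{(p, q). p < q \<and> q < dim_col M}. minor2 M p q * v ({p, q}, 0))"
  proof (rule sum.reindex_bij_witness[of _ "\<lambda>(p, q). ({p, q}, 0)" "\<lambda>c. (Min (fst c), Max (fst c))"])
    fix c assume "c \<in> {(S, u::nat). S \<subseteq> {..<dim_col M} \<and> card S = 2 \<and> u < 1}"
    then obtain S where S: "c = (S, 0)" "S \<subseteq> {..<dim_col M} \<and> card S = 2" by auto
    then obtain p q where "S = {p, q}" "p < q" "q < dim_col M"
      unfolding card_2_nat by auto
    with S show "(\<lambda>(p, q). ({p, q}, 0)) (Min (fst c), Max (fst c)) = c"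
      "(Min (fst c), Max (fst c)) \<in> {(p, q). p < q \<and> q < dim_col M}"
      "(\<lambda>(p, q). minor2 M p q * v ({p, q}, 0)) (Min (fst c), Max (fst c))
        = dmat (eagon_northcott M) 0 ({}, 0) c * v c"
      by (auto simp: dmat_0)
  next
    fix b assume "b \<in> {(p, q). p < q \<and> q < dim_col M}"
    then show "(Min (fst ((\<lambda>(p, q). ({p, q}, 0)) b)), Max (fst ((\<lambda>(p, q). ({p, q}, 0)) b))) = b"
      "(\<lambda>(p, q). ({p, q}, 0)) b \<in> {(S, u::nat). S \<subseteq> {..<dim_col M} \<and> card S = 2 \<and> u < 1}"
      by auto
  qed
  finally show ?thesis .
qed

lemma ksign_empty: "ksign p {} = 1"
  by (simp add: ksign_def)

lemma ksign_singleton: "ksign q {p} = (if p < q then - 1 else 1)"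
  by (simp add: ksign_insert ksign_empty)

text \<open>The minus sign is that of the ordered pairs: for \<open>p < q\<close>,
  \<open>(p, q)\<close> contributes \<open>- X p * Y q\<close> and \<open>(q, p)\<close> contributes
  \<open>X q * Y p\<close>, for the rows \<open>X\<close> and \<open>Y\<close> of
  \<open>M\<close>.\<close>

lemma en_boundary_0:
  "boundary (eagon_northcott M) 0 v ({}, 0) =
    - contr {..<dim_col M} (\<lambda>j. M $$ (0, j)) (contr {..<dim_col M} (\<lambda>j. M $$ (1, j)) (\<lambda>S. v (S, 0))) {}"
proof -
  let ?n = "dim_col M" and ?X = "\<lambda>j. M $$ (0, j)" and ?Y = "\<lambda>j. M $$ (1, j)" and ?v = "\<lambda>p q. v ({p, q}, 0)"
  define L where "L = {(p, q). p < q \<and> q < ?n}"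
  define U where "U = {(p, q). q < p \<and> p < ?n}"
  have fin: "finite L" "finite U"
    by (auto simp: L_def U_def intro: finite_subset[of _ "{..<?n} \<times> {..<?n}"])
  define f where "f p q = ?X p * (ksign q {p} * ?Y q * ?v p q)" for p q
  have "contr {..<?n} ?X (contr {..<?n} ?Y (\<lambda>S. v (S, 0))) {} = (\<Sum>p<?n. \<Sum>q\<in>{..<?n} - {p}. f p q)"
    by (simp add: contr_def f_def sum_distrib_left ksign_empty insert_commute)
  also have "\<dots> = (\<Sum>(p, q)\<in>Sigma {..<?n} (\<lambda>p. {..<?n} - {p}). f p q)"
    by (rule sum.Sigma) auto
  also have "Sigma {..<?n} (\<lambda>p. {..<?n} - {p}) = L \<union> U"
    by (auto simp: L_def U_def)
  also have "(\<Sum>(p, q)\<in>L \<union> U. f p q) = (\<Sum>(p, q)\<in>L. f p q) + (\<Sum>(p, q)\<in>U. f p q)"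
    by (rule sum.union_disjoint) (use fin in \<open>auto simp: L_def U_def\<close>)
  also have "(\<Sum>(p, q)\<in>U. f p q) = (\<Sum>(p, q)\<in>L. f q p)"
    by (rule sum.reindex_bij_witness[of _ prod.swap prod.swap]) (auto simp: L_def U_def)
  also have "(\<Sum>(p, q)\<in>L. f p q) + (\<Sum>(p, q)\<in>L. f q p) = (\<Sum>(p, q)\<in>L. f p q + f q p)"
    by (simp add: sum.distrib case_prod_beta)
  also have "\<dots> = (\<Sum>(p, q)\<in>L. - (minor2 M p q * ?v p q))"
    by (rule sum.cong) (auto simp: L_def f_def ksign_singleton minor2_def algebra_simps insert_commute)
  also have "\<dots> = - (\<Sum>(p, q)\<in>L. minor2 M p q * ?v p q)"
    by (simp add: sum_negf case_prod_beta)
  finally show ?thesis by (simp add: en_boundary_0_sum L_def)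
qed

lemma en_boundary_chain:
  assumes "v \<in> free_mod (eagon_northcott M) (Suc i)"
  shows "chain_on {..<dim_col M} (Suc (Suc i)) (\<lambda>S. v (S, u))"
  using assms by (auto simp: free_mod_def chain_on_def)

text \<open>Since \<open>v\<close> is arbitrary it is first truncated to the basis. A boundary reads
  no other coordinates, and the differential of the truncation has the right support, so the
  identity for \<open>en_diff\<close> applies.\<close>

lemma en_boundary_boundary:
  "boundary (eagon_northcott M) i (boundary (eagon_northcott M) (Suc i) v) = (\<lambda>_. 0)"
proof (rule ext)
  let ?E = "eagon_northcott M" and ?A = "{..<dim_col M}" and ?X = "\<lambda>j. M $$ (0, j)" and ?Y = "\<lambda>j. M $$ (1, j)"
  let ?v = "\<lambda>u S. if S \<subseteq> ?A \<and> card S = Suc (Suc (Suc i)) \<and> u < Suc (Suc i) then v (S, u) else 0"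
  let ?D = "en_diff ?A ?X ?Y"
  have D: "boundary ?E (Suc i) v (S, u) = ?D ?v u S" if "u < Suc i" for S u
  proof (cases "S \<subseteq> ?A \<and> card S = Suc (Suc i)")
    case True
    then have "finite S" using finite_subset by blast
    have "?D (\<lambda>u S. v (S, u)) u S = ?D ?v u S"
      unfolding en_diff_def
      by (intro arg_cong2[of _ _ _ _ "(+)"] contr_cong) (use True that \<open>finite S\<close> in auto)
    then show ?thesis using en_boundary_Suc[of S M i u v] True that by simp
  next
    case False
    have "chain_on ?A (Suc (Suc i)) (?D ?v u)"
      unfolding en_diff_def by (intro chain_on_add chain_on_contr) (auto simp: chain_on_def)
    then have "?D ?v u S = 0" using False unfolding chain_on_def by blast
    moreover have "boundary ?E (Suc i) v (S, u) = 0" by (rule boundary_outside) (use False in auto)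
    ultimately show ?thesis by simp
  qed
  fix r show "boundary ?E i (boundary ?E (Suc i) v) r = 0"
  proof (cases "r \<in> gens ?E i")
    case True
    show ?thesis
    proof (cases i)
      case 0
      then have r: "r = ({}, 0)" using True by simp
      have "(\<lambda>S. boundary ?E (Suc i) v (S, 0)) = ?D ?v 0" using D[of 0] by (simp add: fun_eq_iff)
      then show ?thesis using 0 r by (simp add: en_boundary_0 augmentation_en_diff)
    next
      case (Suc i')
      then obtain T u where r: "r = (T, u)" "T \<subseteq> ?A" "card T = Suc (Suc i')" "u < Suc i'" using True by auto
      have "boundary ?E i (boundary ?E (Suc i) v) r = ?D (\<lambda>u S. boundary ?E (Suc i) v (S, u)) u T"
        unfolding r(1) Suc by (rule en_boundary_Suc[OF r(2-4)])
      also have "\<dots> = ?D (?D ?v) u T"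
        using D r(4) Suc by (simp add: en_diff_def contr_def)
      also have "\<dots> = 0" by (simp add: en_diff_en_diff)
      finally show ?thesis .
    qed
  qed (simp add: boundary_outside)
qed

lemma finite_gens_en: "finite (gens (eagon_northcott M) i)"
proof (cases i)
  case (Suc i')
  have "gens (eagon_northcott M) i \<subseteq> Pow {..<dim_col M} \<times> {..<i}" using Suc by auto
  then show ?thesis by (rule finite_subset) simp
qed simp

lemma graded_free_complex_en:
  assumes M: "M \<in> carrier_mat 2 n" and lin: "linear_form_matrix M"
  shows "graded_free_complex (eagon_northcott M)"
  unfolding graded_free_complex_def
proof (intro conjI allI ballI finite_gens_en en_boundary_boundary)
  have dim: "dim_row M = 2" "dim_col M = n" using M by auto
  have hom: "homogeneous 1 (M $$ (r, j))" if "r < 2" "j < n" for r j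
    using lin that dim by (auto simp: linear_form_matrix_def)
  fix i r c assume r: "r \<in> gens (eagon_northcott M) i" and c: "c \<in> gens (eagon_northcott M) (Suc i)"
  obtain S u where S: "c = (S, u)" "S \<subseteq> {..<n}" "card S = Suc (Suc i)" using c dim by auto
  have fin: "finite S" "S \<noteq> {}" using S finite_subset by auto
  show "homogeneous (gdeg (eagon_northcott M) (Suc i) c - gdeg (eagon_northcott M) i r) (dmat (eagon_northcott M) i r c)"
  proof (cases i)
    case 0
    have "Min S < n" "Max S < n" using S(2) Min_in[OF fin] Max_in[OF fin] by blast+
    then have "homogeneous (1 + 1) (minor2 M (Min S) (Max S))"
      unfolding minor2_def by (intro homogeneous_diff homogeneous_mult hom) auto
    then show ?thesis using 0 S by (simp add: dmat_0)
  next
    case (Suc i')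
    obtain T v where T: "r = (T, v)" by force
    have "homogeneous 1 (dmat (eagon_northcott M) i r c)"
      unfolding S(1) T Suc dmat_Suc
      by (intro homogeneous_sum) (use hom S(2) in \<open>auto simp: homogeneous_ksign_mult intro!: homogeneous_add\<close>)
    then show ?thesis using Suc by simp
  qed
qed

lemma en_image_0:
  "{boundary (eagon_northcott M) 0 v ({}, 0) | v. v \<in> free_mod (eagon_northcott M) 1} = ideal.span (minors2 M)"
  (is "?I = _")
proof
  let ?E = "eagon_northcott M" and ?P = "{(p, q). p < q \<and> q < dim_col M}"
  have finP: "finite ?P" by (rule finite_subset[of _ "{..<dim_col M} \<times> {..<dim_col M}"]) auto
  show "?I \<subseteq> ideal.span (minors2 M)"
  proof clarify
    fix v
    show "boundary ?E 0 v ({}, 0) \<in> ideal.span (minors2 M)"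
      unfolding en_boundary_0_sum
    proof (rule ideal.span_sum)
      fix x assume "x \<in> ?P"
      then obtain p q where x: "x = (p, q)" "p < q" "q < dim_col M" by auto
      then have "minor2 M p q \<in> ideal.span (minors2 M)" by (intro ideal.span_base) (auto simp: minors2_def)
      then have "v ({p, q}, 0) * minor2 M p q \<in> ideal.span (minors2 M)" by (rule ideal.span_scale)
      then show "(case x of (p, q) \<Rightarrow> minor2 M p q * v ({p, q}, 0)) \<in> ideal.span (minors2 M)"
        using x by (simp add: mult.commute)
    qed
  qed
  have add: "boundary ?E 0 (\<lambda>c. v c + w c) r = boundary ?E 0 v r + boundary ?E 0 w r" for v w r
    by (simp add: boundary_def mat_act_def distrib_left sum.distrib)
  have scale: "boundary ?E 0 (\<lambda>c. a * v c) r = a * boundary ?E 0 v r" for a v r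
    by (simp add: boundary_def mat_act_def sum_distrib_left mult.left_commute)
  have "ideal.subspace ?I"
  proof (rule ideal.subspaceI)
    have "boundary ?E 0 (\<lambda>_. 0) ({}, 0) = 0" by (simp add: boundary_def mat_act_def)
    then show "0 \<in> ?I" by (intro CollectI exI[of _ "\<lambda>_. 0"]) (simp add: free_mod_def)
  next
    fix x y assume "x \<in> ?I" "y \<in> ?I"
    then obtain v w where "x = boundary ?E 0 v ({}, 0)" "y = boundary ?E 0 w ({}, 0)"
      "v \<in> free_mod ?E 1" "w \<in> free_mod ?E 1" by blast
    then show "x + y \<in> ?I" by (intro CollectI exI[of _ "\<lambda>c. v c + w c"]) (simp add: add free_mod_def)
  next
    fix a x assume "x \<in> ?I"
    then obtain v where "x = boundary ?E 0 v ({}, 0)" "v \<in> free_mod ?E 1" by blast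
    then show "a * x \<in> ?I" by (intro CollectI exI[of _ "\<lambda>c. a * v c"]) (simp add: scale free_mod_def)
  qed
  moreover have "minors2 M \<subseteq> ?I"
  proof
    fix x assume "x \<in> minors2 M"
    then obtain a b where x: "x = minor2 M a b" "a < b" "b < dim_col M" by (auto simp: minors2_def)
    let ?v = "\<lambda>c. if c = ({a, b}, 0) then 1 else 0"
    have "?v \<in> free_mod ?E 1" using x by (auto simp: free_mod_def)
    moreover have "boundary ?E 0 ?v ({}, 0) = (\<Sum>y\<in>?P. if y = (a, b) then minor2 M a b else 0)"
      unfolding en_boundary_0_sum
    proof (rule sum.cong[OF refl])
      fix y assume "y \<in> ?P"
      then have "(fst y = a \<and> snd y = b \<or> fst y = b \<and> snd y = a) = (y = (a, b))"
        using x(2) by (cases y) auto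
      then show "(case y of (p, q) \<Rightarrow> minor2 M p q * ?v ({p, q}, 0)) = (if y = (a, b) then minor2 M a b else 0)"
        by (simp add: case_prod_beta' doubleton_eq_iff)
    qed
    ultimately show "x \<in> ?I" using x finP by (intro CollectI exI[of _ ?v]) simp
  qed
  ultimately show "ideal.span (minors2 M) \<subseteq> ?I" by (rule ideal.span_minimal[rotated])
qed

text \<open>Exactness at every position \<open>i \<ge> 1\<close>, where for \<open>i = 1\<close> the
  augmentation takes the place of the cycle condition. The statement involves no grading and makes
  sense over every commutative ring, so it can be moved by a change of coordinates.\<close>

definition en_exact :: "nat \<Rightarrow> (nat \<Rightarrow> 'a::comm_ring_1) \<Rightarrow> (nat \<Rightarrow> 'a) \<Rightarrow> bool" where
  "en_exact n X Y \<longleftrightarrow> (\<forall>i v. 1 \<le> i \<longrightarrow> (\<forall>u<i. chain_on {..<n} (Suc i) (v u)) \<longrightarrow>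
      (\<forall>u T. Suc u < i \<longrightarrow> en_diff {..<n} X Y v u T = 0) \<longrightarrow>
      (i = 1 \<longrightarrow> contr {..<n} X (contr {..<n} Y (v 0)) {} = 0) \<longrightarrow>
      (\<exists>w. (\<forall>u<Suc i. chain_on {..<n} (Suc (Suc i)) (w u)) \<and>
           (\<forall>u<i. \<forall>T. en_diff {..<n} X Y w u T = v u T)))"

lemma (in en_degeneration) en_exact: "en_exact n X Y"
  unfolding en_exact_def by (intro allI impI exact) auto

lemma graded_free_resolution_en:
  assumes M: "M \<in> carrier_mat 2 n" and lin: "linear_form_matrix M"
    and ex: "en_exact n (\<lambda>j. M $$ (0, j)) (\<lambda>j. M $$ (1, j))"
  shows "graded_free_resolution (eagon_northcott M) (ideal.span (minors2 M))"
  unfolding graded_free_resolution_def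
proof (intro conjI allI)
  let ?E = "eagon_northcott M" and ?A = "{..<dim_col M}" and ?X = "\<lambda>j. M $$ (0, j)" and ?Y = "\<lambda>j. M $$ (1, j)"
  let ?D = "en_diff ?A ?X ?Y"
  have n: "n = dim_col M" using M by simp
  show "graded_free_complex ?E" by (rule graded_free_complex_en[OF M lin])
  show "\<exists>e. gens ?E 0 = {e} \<and> gdeg ?E 0 e = 0 \<and>
      {boundary ?E 0 v e | v. v \<in> free_mod ?E 1} = ideal.span (minors2 M)"
    using en_image_0[of M] by (intro exI[of _ "({}, 0)"]) simp
  fix i
  show "{v \<in> free_mod ?E (Suc i). boundary ?E i v = (\<lambda>_. 0)} = boundary ?E (Suc i) ` free_mod ?E (Suc (Suc i))"
  proof (intro equalityI subsetI)
    fix v assume "v \<in> boundary ?E (Suc i) ` free_mod ?E (Suc (Suc i))"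
    then show "v \<in> {v \<in> free_mod ?E (Suc i). boundary ?E i v = (\<lambda>_. 0)}"
      using boundary_outside[of _ ?E "Suc i"] by (auto simp: en_boundary_boundary free_mod_def simp del: eagon_northcott_sel)
  next
    fix v assume "v \<in> {v \<in> free_mod ?E (Suc i). boundary ?E i v = (\<lambda>_. 0)}"
    then have v: "v \<in> free_mod ?E (Suc i)" "\<And>r. boundary ?E i v r = 0" by auto
    let ?v = "\<lambda>u S. v (S, u)"
    have "\<exists>w. (\<forall>u<Suc (Suc i). chain_on {..<n} (Suc (Suc (Suc i))) (w u)) \<and>
           (\<forall>u<Suc i. \<forall>T. en_diff {..<n} ?X ?Y w u T = ?v u T)"
    proof (rule ex[unfolded en_exact_def, rule_format])
      show "1 \<le> Suc i" by simp
      show "chain_on {..<n} (Suc (Suc i)) (?v u)" for u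
        unfolding n by (rule en_boundary_chain[OF v(1)])
      show "en_diff {..<n} ?X ?Y ?v u T = 0" if u: "Suc u < Suc i" for u T
      proof (cases "T \<subseteq> ?A \<and> card T = Suc i")
        case True
        obtain i' where i: "i = Suc i'" using u by (cases i) auto
        show ?thesis
          unfolding n using en_boundary_Suc[of T M i' u v] True u i v(2) by simp
      next
        case False
        have "chain_on ?A (Suc i) (?D ?v u)"
          unfolding en_diff_def by (intro chain_on_add chain_on_contr en_boundary_chain[OF v(1)]) auto
        then show ?thesis using False unfolding n by (auto simp: chain_on_def)
      qed
      show "contr {..<n} ?X (contr {..<n} ?Y (?v 0)) {} = 0" if "Suc i = 1"
        unfolding n using en_boundary_0[of M v] v(2) that by simp
    qed
    then obtain w where w: "\<And>u. u < Suc (Suc i) \<Longrightarrow> chain_on ?A (Suc (Suc (Suc i))) (w u)"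
        "\<And>u T. u < Suc i \<Longrightarrow> ?D w u T = ?v u T"
      unfolding n by blast
    \<comment> \<open>Exactness controls \<open>w u\<close> only for the exponents of the basis, so
      other values are cut off.\<close>
    define w' where "w' c = (if snd c < Suc (Suc i) then w (snd c) (fst c) else 0)" for c
    have "w' \<in> free_mod ?E (Suc (Suc i))"
      using w(1) by (auto simp: free_mod_def w'_def chain_on_def)
    moreover have "v = boundary ?E (Suc i) w'"
    proof (rule ext)
      fix r
      show "v r = boundary ?E (Suc i) w' r"
      proof (cases "r \<in> gens ?E (Suc i)")
        case True
        then obtain T u where r: "r = (T, u)" "T \<subseteq> ?A" "card T = Suc (Suc i)" "u < Suc i" by auto
        have "boundary ?E (Suc i) w' r = ?D (\<lambda>u S. w' (S, u)) u T"
          unfolding r(1) by (rule en_boundary_Suc[OF r(2-4)])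
        also have "\<dots> = ?D w u T"
          using r(4) by (simp add: en_diff_def w'_def contr_def)
        finally show ?thesis using w(2)[OF r(4)] r(1) by simp
      next
        case False
        then show ?thesis
          using v(1) by (cases r) (simp add: boundary_outside free_mod_def del: eagon_northcott_sel)
      qed
    qed
    ultimately show "v \<in> boundary ?E (Suc i) ` free_mod ?E (Suc (Suc i))" by blast
  qed
qed

section \<open>Substitution homomorphisms\<close>

definition is_ring_hom :: "('a::comm_ring_1 \<Rightarrow> 'b::comm_ring_1) \<Rightarrow> bool" where
  "is_ring_hom f \<longleftrightarrow> (\<forall>x y. f (x + y) = f x + f y) \<and> (\<forall>x y. f (x * y) = f x * f y) \<and> f 1 = 1"

lemma ring_hom_add: "is_ring_hom f \<Longrightarrow> f (x + y) = f x + f y"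
  and ring_hom_mult: "is_ring_hom f \<Longrightarrow> f (x * y) = f x * f y"
  and ring_hom_one: "is_ring_hom f \<Longrightarrow> f 1 = 1"
  by (simp_all add: is_ring_hom_def)

lemma ring_hom_0: "is_ring_hom f \<Longrightarrow> f 0 = 0"
  using ring_hom_add[of f 0 0] by simp

lemma ring_hom_sum: "is_ring_hom f \<Longrightarrow> f (sum g A) = (\<Sum>x\<in>A. f (g x))"
  by (induction A rule: infinite_finite_induct) (simp_all add: ring_hom_0 ring_hom_add)

lemma ring_hom_uminus: "is_ring_hom f \<Longrightarrow> f (- x) = - f x"
  using ring_hom_add[of f x "- x"] by (simp add: ring_hom_0 eq_neg_iff_add_eq_0 add.commute)

lemma ring_hom_power: "is_ring_hom f \<Longrightarrow> f (x ^ k) = f x ^ k"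
  by (induction k) (simp_all add: ring_hom_one ring_hom_mult)

lemma ring_hom_ksign: "is_ring_hom f \<Longrightarrow> f (ksign j T) = ksign j T"
  by (simp add: ksign_def ring_hom_power ring_hom_uminus ring_hom_one)

lemma ring_hom_contr:
  "is_ring_hom f \<Longrightarrow> f (contr A X v T) = contr A (\<lambda>j. f (X j)) (\<lambda>S. f (v S)) T"
  by (simp add: contr_def ring_hom_sum ring_hom_mult ring_hom_ksign)

lemma ring_hom_en_diff:
  "is_ring_hom f \<Longrightarrow> f (en_diff A X Y v u T)
    = en_diff A (\<lambda>j. f (X j)) (\<lambda>j. f (Y j)) (\<lambda>u S. f (v u S)) u T"
  by (simp add: en_diff_def ring_hom_contr ring_hom_add)

lemma chain_on_ring_hom: "is_ring_hom f \<Longrightarrow> chain_on A r v \<Longrightarrow> chain_on A r (\<lambda>S. f (v S))"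
  unfolding chain_on_def by (metis ring_hom_0)

text \<open>The problem is mapped by \<open>f\<close>, solved there, and the solution mapped back by
  \<open>g\<close>, which returns the entries of the matrix and the cycle to the original
  ones.\<close>

lemma en_exact_ring_hom:
  assumes f: "is_ring_hom f" and g: "is_ring_hom g" and gf: "\<And>x. g (f x) = x"
    and ex: "en_exact n (\<lambda>j. f (X j)) (\<lambda>j. f (Y j))"
  shows "en_exact n X Y"
  unfolding en_exact_def
proof (intro allI impI)
  fix i v
  assume i: "1 \<le> i" and chain: "\<forall>u<i. chain_on {..<n} (Suc i) (v u)"
    and cyc: "\<forall>u T. Suc u < i \<longrightarrow> en_diff {..<n} X Y v u T = 0"
    and aug: "i = 1 \<longrightarrow> contr {..<n} X (contr {..<n} Y (v 0)) {} = 0"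
  have "\<exists>w. (\<forall>u<Suc i. chain_on {..<n} (Suc (Suc i)) (w u)) \<and>
      (\<forall>u<i. \<forall>T. en_diff {..<n} (\<lambda>j. f (X j)) (\<lambda>j. f (Y j)) w u T = f (v u T))"
  proof (rule ex[unfolded en_exact_def, rule_format, OF i])
    show "chain_on {..<n} (Suc i) (\<lambda>S. f (v u S))" if "u < i" for u
      using chain that by (intro chain_on_ring_hom[OF f]) simp
    show "en_diff {..<n} (\<lambda>j. f (X j)) (\<lambda>j. f (Y j)) (\<lambda>u S. f (v u S)) u T = 0" if "Suc u < i" for u T
      using ring_hom_en_diff[OF f, of "{..<n}" X Y v u T] cyc that by (simp add: ring_hom_0[OF f])
    show "contr {..<n} (\<lambda>j. f (X j)) (contr {..<n} (\<lambda>j. f (Y j)) (\<lambda>S. f (v 0 S))) {} = 0" if "i = 1"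
    proof -
      have "contr {..<n} (\<lambda>j. f (Y j)) (\<lambda>S. f (v 0 S)) = (\<lambda>T. f (contr {..<n} Y (v 0) T))"
        by (rule ext) (rule ring_hom_contr[OF f, symmetric])
      then show ?thesis
        using aug that ring_hom_contr[OF f, of "{..<n}" X "contr {..<n} Y (v 0)" "{}"]
        by (simp add: ring_hom_0[OF f])
    qed
  qed
  then obtain w where w: "\<And>u. u < Suc i \<Longrightarrow> chain_on {..<n} (Suc (Suc i)) (w u)"
    "\<And>u T. u < i \<Longrightarrow> en_diff {..<n} (\<lambda>j. f (X j)) (\<lambda>j. f (Y j)) w u T = f (v u T)" by blast
  show "\<exists>w. (\<forall>u<Suc i. chain_on {..<n} (Suc (Suc i)) (w u)) \<and> (\<forall>u<i. \<forall>T. en_diff {..<n} X Y w u T = v u T)"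
  proof (intro exI[of _ "\<lambda>u S. g (w u S)"] conjI allI impI)
    show "chain_on {..<n} (Suc (Suc i)) (\<lambda>S. g (w u S))" if "u < Suc i" for u
      by (rule chain_on_ring_hom[OF g w(1)[OF that]])
    show "en_diff {..<n} X Y (\<lambda>u S. g (w u S)) u T = v u T" if "u < i" for u T
    proof -
      have "en_diff {..<n} X Y (\<lambda>u S. g (w u S)) u T = g (f (v u T))"
        unfolding w(2)[OF that, symmetric] ring_hom_en_diff[OF g] by (simp only: gf)
      then show ?thesis by (simp only: gf)
    qed
  qed
qed

section \<open>Substitution of polynomials for the variables\<close>

definition subst_term :: "('n::finite \<Rightarrow> 'n ring_R) \<Rightarrow> ('n \<Rightarrow>\<^sub>0 nat) \<Rightarrow> complex \<Rightarrow> 'n ring_R" where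
  "subst_term f t a = Const a * (\<Prod>i\<in>UNIV. f i ^ Poly_Mapping.lookup t i)"

definition subst :: "('n::finite \<Rightarrow> 'n ring_R) \<Rightarrow> 'n ring_R \<Rightarrow> 'n ring_R" where
  "subst f p = (\<Sum>t\<in>Poly_Mapping.keys p. subst_term f t (Poly_Mapping.lookup p t))"

lemma subst_superset:
  assumes "finite A" "Poly_Mapping.keys p \<subseteq> A"
  shows "subst f p = (\<Sum>t\<in>A. subst_term f t (Poly_Mapping.lookup p t))"
  unfolding subst_def
  by (rule sum.mono_neutral_left) (use assms in \<open>auto simp: in_keys_iff subst_term_def\<close>)

lemma subst_add: "subst f (p + q) = subst f p + subst f q"
proof -
  let ?A = "Poly_Mapping.keys p \<union> Poly_Mapping.keys q"
  have "subst f (p + q) = (\<Sum>t\<in>?A. subst_term f t (Poly_Mapping.lookup (p + q) t))"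
    by (rule subst_superset) (simp_all add: keys_add)
  also have "\<dots> = (\<Sum>t\<in>?A. subst_term f t (Poly_Mapping.lookup p t))
      + (\<Sum>t\<in>?A. subst_term f t (Poly_Mapping.lookup q t))"
    by (simp add: lookup_add subst_term_def Const_add distrib_right sum.distrib)
  finally show ?thesis by (simp add: subst_superset[of ?A])
qed

lemma subst_0 [simp]: "subst f 0 = 0"
  by (simp add: subst_def)

lemma subst_sum: "subst f (sum g A) = (\<Sum>x\<in>A. subst f (g x))"
  by (induction A rule: infinite_finite_induct) (simp_all add: subst_add)

lemma subst_single: "subst f (Poly_Mapping.single t a) = subst_term f t a"
  by (cases "a = 0") (simp_all add: subst_def subst_term_def)

lemma subst_term_mult: "subst_term f (s + t) (a * b) = subst_term f s a * subst_term f t b"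
  by (simp add: subst_term_def Const_mult lookup_add power_add prod.distrib mult_ac)

lemma subst_mult: "subst f (p * q) = subst f p * subst f q"
proof -
  let ?m = "\<lambda>p t. Poly_Mapping.single t (Poly_Mapping.lookup p t)"
  have "p * q = (\<Sum>s\<in>Poly_Mapping.keys p. \<Sum>t\<in>Poly_Mapping.keys q. ?m p s * ?m q t)"
    by (subst poly_mapping_sum_monomials[of p], subst poly_mapping_sum_monomials[of q]) (rule sum_product)
  then have "subst f (p * q) = (\<Sum>s\<in>Poly_Mapping.keys p. \<Sum>t\<in>Poly_Mapping.keys q.
      subst_term f s (Poly_Mapping.lookup p s) * subst_term f t (Poly_Mapping.lookup q t))"
    by (simp add: subst_sum mult_single subst_single subst_term_mult)
  then show ?thesis by (simp add: subst_def sum_product)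
qed

lemma subst_Const [simp]: "subst f (Const a) = Const a"
  by (simp add: Const_def subst_single) (simp add: subst_term_def Const_def)

lemma subst_Var [simp]: "subst f (Var i) = f i"
proof -
  have "(\<Prod>j\<in>UNIV. f j ^ Poly_Mapping.lookup (Poly_Mapping.single i (1::nat)) j) = (\<Prod>j\<in>{i}. f j)"
    by (rule prod.mono_neutral_cong_right) (auto simp: lookup_single when_def)
  then show ?thesis by (simp add: Var_def subst_single subst_term_def)
qed

lemma is_ring_hom_subst: "is_ring_hom (subst f)"
  using subst_Const[of f 1] by (simp add: is_ring_hom_def subst_add subst_mult)

lemma ring_hom_prod: "is_ring_hom f \<Longrightarrow> f (prod g A) = (\<Prod>x\<in>A. f (g x))"
  by (induction A rule: infinite_finite_induct) (simp_all add: ring_hom_one ring_hom_mult)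

lemma subst_Var_id: "subst Var p = p"
proof -
  have *: "subst_term Var t a = Poly_Mapping.single t a" for t a
  proof -
    have pow: "Var i ^ k = Poly_Mapping.single (Poly_Mapping.single i k) 1" for i k
      by (induction k) (simp_all add: Var_def mult_single flip: single_add)
    have "(\<Prod>i\<in>A. Var i ^ Poly_Mapping.lookup t i)
        = Poly_Mapping.single (\<Sum>i\<in>A. Poly_Mapping.single i (Poly_Mapping.lookup t i)) 1" if "finite A" for A
      using that by induction (simp_all add: pow mult_single)
    moreover have "(\<Sum>i\<in>UNIV. Poly_Mapping.single i (Poly_Mapping.lookup t i)) = t"
      by (rule poly_mapping_eqI) (simp add: lookup_sum lookup_single when_def)
    ultimately show ?thesis by (simp add: subst_term_def Const_def mult_single)
  qed
  show ?thesis
    unfolding subst_def * by (rule poly_mapping_sum_monomials[symmetric])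
qed

lemma subst_inverse:
  assumes "\<And>i. subst g (f i) = Var i"
  shows "subst g (subst f p) = p"
proof -
  have "subst g (subst f p) = subst (\<lambda>i. subst g (f i)) p"
    by (simp add: subst_def[of f] subst_def[of "\<lambda>i. subst g (f i)"] subst_sum subst_term_def subst_mult
        ring_hom_prod[OF is_ring_hom_subst] ring_hom_power[OF is_ring_hom_subst])
  then show ?thesis using assms by (simp add: subst_Var_id)
qed

definition linear_form :: "('n::finite \<Rightarrow> complex) \<Rightarrow> 'n ring_R" where
  "linear_form a = (\<Sum>i\<in>UNIV. Const (a i) * Var i)"

lemma homogeneous_linear_form: "homogeneous 1 (linear_form a)"
  unfolding linear_form_def
  by (intro homogeneous_sum) (use homogeneous_mult[OF homogeneous_Const homogeneous_Var] in simp)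

lemma lookup_linear_form: "Poly_Mapping.lookup (linear_form a) (Poly_Mapping.single i 1) = a i"
proof -
  have "Poly_Mapping.single j (1::nat) = Poly_Mapping.single i 1 \<longleftrightarrow> j = i" for j
    by (metis lookup_single_eq lookup_single_not_eq zero_neq_one)
  then show ?thesis
    by (simp add: linear_form_def lookup_sum lookup_Const_mult Var_def lookup_single when_def if_distrib cong: if_cong)
qed

lemma linear_form_nonzero: "a i \<noteq> 0 \<Longrightarrow> linear_form a \<noteq> 0"
  using lookup_linear_form[of a i] by auto

lemma linear_form_add: "linear_form (\<lambda>i. a i + b i) = linear_form a + linear_form b"
  by (simp add: linear_form_def Const_add distrib_right sum.distrib)

lemma linear_form_scale: "linear_form (\<lambda>i. c * a i) = Const c * linear_form a"
  by (simp add: linear_form_def Const_mult sum_distrib_left mult.assoc)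

lemma linear_form_sum: "linear_form (\<lambda>i. \<Sum>x\<in>A. f x i) = (\<Sum>x\<in>A. linear_form (f x))"
proof -
  have "linear_form (\<lambda>i. \<Sum>x\<in>A. f x i) = (\<Sum>i\<in>UNIV. \<Sum>x\<in>A. Const (f x i) * Var i)"
    by (simp add: linear_form_def Const_sum sum_distrib_right)
  also have "\<dots> = (\<Sum>x\<in>A. linear_form (f x))"
    unfolding linear_form_def by (rule sum.swap)
  finally show ?thesis .
qed

lemma subst_linear_form: "subst f (linear_form a) = (\<Sum>i\<in>UNIV. Const (a i) * f i)"
  by (simp add: linear_form_def subst_sum subst_mult)

section \<open>Linear resolutions inside minimal resolutions\<close>

lemma order_ge_UNIV_split:
  obtains p' where "p = Const (Poly_Mapping.lookup p 0) + p'" "order_ge UNIV 1 p'"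
proof (rule that[of "p - Const (Poly_Mapping.lookup p 0)"])
  have "wdeg UNIV t \<noteq> 0" if "t \<in> Poly_Mapping.keys (p - Const (Poly_Mapping.lookup p 0))" for t
  proof
    assume "wdeg UNIV t = 0"
    then have "t = 0" by (intro poly_mapping_eqI) (simp add: wdeg_def)
    then show False using that by (simp add: in_keys_iff lookup_minus lookup_Const)
  qed
  then show "order_ge UNIV 1 (p - Const (Poly_Mapping.lookup p 0))"
    unfolding order_ge_def by (metis One_nat_def Suc_leI neq0_conv)
qed simp

lemma homogeneous_lookup: "homogeneous e p \<Longrightarrow> int (total_deg t) \<noteq> e \<Longrightarrow> Poly_Mapping.lookup p t = 0"
  unfolding homogeneous_def by (meson in_keys_iff)

text \<open>All terms of \<open>q\<close> have degree \<open>a\<close>, so in degrees up to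
  \<open>a\<close> the product sees only the constant term of \<open>p\<close>.\<close>

lemma lookup_homogeneous_mult:
  assumes "homogeneous a q" "int (total_deg t) \<le> a"
  shows "Poly_Mapping.lookup (q * p) t =
    (if int (total_deg t) = a then Poly_Mapping.lookup (q * Const (Poly_Mapping.lookup p 0)) t else 0)"
proof -
  obtain k where a: "a = int k" using assms(2) by (metis nonneg_int_cases of_nat_0_le_iff order_trans)
  have q: "order_ge UNIV k q"
    using assms(1) unfolding a by (simp add: homogeneous_def order_ge_def total_deg_eq_wdeg)
  show ?thesis
  proof (cases "int (total_deg t) = a")
    case True
    obtain p' where p': "p = Const (Poly_Mapping.lookup p 0) + p'" "order_ge UNIV 1 p'"
      by (rule order_ge_UNIV_split)
    have "order_ge UNIV (k + 1) (q * p')" by (rule order_ge_mult[OF q p'(2)])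
    then have "Poly_Mapping.lookup (q * p') t = 0"
      by (rule order_ge_lookup) (use True a in \<open>simp add: total_deg_eq_wdeg\<close>)
    then show ?thesis using True by (subst p'(1)) (simp add: distrib_left lookup_add)
  next
    case False
    have "order_ge UNIV (k + 0) (q * p)" by (rule order_ge_mult[OF q]) simp
    then have "Poly_Mapping.lookup (q * p) t = 0"
      by (rule order_ge_lookup) (use False assms(2) a in \<open>simp add: total_deg_eq_wdeg\<close>)
    then show ?thesis using False by simp
  qed
qed

lemma lookup_mult_0:
  "Poly_Mapping.lookup (q * p :: 'n::finite ring_R) 0 = Poly_Mapping.lookup q 0 * Poly_Mapping.lookup p 0"
proof -
  obtain q' where q': "q = Const (Poly_Mapping.lookup q 0) + q'" "order_ge UNIV 1 q'"
    by (rule order_ge_UNIV_split)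
  have "order_ge UNIV (1 + 0) (q' * p)" by (rule order_ge_mult[OF q'(2)]) simp
  then have "Poly_Mapping.lookup (q' * p) 0 = 0" by (rule order_ge_lookup) simp
  then show ?thesis by (subst q'(1)) (simp add: distrib_right lookup_add lookup_Const_mult)
qed

lemma homogeneous_nonpos_eq_0:
  assumes "homogeneous a p" "a \<le> 0" "Poly_Mapping.lookup p 0 = 0"
  shows "p = 0"
proof (rule poly_mapping_eqI)
  fix t
  show "Poly_Mapping.lookup p t = Poly_Mapping.lookup 0 t"
  proof (cases "t \<in> Poly_Mapping.keys p")
    case True
    then have "wdeg UNIV t = 0" using assms(1,2) by (auto simp: homogeneous_def total_deg_eq_wdeg)
    then have "t = 0" by (intro poly_mapping_eqI) (simp add: wdeg_def)
    then show ?thesis using assms(3) by simp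
  qed (simp add: in_keys_iff)
qed

definition unit_at :: "'b \<Rightarrow> 'b \<Rightarrow> 'a::zero_neq_one" where
  "unit_at b c = (if c = b then 1 else 0)"

lemma unit_at_free_mod: "b \<in> gens F i \<Longrightarrow> unit_at b \<in> free_mod F i"
  by (auto simp: free_mod_def unit_at_def)

lemma boundary_unit_at:
  assumes "finite (gens F (Suc i))" "b \<in> gens F (Suc i)" "r \<in> gens F i"
  shows "boundary F i (unit_at b) r = dmat F i r b"
proof -
  have "boundary F i (unit_at b) r = (\<Sum>c\<in>gens F (Suc i). if c = b then dmat F i r c else 0)"
    using assms(3) by (auto simp: boundary_def mat_act_def unit_at_def intro!: sum.cong)
  then show ?thesis using assms by simp
qed

text \<open>A generator of lower degree would have a zero column: for \<open>i = 0\<close> because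
  \<open>J\<close> has nothing below degree 2, later because the entries would have degree at most 0
  and no constant term. Its basis vector would be a cycle, hence a boundary, although boundaries in
  a minimal resolution have no constant terms.\<close>

lemma minimal_resolution_gdeg:
  assumes F: "minimal_graded_free_resolution F J"
    and J: "\<And>p t. p \<in> J \<Longrightarrow> t \<in> Poly_Mapping.keys p \<Longrightarrow> 2 \<le> total_deg t"
    and b: "b \<in> gens F (Suc i)"
  shows "int (Suc (Suc i)) \<le> gdeg F (Suc i) b"
  using b
proof (induction i arbitrary: b rule: less_induct)
  case (less i)
  note b = less.prems
  have res: "graded_free_resolution F J" and cplx: "graded_free_complex F"
    and min: "\<And>i r c. r \<in> gens F i \<Longrightarrow> c \<in> gens F (Suc i) \<Longrightarrow> Poly_Mapping.lookup (dmat F i r c) 0 = 0"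
    using F by (auto simp: minimal_graded_free_resolution_def graded_free_resolution_def)
  have fin: "finite (gens F i)" for i using cplx by (simp add: graded_free_complex_def)
  have hom: "homogeneous (gdeg F (Suc i) c - gdeg F i r) (dmat F i r c)"
    if "r \<in> gens F i" "c \<in> gens F (Suc i)" for i r c
    using cplx that by (simp add: graded_free_complex_def)
  have ker: "{v \<in> free_mod F (Suc i). boundary F i v = (\<lambda>_. 0)} = boundary F (Suc i) ` free_mod F (Suc (Suc i))"
    using res by (simp add: graded_free_resolution_def)
  show "int (Suc (Suc i)) \<le> gdeg F (Suc i) b"
  proof (rule ccontr)
    assume neg: "\<not> int (Suc (Suc i)) \<le> gdeg F (Suc i) b"
    have zero: "dmat F i r b = 0" if r: "r \<in> gens F i" for r
    proof (cases i)
      case 0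
      obtain e where e: "gens F 0 = {e}" "gdeg F 0 e = 0"
          "{boundary F 0 v e | v. v \<in> free_mod F 1} = J"
        using res by (auto simp: graded_free_resolution_def)
      have re: "r = e" using r 0 e by simp
      have "boundary F 0 (unit_at b) e \<in> J"
        using e(3) unit_at_free_mod[OF b] 0 by auto
      then have "dmat F 0 r b \<in> J"
        using boundary_unit_at[OF fin b[unfolded 0], of r] r 0 re by simp
      moreover have "homogeneous (gdeg F (Suc 0) b) (dmat F 0 r b)"
        using hom[OF r b] 0 re e(2) by simp
      ultimately have "t \<notin> Poly_Mapping.keys (dmat F 0 r b)" for t
        using J[of "dmat F 0 r b" t] neg 0 by (auto simp: homogeneous_def)
      then have "Poly_Mapping.keys (dmat F 0 r b) = {}" by blast
      then show ?thesis using 0 by simp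
    next
      case (Suc i')
      have "int (Suc i) \<le> gdeg F i r" using less.IH[of i' r] r Suc by simp
      then have "gdeg F (Suc i) b - gdeg F i r \<le> 0" using neg by simp
      then show ?thesis by (rule homogeneous_nonpos_eq_0[OF hom[OF r b] _ min[OF r b]])
    qed
    have "boundary F i (unit_at b) r = 0" for r
    proof (cases "r \<in> gens F i")
      case True
      then show ?thesis using boundary_unit_at[OF fin b] zero by simp
    qed (rule boundary_outside)
    then have "unit_at b \<in> boundary F (Suc i) ` free_mod F (Suc (Suc i))"
      unfolding ker[symmetric] using unit_at_free_mod[OF b] by auto
    then obtain w where "unit_at b = boundary F (Suc i) w" by blast
    then have "unit_at b b = (\<Sum>c\<in>gens F (Suc (Suc i)). dmat F (Suc i) b c * w c)"
      using b by (simp add: boundary_def mat_act_def)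
    then have "Poly_Mapping.lookup (unit_at b b :: 'b ring_R) 0 = 0"
      using min[OF b] by (simp add: lookup_sum lookup_mult_0)
    then show False by (simp add: unit_at_def)
  qed
qed

text \<open>By degree the comparison map has constant entries. If it kills an element, it also kills the
  constant vectors of coefficients of that element; by induction these are cycles, hence boundaries,
  whose entries have no constant terms.\<close>

lemma linear_resolution_embeds:
  fixes E :: "('c, 'n::finite) free_seq" and F :: "('b, 'n) free_seq"
  assumes E: "graded_free_resolution E J'" and E0: "gens E 0 = {e0}" "gdeg E 0 e0 = 0"
    and E_lin: "\<And>i c. c \<in> gens E (Suc i) \<Longrightarrow> gdeg E (Suc i) c = int (Suc (Suc i))"
    and F: "minimal_graded_free_resolution F J" and JJ: "J' \<subseteq> J"
    and J: "\<And>p t. p \<in> J \<Longrightarrow> t \<in> Poly_Mapping.keys p \<Longrightarrow> 2 \<le> total_deg t"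
  shows "embeds_as_subcomplex E F"
proof -
  have resF: "graded_free_resolution F J" and cF: "graded_free_complex F" and cE: "graded_free_complex E"
    using F E by (auto simp: minimal_graded_free_resolution_def graded_free_resolution_def)
  have finF: "finite (gens F i)" and finE: "finite (gens E i)" for i
    using cF cE by (simp_all add: graded_free_complex_def)
  have homF: "homogeneous (gdeg F (Suc i) c - gdeg F i r) (dmat F i r c)"
    if "r \<in> gens F i" "c \<in> gens F (Suc i)" for i r c
    using cF that by (simp add: graded_free_complex_def)
  have homE: "homogeneous (gdeg E (Suc i) c - gdeg E i r) (dmat E i r c)"
    if "r \<in> gens E i" "c \<in> gens E (Suc i)" for i r c
    using cE that by (simp add: graded_free_complex_def)
  have kerF: "{v \<in> free_mod F (Suc i). boundary F i v = (\<lambda>_. 0)} = boundary F (Suc i) ` free_mod F (Suc (Suc i))"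
    and kerE: "{v \<in> free_mod E (Suc i). boundary E i v = (\<lambda>_. 0)} = boundary E (Suc i) ` free_mod E (Suc (Suc i))" for i
    using resF E by (simp_all add: graded_free_resolution_def)
  obtain f0 where f0: "gens F 0 = {f0}" "gdeg F 0 f0 = 0" "{boundary F 0 v f0 | v. v \<in> free_mod F 1} = J"
    using resF by (auto simp: graded_free_resolution_def)
  have J': "{boundary E 0 v e0 | v. v \<in> free_mod E 1} = J'"
    using E E0 by (auto simp: graded_free_resolution_def)
  have gdegF: "int (Suc (Suc i)) \<le> gdeg F (Suc i) b" if "b \<in> gens F (Suc i)" for i b
    by (rule minimal_resolution_gdeg[OF F J that])

  \<comment> \<open>\<open>T n K c\<close> is the image under the constant matrix \<open>K\<close>
    of the boundary of the generator \<open>c\<close>. \<open>P\<close> carries the induction: these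
    images are boundaries in \<open>F\<close>. \<open>Q\<close> is commutation with the
    differentials.\<close>
  define T where "T n K c r = (if r \<in> gens F n then \<Sum>c'\<in>gens E n. Const (K r c') * dmat E n c' c else 0)"
    for n and K :: "'b \<Rightarrow> 'c \<Rightarrow> complex" and c r
  define P where "P n K \<longleftrightarrow> (n = 0 \<longrightarrow> K = (\<lambda>_ _. 1)) \<and>
      (\<forall>b\<in>gens F n. \<forall>c\<in>gens E n. K b c \<noteq> 0 \<longrightarrow> gdeg F n b = gdeg E n c) \<and>
      (\<forall>c\<in>gens E (Suc n). \<exists>w\<in>free_mod F (Suc n). boundary F n w = T n K c)" for n K
  define Q where "Q n K K' \<longleftrightarrow> (\<forall>r\<in>gens F n. \<forall>c\<in>gens E (Suc n).
      (\<Sum>b\<in>gens F (Suc n). dmat F n r b * Const (K' b c)) = (\<Sum>c'\<in>gens E n. Const (K r c') * dmat E n c' c))"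
    for n K K'
  have "\<exists>K. \<forall>n. P n (K n) \<and> Q n (K n) (K (Suc n))"
  proof (rule dependent_nat_choice)
    have "\<exists>w\<in>free_mod F (Suc 0). boundary F 0 w = T 0 (\<lambda>_ _. 1) c" if c: "c \<in> gens E (Suc 0)" for c
    proof -
      have "boundary E 0 (unit_at c) e0 \<in> J'" using J' unit_at_free_mod[OF c] by auto
      then have "dmat E 0 e0 c \<in> J" using boundary_unit_at[OF finE c, of e0] E0 JJ by auto
      then obtain w where w: "w \<in> free_mod F (Suc 0)" "boundary F 0 w f0 = dmat E 0 e0 c"
        using f0(3) by auto
      have "boundary F 0 w r = T 0 (\<lambda>_ _. 1) c r" for r
        using w(2) boundary_outside[of r F 0 w] f0(1) E0(1) by (auto simp: T_def)
      then show ?thesis using w(1) by blast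
    qed
    then show "\<exists>K. P 0 K" unfolding P_def using f0 E0 by (intro exI[of _ "\<lambda>_ _. 1"]) auto
  next
    fix K n assume PK: "P n K"
    have "\<forall>c\<in>gens E (Suc n). \<exists>w. w \<in> free_mod F (Suc n) \<and> boundary F n w = T n K c"
      using PK by (auto simp: P_def)
    then obtain w where w: "\<And>c. c \<in> gens E (Suc n) \<Longrightarrow> w c \<in> free_mod F (Suc n)"
        "\<And>c. c \<in> gens E (Suc n) \<Longrightarrow> boundary F n (w c) = T n K c"
      by metis
    \<comment> \<open>Of the lift only the constant terms on generators of degree
      \<open>n + 2\<close> are kept. This is still a lift: the target is homogeneous of the matching
      degree, and no generator of \<open>F\<close> in this position has smaller degree.\<close>
    define K' where "K' b c = (if gdeg F (Suc n) b = int (Suc (Suc n)) then Poly_Mapping.lookup (w c b) 0 else 0)" for b c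
    have QK: "Q n K K'"
      unfolding Q_def
    proof (intro ballI)
      fix r c assume r: "r \<in> gens F n" and c: "c \<in> gens E (Suc n)"
      let ?e = "int (Suc (Suc n)) - gdeg F n r"
      have tgt: "(\<Sum>b\<in>gens F (Suc n). dmat F n r b * w c b) = T n K c r"
        using arg_cong[OF w(2)[OF c], of "\<lambda>f. f r"] r by (simp add: boundary_def mat_act_def)
      have homT: "homogeneous ?e (T n K c r)"
      proof -
        have "homogeneous ?e (Const (K r c') * dmat E n c' c)" if c': "c' \<in> gens E n" for c'
        proof (cases "K r c' = 0")
          case False
          then have "gdeg F n r = gdeg E n c'" using PK r c' by (auto simp: P_def)
          then have "homogeneous ?e (dmat E n c' c)" using homE[OF c' c] E_lin[OF c] by simp
          then show ?thesis using homogeneous_mult[OF homogeneous_Const] by fastforce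
        qed simp
        then show ?thesis using r by (auto simp: T_def intro: homogeneous_sum)
      qed
      have homL: "homogeneous ?e (\<Sum>b\<in>gens F (Suc n). dmat F n r b * Const (K' b c))"
      proof (rule homogeneous_sum)
        fix b assume b: "b \<in> gens F (Suc n)"
        show "homogeneous ?e (dmat F n r b * Const (K' b c))"
        proof (cases "gdeg F (Suc n) b = int (Suc (Suc n))")
          case True
          then show ?thesis using homogeneous_mult[OF homF[OF r b] homogeneous_Const] by simp
        qed (simp add: K'_def)
      qed
      have "(\<Sum>b\<in>gens F (Suc n). dmat F n r b * Const (K' b c)) = T n K c r"
      proof (rule poly_mapping_eqI)
        fix t
        show "Poly_Mapping.lookup (\<Sum>b\<in>gens F (Suc n). dmat F n r b * Const (K' b c)) t
            = Poly_Mapping.lookup (T n K c r) t"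
        proof (cases "int (total_deg t) = ?e")
          case False
          then show ?thesis using homogeneous_lookup[OF homT] homogeneous_lookup[OF homL] by simp
        next
          case True
          have "Poly_Mapping.lookup (dmat F n r b * w c b) t = Poly_Mapping.lookup (dmat F n r b * Const (K' b c)) t"
            if b: "b \<in> gens F (Suc n)" for b
          proof -
            have "int (total_deg t) \<le> gdeg F (Suc n) b - gdeg F n r" using gdegF[OF b] True by simp
            from lookup_homogeneous_mult[OF homF[OF r b] this, of "w c b"] True
            show ?thesis by (simp add: K'_def)
          qed
          then show ?thesis unfolding tgt[symmetric] lookup_sum by (intro sum.cong) auto
        qed
      qed
      then show "(\<Sum>b\<in>gens F (Suc n). dmat F n r b * Const (K' b c)) = (\<Sum>c'\<in>gens E n. Const (K r c') * dmat E n c' c)"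
        using r by (simp add: T_def)
    qed
    have "\<exists>y\<in>free_mod F (Suc (Suc n)). boundary F (Suc n) y = T (Suc n) K' c2" if c2: "c2 \<in> gens E (Suc (Suc n))" for c2
    proof -
      have dd: "(\<Sum>c'\<in>gens E (Suc n). dmat E n c'' c' * dmat E (Suc n) c' c2) = 0" if "c'' \<in> gens E n" for c''
      proof -
        have "boundary E n (boundary E (Suc n) (unit_at c2)) c'' = 0"
          using cE unit_at_free_mod[OF c2] by (simp add: graded_free_complex_def)
        then show ?thesis
          using that boundary_unit_at[OF finE c2] by (simp add: boundary_def[of E n] mat_act_def)
      qed
      have "boundary F n (T (Suc n) K' c2) r = 0" for r
      proof (cases "r \<in> gens F n")
        case r: True
        have "boundary F n (T (Suc n) K' c2) r
            = (\<Sum>b\<in>gens F (Suc n). \<Sum>c'\<in>gens E (Suc n). dmat F n r b * Const (K' b c') * dmat E (Suc n) c' c2)"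
          using r by (simp add: boundary_def mat_act_def T_def sum_distrib_left mult.assoc)
        also have "\<dots> = (\<Sum>c'\<in>gens E (Suc n). (\<Sum>b\<in>gens F (Suc n). dmat F n r b * Const (K' b c')) * dmat E (Suc n) c' c2)"
          unfolding sum_distrib_right by (rule sum.swap)
        also have "\<dots> = (\<Sum>c'\<in>gens E (Suc n). \<Sum>c''\<in>gens E n. Const (K r c'') * (dmat E n c'' c' * dmat E (Suc n) c' c2))"
          using QK r unfolding Q_def by (intro sum.cong refl) (simp add: sum_distrib_right mult.assoc)
        also have "\<dots> = (\<Sum>c''\<in>gens E n. Const (K r c'') * (\<Sum>c'\<in>gens E (Suc n). dmat E n c'' c' * dmat E (Suc n) c' c2))"
          unfolding sum_distrib_left by (rule sum.swap)
        also have "\<dots> = 0" by (simp add: dd)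
        finally show ?thesis .
      qed (rule boundary_outside)
      then have "T (Suc n) K' c2 \<in> boundary F (Suc n) ` free_mod F (Suc (Suc n))"
        unfolding kerF[symmetric] by (auto simp: free_mod_def T_def)
      then show ?thesis by (metis imageE)
    qed
    then have "P (Suc n) K'" unfolding P_def using E_lin by (auto simp: K'_def)
    with QK show "\<exists>K'. P (Suc n) K' \<and> Q n K K'" by blast
  qed
  then obtain K where P: "\<And>n. P n (K n)" and Q: "\<And>n. Q n (K n) (K (Suc n))" by blast
  define \<phi> where "\<phi> n b c = (Const (K n b c) :: 'n ring_R)" for n b c
  let ?\<Phi> = "\<lambda>n. mat_act (gens F n) (gens E n) (\<phi> n)"
  have chain: "boundary F i (?\<Phi> (Suc i) v) = ?\<Phi> i (boundary E i v)" for i v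
  proof (rule ext)
    fix r show "boundary F i (?\<Phi> (Suc i) v) r = ?\<Phi> i (boundary E i v) r"
    proof (cases "r \<in> gens F i")
      case r: True
      have "boundary F i (?\<Phi> (Suc i) v) r
          = (\<Sum>b\<in>gens F (Suc i). \<Sum>c\<in>gens E (Suc i). dmat F i r b * Const (K (Suc i) b c) * v c)"
        using r by (simp add: boundary_def mat_act_def \<phi>_def sum_distrib_left mult.assoc)
      also have "\<dots> = (\<Sum>c\<in>gens E (Suc i). (\<Sum>b\<in>gens F (Suc i). dmat F i r b * Const (K (Suc i) b c)) * v c)"
        unfolding sum_distrib_right by (rule sum.swap)
      also have "\<dots> = (\<Sum>c\<in>gens E (Suc i). \<Sum>c'\<in>gens E i. Const (K i r c') * (dmat E i c' c * v c))"
        using Q[of i] r unfolding Q_def by (intro sum.cong refl) (simp add: sum_distrib_right mult.assoc)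
      also have "\<dots> = (\<Sum>c'\<in>gens E i. Const (K i r c') * (\<Sum>c\<in>gens E (Suc i). dmat E i c' c * v c))"
        unfolding sum_distrib_left by (rule sum.swap)
      also have "\<dots> = ?\<Phi> i (boundary E i v) r"
        using r by (simp add: boundary_def mat_act_def \<phi>_def)
      finally show ?thesis .
    qed (simp add: boundary_def mat_act_def)
  qed
  have inj: "v = (\<lambda>_. 0)" if "v \<in> free_mod E i" "?\<Phi> i v = (\<lambda>_. 0)" for i v
    using that
  proof (induction i arbitrary: v)
    case 0
    have "K 0 = (\<lambda>_ _. 1)" using P[of 0] by (simp add: P_def)
    then have "v e0 = 0"
      using fun_cong[OF 0(2), of f0] by (simp add: mat_act_def \<phi>_def f0(1) E0(1))
    then show ?case using 0(1) E0(1) by (auto simp: free_mod_def)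
  next
    case (Suc i)
    have coeff: "Poly_Mapping.lookup (v c) t = 0" if c: "c \<in> gens E (Suc i)" for c t
    proof -
      define vt where "vt c = (Const (Poly_Mapping.lookup (v c) t) :: 'n ring_R)" for c
      have vt: "vt \<in> free_mod E (Suc i)" using Suc.prems(1) by (simp add: free_mod_def vt_def)
      have "?\<Phi> (Suc i) vt r = 0" for r
      proof (cases "r \<in> gens F (Suc i)")
        case True
        have "?\<Phi> (Suc i) vt r = Const (\<Sum>c\<in>gens E (Suc i). K (Suc i) r c * Poly_Mapping.lookup (v c) t)"
          using True by (simp add: mat_act_def \<phi>_def vt_def Const_sum Const_mult)
        also have "\<dots> = Const (Poly_Mapping.lookup (?\<Phi> (Suc i) v r) t)"
          using True by (simp add: mat_act_def \<phi>_def lookup_sum lookup_Const_mult)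
        finally show ?thesis using Suc.prems(2) by simp
      qed (simp add: mat_act_def)
      then have "?\<Phi> (Suc i) vt = (\<lambda>_. 0)" by blast
      then have "?\<Phi> i (boundary E i vt) = (\<lambda>_. 0)"
        unfolding chain[symmetric] by (simp add: boundary_def mat_act_def fun_eq_iff)
      moreover have "boundary E i vt \<in> free_mod E i"
        by (simp add: free_mod_def boundary_def mat_act_def)
      ultimately have "boundary E i vt = (\<lambda>_. 0)" by (intro Suc.IH)
      then have "vt \<in> boundary E (Suc i) ` free_mod E (Suc (Suc i))"
        unfolding kerE[symmetric] using vt by simp
      then obtain w where "vt = boundary E (Suc i) w" by blast
      then have "vt c = (\<Sum>c2\<in>gens E (Suc (Suc i)). dmat E (Suc i) c c2 * w c2)"
        using c by (simp add: boundary_def mat_act_def)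
      moreover have "Poly_Mapping.lookup (dmat E (Suc i) c c2) 0 = 0" if c2: "c2 \<in> gens E (Suc (Suc i))" for c2
        by (rule homogeneous_lookup[OF homE[OF c c2]]) (simp add: E_lin[OF c] E_lin[OF c2] total_deg_def)
      ultimately have "Poly_Mapping.lookup (vt c) 0 = 0" by (simp add: lookup_sum lookup_mult_0)
      then show ?thesis by (simp add: vt_def lookup_Const)
    qed
    show ?case
    proof (rule ext)
      fix c show "v c = 0"
        using coeff[of c] Suc.prems(1) by (cases "c \<in> gens E (Suc i)") (auto simp: free_mod_def intro: poly_mapping_eqI)
    qed
  qed
  show ?thesis
    unfolding embeds_as_subcomplex_def
  proof (intro exI[of _ \<phi>] conjI allI ballI chain)
    fix i r c assume "r \<in> gens F i" "c \<in> gens E i"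
    then have "K i r c \<noteq> 0 \<longrightarrow> gdeg F i r = gdeg E i c" using P[of i] by (auto simp: P_def)
    then show "homogeneous (gdeg E i c - gdeg F i r) (\<phi> i r c)"
      using homogeneous_Const[of "K i r c"] by (cases "K i r c = 0") (auto simp: \<phi>_def)
  next
    fix i show "inj_on (?\<Phi> i) (free_mod E i)"
    proof (rule inj_onI)
      fix v w assume v: "v \<in> free_mod E i" and w: "w \<in> free_mod E i" and eq: "?\<Phi> i v = ?\<Phi> i w"
      have "(\<lambda>c. v c - w c) = (\<lambda>_. 0)"
      proof (rule inj)
        show "(\<lambda>c. v c - w c) \<in> free_mod E i" using v w by (simp add: free_mod_def)
        have "?\<Phi> i (\<lambda>c. v c - w c) r = ?\<Phi> i v r - ?\<Phi> i w r" for r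
          by (simp add: mat_act_def right_diff_distrib sum_subtractf)
        then show "?\<Phi> i (\<lambda>c. v c - w c) = (\<lambda>_. 0)" using eq by (simp add: fun_eq_iff)
      qed
      then show "v = w" by (simp add: fun_eq_iff)
    qed
  qed
qed

section \<open>Linear forms on three-space\<close>

definition ev :: "complex vec \<Rightarrow> (nat \<Rightarrow> complex) \<Rightarrow> complex" where
  "ev a x = (\<Sum>i<3. a $ i * x i)"

lemma ev_add_scale [simp]: "ev a (\<lambda>i. x i + s * y i) = ev a x + s * ev a y"
  by (simp add: ev_def sum.distrib sum_distrib_left algebra_simps)

lemma ev_diff [simp]: "ev a (\<lambda>i. x i - y i) = ev a x - ev a y"
  by (simp add: ev_def sum_subtractf algebra_simps)

lemma ev_scale: "ev a (\<lambda>i. s * x i) = s * ev a x"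
  by (simp add: ev_def sum_distrib_left algebra_simps)

lemma ev_0 [simp]: "ev a (\<lambda>_. 0) = 0"
  by (simp add: ev_def)

lemma ev_unit: "k < 3 \<Longrightarrow> ev a (\<lambda>i. if i = k then 1 else 0) = a $ k"
  by (simp add: ev_def if_distrib cong: if_cong)

lemma ev_eqI: "(\<And>i. i < 3 \<Longrightarrow> x i = y i) \<Longrightarrow> ev a x = ev a y"
  by (simp add: ev_def)

text \<open>Polynomial functions enter only through their restrictions to lines, which are
  polynomials in one parameter; this is enough to find points where finitely many of them are
  nonzero.\<close>

definition line_poly :: "((nat \<Rightarrow> complex) \<Rightarrow> complex) \<Rightarrow> bool" where
  "line_poly f \<longleftrightarrow> (\<forall>x y. \<exists>q. \<forall>s. f (\<lambda>i. x i + s * (y i - x i)) = poly q s)"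

lemma line_poly_const: "line_poly (\<lambda>_. c)"
  unfolding line_poly_def by (intro allI exI[of _ "[:c:]"]) simp

lemma line_poly_ev: "line_poly (ev a)"
  unfolding line_poly_def
proof (intro allI)
  fix x y
  show "\<exists>q. \<forall>s. ev a (\<lambda>i. x i + s * (y i - x i)) = poly q s"
    by (intro exI[of _ "[:ev a x, ev a y - ev a x:]"]) simp
qed

lemma line_poly_add: "line_poly f \<Longrightarrow> line_poly g \<Longrightarrow> line_poly (\<lambda>x. f x + g x)"
  unfolding line_poly_def by (metis poly_add)

lemma line_poly_mult: "line_poly f \<Longrightarrow> line_poly g \<Longrightarrow> line_poly (\<lambda>x. f x * g x)"
  unfolding line_poly_def by (metis poly_mult)

lemma line_poly_sum: "(\<And>i. i \<in> I \<Longrightarrow> line_poly (f i)) \<Longrightarrow> line_poly (\<lambda>x. \<Sum>i\<in>I. f i x)"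
  by (induction I rule: infinite_finite_induct) (auto intro: line_poly_const line_poly_add)

lemma line_poly_prod: "(\<And>i. i \<in> I \<Longrightarrow> line_poly (f i)) \<Longrightarrow> line_poly (\<lambda>x. \<Prod>i\<in>I. f i x)"
  by (induction I rule: infinite_finite_induct) (auto intro: line_poly_const line_poly_mult)

text \<open>On the line joining a point that suits the earlier functions to one that suits the new
  function, both the product of the former and the latter are nonzero polynomials, with finitely
  many roots.\<close>

lemma common_nonzero:
  assumes "finite I" and f: "\<And>i. i \<in> I \<Longrightarrow> line_poly (f i)"
    and nz: "\<And>i. i \<in> I \<Longrightarrow> \<exists>x\<in>L. f i x \<noteq> 0" and L: "L \<noteq> {}"
    and closed: "\<And>x y s. x \<in> L \<Longrightarrow> y \<in> L \<Longrightarrow> (\<lambda>i. x i + s * (y i - x i)) \<in> L"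
  shows "\<exists>x\<in>L. \<forall>i\<in>I. f i x \<noteq> 0"
  using assms(1) f nz
proof (induction I)
  case (insert i I)
  then obtain x where x: "x \<in> L" "\<forall>j\<in>I. f j x \<noteq> 0" by auto
  obtain y where y: "y \<in> L" "f i y \<noteq> 0" using insert.prems(2) by auto
  have "line_poly (\<lambda>x. \<Prod>j\<in>I. f j x)" using insert.prems(1) by (intro line_poly_prod) auto
  then obtain p where p: "\<And>s. (\<Prod>j\<in>I. f j (\<lambda>i. x i + s * (y i - x i))) = poly p s"
    unfolding line_poly_def by blast
  obtain q where q: "\<And>s. f i (\<lambda>i. x i + s * (y i - x i)) = poly q s"
    using insert.prems(1)[of i] unfolding line_poly_def by blast
  have "poly p 0 \<noteq> 0" "poly q 1 \<noteq> 0" using p[of 0] q[of 1] x(2) y(2) insert.hyps by (auto simp flip: p q)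
  then have "p * q \<noteq> 0" by auto
  then have "finite {s. poly (p * q) s = 0}" by (rule poly_roots_finite)
  then obtain s where "s \<notin> {s. poly (p * q) s = 0}"
    using ex_new_if_finite[OF infinite_UNIV_char_0] by blast
  then have "poly p s \<noteq> 0" "poly q s \<noteq> 0" by auto
  then have "\<forall>j\<in>insert i I. f j (\<lambda>i. x i + s * (y i - x i)) \<noteq> 0"
    using insert.hyps by (simp flip: p q)
  then show ?case using closed[OF x(1) y(1)] by blast
qed (use L in auto)

lemma eventually_ev_nonzero:
  assumes "ev a y \<noteq> 0"
  shows "\<forall>\<^sub>F s in at 0. ev a (\<lambda>i. x i + s * y i) \<noteq> 0"
proof -
  have "\<forall>\<^sub>F s in at 0. s \<noteq> - ev a x / ev a y" by (rule eventually_neq_at_within)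
  then show ?thesis
    by eventually_elim (use assms in \<open>auto simp: field_simps eq_neg_iff_add_eq_0 add.commute\<close>)
qed

lemma tendsto_ev: "((\<lambda>s. ev a (\<lambda>i. x i + s * y i)) \<longlongrightarrow> ev a x) (at 0)"
proof -
  have "((\<lambda>s. ev a x + s * ev a y) \<longlongrightarrow> ev a x + 0 * ev a y) (at 0)"
    by (intro tendsto_intros)
  then show ?thesis by simp
qed

text \<open>Partial fractions: the residue along one line isolates its coefficient.\<close>

lemma recip_independent:
  fixes \<beta> :: "'i \<Rightarrow> complex vec"
  assumes fin: "finite K" "J \<subseteq> K"
    and L: "L \<noteq> {}" "\<And>x y s. x \<in> L \<Longrightarrow> y \<in> L \<Longrightarrow> (\<lambda>i. x i + s * y i) \<in> L"
    and K: "\<And>j. j \<in> K \<Longrightarrow> \<exists>x\<in>L. ev (\<beta> j) x \<noteq> 0"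
    and J: "\<And>i j. i \<in> J \<Longrightarrow> j \<in> J \<Longrightarrow> i \<noteq> j \<Longrightarrow> \<exists>x\<in>L. ev (\<beta> j) x = 0 \<and> ev (\<beta> i) x \<noteq> 0"
    and zero: "\<And>x. x \<in> L \<Longrightarrow> (\<And>j. j \<in> K \<Longrightarrow> ev (\<beta> j) x \<noteq> 0) \<Longrightarrow> (\<Sum>j\<in>J. c j / ev (\<beta> j) x) = 0"
    and j: "j \<in> J"
  shows "c j = 0"
proof -
  have line: "(\<lambda>i. x i + s * (y i - x i)) \<in> L" if "x \<in> L" "y \<in> L" for x y s
    using L(2)[OF that(1) L(2)[OF that(2,1), of "-1"], of s] by simp
  obtain z where "z \<in> L" using L(1) by blast
  then have "(\<lambda>_. 0) \<in> L" using L(2)[of z z "- 1"] by simp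
  then have L': "{x \<in> L. ev (\<beta> j) x = 0} \<noteq> {}" by force
  have "\<exists>x\<in>{x \<in> L. ev (\<beta> j) x = 0}. \<forall>i\<in>J - {j}. ev (\<beta> i) x \<noteq> 0"
  proof (rule common_nonzero[OF _ line_poly_ev _ L'])
    show "finite (J - {j})" using fin finite_subset by auto
    show "\<exists>x\<in>{x \<in> L. ev (\<beta> j) x = 0}. ev (\<beta> i) x \<noteq> 0" if "i \<in> J - {j}" for i
      using J[of i j] that j by auto
  qed (use line in auto)
  then obtain x where x: "x \<in> L" "ev (\<beta> j) x = 0" "\<And>i. i \<in> J - {j} \<Longrightarrow> ev (\<beta> i) x \<noteq> 0" by blast
  have "\<exists>a\<in>L. \<forall>i\<in>K. ev (\<beta> i) a \<noteq> 0"
    by (rule common_nonzero[OF fin(1) line_poly_ev K L(1) line])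
  then obtain a where a: "a \<in> L" "\<And>i. i \<in> K \<Longrightarrow> ev (\<beta> i) a \<noteq> 0" by blast
  \<comment> \<open>Approaches a general zero \<open>x\<close> of the form \<open>j\<close> in the
    direction of a point \<open>a\<close> where no form vanishes; after multiplication by
    \<open>s\<close> only the pole along \<open>j\<close> survives the limit.\<close>
  define y where "y s = (\<lambda>i. x i + s * a i)" for s :: complex
  have "\<forall>\<^sub>F s in at 0. \<forall>i\<in>K. ev (\<beta> i) (y s) \<noteq> 0"
    unfolding y_def by (intro eventually_ball_finite fin ballI eventually_ev_nonzero a)
  moreover have "\<forall>\<^sub>F s in at (0::complex). s \<noteq> 0" by (rule eventually_neq_at_within)
  ultimately have ev0: "\<forall>\<^sub>F s in at 0. c j / ev (\<beta> j) a + s * (\<Sum>i\<in>J - {j}. c i / ev (\<beta> i) (y s)) = 0"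
  proof eventually_elim
    case (elim s)
    have "y s \<in> L" unfolding y_def by (rule L(2)[OF x(1) a(1)])
    then have "0 = (\<Sum>i\<in>J. c i / ev (\<beta> i) (y s))" using zero elim by simp
    also have "\<dots> = c j / ev (\<beta> j) (y s) + (\<Sum>i\<in>J - {j}. c i / ev (\<beta> i) (y s))"
      by (rule sum.remove) (use fin finite_subset j in auto)
    also have "ev (\<beta> j) (y s) = s * ev (\<beta> j) a" by (simp add: y_def x(2))
    finally have "0 = s * (c j / (s * ev (\<beta> j) a) + (\<Sum>i\<in>J - {j}. c i / ev (\<beta> i) (y s)))" by simp
    also have "\<dots> = c j / ev (\<beta> j) a + s * (\<Sum>i\<in>J - {j}. c i / ev (\<beta> i) (y s))"
      using elim(2) by (simp add: distrib_left)
    finally show ?case by simp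
  qed
  have "((\<lambda>s. c j / ev (\<beta> j) a + s * (\<Sum>i\<in>J - {j}. c i / ev (\<beta> i) (y s))) \<longlongrightarrow>
      c j / ev (\<beta> j) a + 0 * (\<Sum>i\<in>J - {j}. c i / ev (\<beta> i) x)) (at 0)"
    unfolding y_def by (intro tendsto_intros tendsto_ev x(3))
  then have "((\<lambda>s::complex. 0) \<longlongrightarrow> c j / ev (\<beta> j) a) (at 0)"
    using tendsto_cong[OF ev0] by simp
  then have "c j / ev (\<beta> j) a = 0"
    by (metis tendsto_const_iff at_neq_bot)
  then show ?thesis using a(2) j fin by auto
qed

lemma recip_three_term:
  fixes J K D c e r :: complex
  assumes nz: "J \<noteq> 0" "K \<noteq> 0" "D \<noteq> 0" "c \<noteq> 0" and J: "J = c * K + e * D"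
  shows "r / J / D = r / c / K / D - r * e / c / (J * K)"
proof -
  have "r / c / K / D - r * e / c / (J * K) = r * (J - e * D) / (c * J * K * D)"
    using nz by (simp add: divide_simps) (simp add: algebra_simps)
  also have "J - e * D = c * K" using J by simp
  finally show ?thesis using nz by simp
qed

locale line_arrangement =
  fixes \<alpha> :: "'n::finite \<Rightarrow> complex vec"
  assumes carrier: "\<And>i. \<alpha> i \<in> carrier_vec 3"
    and nonzero: "\<And>i. \<alpha> i \<noteq> 0\<^sub>v 3"
    and nonprop: "\<And>i j c. i \<noteq> j \<Longrightarrow> \<alpha> i \<noteq> c \<cdot>\<^sub>v \<alpha> j"
begin

abbreviation form :: "'n \<Rightarrow> (nat \<Rightarrow> complex) \<Rightarrow> complex" (\<open>\<ell>\<close>) where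
  "\<ell> i \<equiv> ev (\<alpha> i)"

definition complement :: "(nat \<Rightarrow> complex) set" where
  "complement = {x. \<forall>i. \<ell> i x \<noteq> 0}"

lemma complementD: "x \<in> complement \<Longrightarrow> \<ell> i x \<noteq> 0"
  by (simp add: complement_def)

lemma form_eq_1: obtains a where "\<ell> i a = 1"
proof -
  obtain k where k: "k < 3" "\<alpha> i $ k \<noteq> 0"
    using carrier[of i] nonzero[of i] by (metis carrier_vecD eq_vecI index_zero_vec zero_carrier_vec)
  have "\<ell> i (\<lambda>j. (1 / \<alpha> i $ k) * (if j = k then 1 else 0)) = 1"
    unfolding ev_scale ev_unit[OF k(1)] using k(2) by simp
  then show ?thesis by (rule that)
qed

text \<open>A form that vanishes on the kernel of another is a multiple of it, the factor being its
  value at a point where the other is 1.\<close>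

lemma form_nonprop:
  assumes "i \<noteq> j"
  shows "\<exists>x. \<ell> i x = 0 \<and> \<ell> j x \<noteq> 0"
proof (rule ccontr)
  assume neg: "\<not> ?thesis"
  obtain a where a: "\<ell> i a = 1" by (rule form_eq_1)
  have *: "\<ell> j x = \<ell> j a * \<ell> i x" for x
  proof -
    have "\<ell> i (\<lambda>k. x k + (- \<ell> i x) * a k) = 0" unfolding ev_add_scale a by simp
    then have "\<ell> j (\<lambda>k. x k + (- \<ell> i x) * a k) = 0" using neg by blast
    then show ?thesis unfolding ev_add_scale by simp
  qed
  have "\<alpha> j = \<ell> j a \<cdot>\<^sub>v \<alpha> i"
  proof (rule eq_vecI)
    fix k assume "k < dim_vec (\<ell> j a \<cdot>\<^sub>v \<alpha> i)"
    then have k: "k < 3" using carrier[of i] by simp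
    show "\<alpha> j $ k = (\<ell> j a \<cdot>\<^sub>v \<alpha> i) $ k"
      using *[of "\<lambda>i. if i = k then 1 else 0"] k carrier[of i] by (simp add: ev_unit)
  qed (use carrier[of i] carrier[of j] in simp)
  then show False using nonprop[of j i] assms by blast
qed

lemma generic_point_on_line:
  obtains x where "\<ell> d x = 0" "\<And>j. j \<noteq> d \<Longrightarrow> \<ell> j x \<noteq> 0"
proof -
  have "\<exists>x\<in>{x. \<ell> d x = 0}. \<forall>j\<in>UNIV - {d}. \<ell> j x \<noteq> 0"
  proof (rule common_nonzero[OF _ line_poly_ev])
    show "\<exists>x\<in>{x. \<ell> d x = 0}. \<ell> i x \<noteq> 0" if "i \<in> UNIV - {d}" for i
      using form_nonprop[of d i] that by auto
    show "{x. \<ell> d x = 0} \<noteq> {}" using ev_0 by blast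
  qed auto
  then show ?thesis using that by auto
qed

lemma complement_nonzero:
  assumes "finite I" "\<And>i. i \<in> I \<Longrightarrow> line_poly (f i)" "\<And>i. i \<in> I \<Longrightarrow> \<exists>x. f i x \<noteq> 0"
  shows "\<exists>x\<in>complement. \<forall>i\<in>I. f i x \<noteq> 0"
proof -
  define g where "g i = (case i of Inl k \<Rightarrow> \<ell> k | Inr k \<Rightarrow> f k)" for i
  have "\<exists>x\<in>UNIV. \<forall>i\<in>(UNIV :: 'n set) <+> I. g i x \<noteq> 0"
  proof (rule common_nonzero)
    show "finite ((UNIV :: 'n set) <+> I)" using assms(1) by simp
    show "line_poly (g i)" if "i \<in> UNIV <+> I" for i
      using that assms(2) line_poly_ev by (auto simp: g_def)
    show "\<exists>x\<in>UNIV. g i x \<noteq> 0" if "i \<in> UNIV <+> I" for i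
    proof (cases i)
      case (Inl k)
      then show ?thesis by (metis form_eq_1 g_def old.sum.simps(5) UNIV_I zero_neq_one)
    next
      case (Inr k)
      then show ?thesis using that assms(3)[of k] by (auto simp: g_def)
    qed
  qed auto
  then obtain x where x: "\<And>i. i \<in> (UNIV :: 'n set) <+> I \<Longrightarrow> g i x \<noteq> 0" by blast
  have "\<ell> k x \<noteq> 0" for k using x[of "Inl k"] by (auto simp: g_def)
  moreover have "f k x \<noteq> 0" if "k \<in> I" for k using x[of "Inr k"] that by (auto simp: g_def)
  ultimately show ?thesis by (auto simp: complement_def)
qed

lemma recip_forms_independent:
  assumes "\<And>x. x \<in> complement \<Longrightarrow> (\<Sum>i\<in>UNIV. c i / \<ell> i x) = 0"
  shows "c j = 0"
proof (rule recip_independent[of UNIV UNIV UNIV \<alpha>])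
  show "\<exists>x\<in>UNIV. \<ell> j x \<noteq> 0" for j
    by (rule form_eq_1[of j]) (metis UNIV_I zero_neq_one)
  show "\<exists>x\<in>UNIV. \<ell> j x = 0 \<and> \<ell> i x \<noteq> 0" if "i \<noteq> j" for i j
    using form_nonprop[of j i] that by auto
  show "(\<Sum>i\<in>UNIV. c i / \<ell> i x) = 0" if "\<And>j. j \<in> UNIV \<Longrightarrow> \<ell> j x \<noteq> 0" for x
    using assms that by (simp add: complement_def)
qed auto

section \<open>Quadrics in the Orlik-Terao ideal\<close>

lemma OT_three_term:
  assumes dist: "d \<noteq> j" "d \<noteq> k" "j \<noteq> k" and dep: "\<And>x. \<ell> j x = b * \<ell> k x + e * \<ell> d x"
  shows "Var d * Var k - Const b * (Var d * Var j) - Const e * (Var j * Var k) \<in> OT_ideal \<alpha>"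
proof -
  define c where "c i = (if i = j then 1 else if i = k then - b else - e)" for i
  have "dependency \<alpha> {d, j, k} c"
    unfolding dependency_def
  proof (intro allI impI)
    fix x :: nat assume "x < 3"
    then show "(\<Sum>i\<in>{d, j, k}. c i * \<alpha> i $ x) = 0"
      using dist dep[of "\<lambda>i. if i = x then 1 else 0"] by (simp add: ev_unit c_def)
  qed
  then have "OT_relation {d, j, k} c \<in> OT_ideal \<alpha>"
    unfolding OT_ideal_def by (intro ideal.span_base) blast
  moreover have "OT_relation {d, j, k} c = Var d * Var k - Const b * (Var d * Var j) - Const e * (Var j * Var k)"
  proof -
    have "{d, j, k} - {d} = {j, k}" "{d, j, k} - {j} = {d, k}" "{d, j, k} - {k} = {d, j}" using dist by auto
    then show ?thesis using dist by (simp add: OT_relation_def c_def Const_uminus algebra_simps)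
  qed
  ultimately show ?thesis by simp
qed

lemma OT_scale: "p \<in> OT_ideal \<alpha> \<Longrightarrow> r * p \<in> OT_ideal \<alpha>"
  unfolding OT_ideal_def by (rule ideal.span_scale)
lemma OT_add: "p \<in> OT_ideal \<alpha> \<Longrightarrow> q \<in> OT_ideal \<alpha> \<Longrightarrow> p + q \<in> OT_ideal \<alpha>"
  unfolding OT_ideal_def by (rule ideal.span_add)
lemma OT_0: "0 \<in> OT_ideal \<alpha>"
  unfolding OT_ideal_def by (rule ideal.span_zero)

definition quad :: "'n set \<Rightarrow> ('n \<Rightarrow> 'n \<Rightarrow> complex) \<Rightarrow> 'n ring_R" where
  "quad S q = (\<Sum>i\<in>S. \<Sum>j\<in>S. Const (q i j) * (Var i * Var j))"

text \<open>The value of \<open>quad S q\<close> at \<open>y_i = 1 / \<ell> i x\<close>.\<close>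

definition quad_val :: "'n set \<Rightarrow> ('n \<Rightarrow> 'n \<Rightarrow> complex) \<Rightarrow> (nat \<Rightarrow> complex) \<Rightarrow> complex" where
  "quad_val S q x = (\<Sum>i\<in>S. \<Sum>j\<in>S. q i j / (\<ell> i x * \<ell> j x))"

lemma quad_add: "quad S (\<lambda>i j. q i j + r i j) = quad S q + quad S r"
  by (simp add: quad_def Const_add distrib_right sum.distrib)

lemma quad_val_add: "quad_val S (\<lambda>i j. q i j + r i j) x = quad_val S q x + quad_val S r x"
  by (simp add: quad_val_def add_divide_distrib sum.distrib)

lemma sum_sum_single:
  "finite S \<Longrightarrow> j \<in> S \<Longrightarrow> k \<in> S \<Longrightarrow>
    (\<Sum>i\<in>S. \<Sum>l\<in>S. if i = j \<and> l = k then f i l else 0) = (f j k :: 'a::comm_monoid_add)"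
proof -
  assume "finite S" "j \<in> S" "k \<in> S"
  then have "(\<Sum>i\<in>S. \<Sum>l\<in>S. if i = j \<and> l = k then f i l else 0) = (\<Sum>i\<in>S. if i = j then f i k else 0)"
    by (intro sum.cong refl) auto
  then show ?thesis using \<open>finite S\<close> \<open>j \<in> S\<close> by simp
qed

lemma quad_single:
  assumes "j \<in> S" "k \<in> S"
  shows "quad S (\<lambda>i l. if i = j \<and> l = k then a else 0) = Const a * (Var j * Var k)"
    and "quad_val S (\<lambda>i l. if i = j \<and> l = k then a else 0) x = a / (\<ell> j x * \<ell> k x)"
proof -
  have "quad S (\<lambda>i l. if i = j \<and> l = k then a else 0)
      = (\<Sum>i\<in>S. \<Sum>l\<in>S. if i = j \<and> l = k then Const a * (Var i * Var l) else 0)"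
    unfolding quad_def by (intro sum.cong refl) auto
  then show "quad S (\<lambda>i l. if i = j \<and> l = k then a else 0) = Const a * (Var j * Var k)"
    using sum_sum_single[of S j k] assms by simp
  have "quad_val S (\<lambda>i l. if i = j \<and> l = k then a else 0) x
      = (\<Sum>i\<in>S. \<Sum>l\<in>S. if i = j \<and> l = k then a / (\<ell> i x * \<ell> l x) else 0)"
    unfolding quad_val_def by (intro sum.cong refl) auto
  then show "quad_val S (\<lambda>i l. if i = j \<and> l = k then a else 0) x = a / (\<ell> j x * \<ell> k x)"
    using sum_sum_single[of S j k] assms by simp
qed

text \<open>Two forms that are proportional on the line \<open>d\<close> form a three-term dependency with the form \<open>d\<close>,
  which removes one of the two variables from the coefficient of the variable \<open>d\<close>.\<close>

lemma eliminate_variable: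
  assumes d: "d \<notin> S" and T: "T \<subseteq> S"
    and res: "\<And>x. \<ell> d x = 0 \<Longrightarrow> (\<And>j. j \<noteq> d \<Longrightarrow> \<ell> j x \<noteq> 0) \<Longrightarrow> (\<Sum>j\<in>T. r j / \<ell> j x) = 0"
  shows "\<exists>q. Var d * (\<Sum>j\<in>T. Const (r j) * Var j) - quad S q \<in> OT_ideal \<alpha> \<and>
      (\<forall>x\<in>complement. (\<Sum>j\<in>T. r j / \<ell> j x) / \<ell> d x = quad_val S q x)"
  using T res
proof (induction "card T" arbitrary: T r rule: less_induct)
  case (less T)
  note T = less.prems(1) and res = less.prems(2)
  have fT: "finite T" by simp
  show ?case
  proof (cases "\<forall>j\<in>T. \<forall>k\<in>T. j \<noteq> k \<longrightarrow> (\<exists>x. \<ell> d x = 0 \<and> \<ell> k x = 0 \<and> \<ell> j x \<noteq> 0)")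
    \<comment> \<open>If no two of the forms become proportional on the line \<open>d\<close>,
      partial fractions on that line force all coefficients to vanish.\<close>
    case True
    have "r j = 0" if j: "j \<in> T" for j
    proof (rule recip_independent[of "UNIV - {d}" T "{x. \<ell> d x = 0}" \<alpha>])
      show "{x. \<ell> d x = 0} \<noteq> {}" using ev_0 by blast
      show "\<exists>x\<in>{x. \<ell> d x = 0}. \<ell> k x \<noteq> 0" if "k \<in> UNIV - {d}" for k
        using form_nonprop[of d k] that by auto
      show "(\<Sum>k\<in>T. r k / \<ell> k x) = 0" if "x \<in> {x. \<ell> d x = 0}" "\<And>k. k \<in> UNIV - {d} \<Longrightarrow> \<ell> k x \<noteq> 0" for x
        using res[of x] that by auto
    qed (use True j T d in auto)
    then show ?thesis
      by (intro exI[of _ "\<lambda>_ _. 0"]) (simp add: quad_def quad_val_def OT_0)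
  next
    case False
    then obtain j k where jk: "j \<in> T" "k \<in> T" "j \<noteq> k" "\<And>x. \<ell> d x = 0 \<Longrightarrow> \<ell> k x = 0 \<Longrightarrow> \<ell> j x = 0"
      by blast
    have dist: "d \<noteq> j" "d \<noteq> k" using jk T d by auto
    obtain a0 where a0: "\<ell> d a0 = 0" "\<ell> k a0 \<noteq> 0" using form_nonprop[OF dist(2)] by blast
    obtain b0 where b0: "\<ell> d b0 = 1" by (rule form_eq_1)
    \<comment> \<open>\<open>c\<close> is the ratio of the forms \<open>j\<close> and
      \<open>k\<close> on the line \<open>d\<close>; \<open>e\<close> is the correction off the
      line.\<close>
    define c where "c = \<ell> j a0 / \<ell> k a0"
    define e where "e = \<ell> j b0 - c * \<ell> k b0"
    have on_line: "\<ell> j x = c * \<ell> k x" if "\<ell> d x = 0" for x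
    proof -
      have "\<ell> j (\<lambda>i. x i + (- \<ell> k x / \<ell> k a0) * a0 i) = 0"
        by (rule jk(4)) (use that a0 in \<open>simp_all only: ev_add_scale, simp_all\<close>)
      then show ?thesis unfolding ev_add_scale c_def using a0 by (simp add: field_simps)
    qed
    have dep: "\<ell> j x = c * \<ell> k x + e * \<ell> d x" for x
    proof -
      have "\<ell> j (\<lambda>i. x i + (- \<ell> d x) * b0 i) = c * \<ell> k (\<lambda>i. x i + (- \<ell> d x) * b0 i)"
        by (rule on_line) (simp only: ev_add_scale b0, simp)
      then show ?thesis unfolding ev_add_scale e_def by (simp add: algebra_simps)
    qed
    have c: "c \<noteq> 0" using form_nonprop[OF dist(1)] on_line by auto
    \<comment> \<open>On the line \<open>d\<close> the fraction \<open>r j / \<ell> j\<close> equals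
      \<open>(r j / c) / \<ell> k\<close>, so the coefficient moves from \<open>j\<close> to
      \<open>k\<close> and the sum there does not change.\<close>
    define r' where "r' = r(k := r k + r j / c)"
    have split: "(\<Sum>i\<in>T. f i) = f j + f k + (\<Sum>i\<in>T - {j} - {k}. f i)" for f :: "'n \<Rightarrow> 'z::ab_group_add"
      using jk fT by (simp add: sum.remove[of T j] sum.remove[of "T - {j}" k] add.assoc)
    have split': "(\<Sum>i\<in>T - {j}. f i) = f k + (\<Sum>i\<in>T - {j} - {k}. f i)" for f :: "'n \<Rightarrow> 'z::ab_group_add"
      using jk fT by (simp add: sum.remove[of "T - {j}" k])
    have rest: "(\<Sum>i\<in>T - {j} - {k}. r' i / \<ell> i x) = (\<Sum>i\<in>T - {j} - {k}. r i / \<ell> i x)" for x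
      by (intro sum.cong) (auto simp: r'_def)
    have "\<exists>q. Var d * (\<Sum>i\<in>T - {j}. Const (r' i) * Var i) - quad S q \<in> OT_ideal \<alpha> \<and>
      (\<forall>x\<in>complement. (\<Sum>i\<in>T - {j}. r' i / \<ell> i x) / \<ell> d x = quad_val S q x)"
    proof (rule less.hyps)
      show "card (T - {j}) < card T" using jk fT by (intro card_Diff1_less)
      show "T - {j} \<subseteq> S" using T by auto
      fix x assume x: "\<ell> d x = 0" "\<And>j. j \<noteq> d \<Longrightarrow> \<ell> j x \<noteq> 0"
      have "(\<Sum>i\<in>T - {j}. r' i / \<ell> i x) = (\<Sum>i\<in>T. r i / \<ell> i x)"
        unfolding split split' rest using c x(2) dist on_line[OF x(1)] by (simp add: r'_def add_divide_distrib)
      then show "(\<Sum>i\<in>T - {j}. r' i / \<ell> i x) = 0" using res[OF x] by simp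
    qed
    then obtain q where q: "Var d * (\<Sum>i\<in>T - {j}. Const (r' i) * Var i) - quad S q \<in> OT_ideal \<alpha>"
        "\<And>x. x \<in> complement \<Longrightarrow> (\<Sum>i\<in>T - {j}. r' i / \<ell> i x) / \<ell> d x = quad_val S q x" by blast
    \<comment> \<open>The coefficient of the product of the variables \<open>j\<close> and
      \<open>k\<close> that the three-term relation leaves behind.\<close>
    let ?s = "\<lambda>i l. if i = j \<and> l = k then - (r j * e / c) else 0"
    have jS: "j \<in> S" "k \<in> S" using jk T by auto
    show ?thesis
    proof (intro exI[of _ "\<lambda>i l. q i l + ?s i l"] conjI ballI)
      let ?rel = "Var d * Var k - Const c * (Var d * Var j) - Const e * (Var j * Var k)"
      have rest': "(\<Sum>i\<in>T - {j} - {k}. Const (r' i) * Var i) = (\<Sum>i\<in>T - {j} - {k}. Const (r i) * Var i)"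
        by (intro sum.cong) (auto simp: r'_def)
      have const: "(Const (r j) :: 'n ring_R) = Const (r j / c) * Const c"
          "(Const (- (r j * e / c)) :: 'n ring_R) = - (Const (r j / c) * Const e)"
          "(Const (r' k) :: 'n ring_R) = Const (r k) + Const (r j / c)"
        using c by (simp_all add: r'_def Const_add flip: Const_mult Const_uminus)
      have eq: "Var d * (\<Sum>i\<in>T. Const (r i) * Var i) - quad S (\<lambda>i l. q i l + ?s i l)
          = (Var d * (\<Sum>i\<in>T - {j}. Const (r' i) * Var i) - quad S q) + (- Const (r j / c)) * ?rel"
        unfolding split split' rest' quad_add quad_single(1)[OF jS] const by (simp add: algebra_simps)
      then show "Var d * (\<Sum>i\<in>T. Const (r i) * Var i) - quad S (\<lambda>i l. q i l + ?s i l) \<in> OT_ideal \<alpha>"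
        unfolding eq by (intro OT_add q(1) OT_scale OT_three_term dist jk(3) dep)
    next
      fix x assume x: "x \<in> complement"
      have nz: "\<ell> j x \<noteq> 0" "\<ell> k x \<noteq> 0" "\<ell> d x \<noteq> 0" using x complementD by auto
      have "r j / \<ell> j x / \<ell> d x = r j / c / \<ell> k x / \<ell> d x - r j * e / c / (\<ell> j x * \<ell> k x)"
        by (rule recip_three_term[OF nz c dep])
      then show "(\<Sum>i\<in>T. r i / \<ell> i x) / \<ell> d x = quad_val S (\<lambda>i l. q i l + ?s i l) x"
        unfolding quad_val_add quad_single(2)[OF jS] q(2)[OF x, symmetric] split split' rest
        by (simp add: r'_def add_divide_distrib)
    qed
  qed
qed

text \<open>Along \<open>\<ell> d\<close> the value has a pole of order at most 2, whose
  coefficients are \<open>q d d\<close> and the sum of the \<open>r j / \<ell> j\<close> on the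
  line. Both vanish, so the terms containing the variable \<open>d\<close> can be traded, modulo the
  ideal, for a quadric in the other variables.\<close>

lemma quad_in_OT_ideal:
  assumes "finite S" "\<And>x. x \<in> complement \<Longrightarrow> quad_val S q x = 0"
  shows "quad S q \<in> OT_ideal \<alpha>"
  using assms
proof (induction S arbitrary: q)
  case empty
  then show ?case by (simp add: quad_def OT_0)
next
  case (insert d S)
  define r where "r j = q d j + q j d" for j
  have val: "quad_val (insert d S) q x
      = q d d / (\<ell> d x)\<^sup>2 + (\<Sum>j\<in>S. r j / \<ell> j x) / \<ell> d x + quad_val S q x" for x
    using insert.hyps
    by (simp add: quad_val_def r_def sum.distrib power2_eq_square sum_divide_distrib add_divide_distrib mult.commute)
  have lim: "q d d = 0 \<and> (\<Sum>j\<in>S. r j / \<ell> j x) = 0" if x: "\<ell> d x = 0" "\<And>j. j \<noteq> d \<Longrightarrow> \<ell> j x \<noteq> 0" for x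
  proof -
    obtain a0 where "a0 \<in> complement" using complement_nonzero[of "{}" "\<lambda>_ _. 0"] by auto
    then have a0: "\<ell> i a0 \<noteq> 0" for i by (rule complementD)
    \<comment> \<open>Normalised so that \<open>\<ell> d\<close> takes the value \<open>s\<close> at
      \<open>x + s * a\<close>.\<close>
    define a where "a = (\<lambda>i. (1 / \<ell> d a0) * a0 i)"
    have a: "\<ell> d a = 1" "\<And>i. \<ell> i a \<noteq> 0" unfolding a_def ev_scale using a0 by auto
    define y where "y s = (\<lambda>i. x i + s * a i)" for s :: complex
    have yd: "\<ell> d (y s) = s" for s by (simp add: y_def x(1) a(1))
    have "\<forall>\<^sub>F s in at 0. \<forall>i\<in>UNIV. \<ell> i (y s) \<noteq> 0"
      unfolding y_def by (intro eventually_ball_finite ballI eventually_ev_nonzero a) simp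
    then have ev_c: "\<forall>\<^sub>F s in at 0. y s \<in> complement" by (simp add: complement_def)
    have jd: "j \<noteq> d" if "j \<in> S" for j using that insert.hyps by auto
    let ?A = "\<lambda>y. \<Sum>j\<in>S. r j / \<ell> j y" and ?B = "\<lambda>y. quad_val S q y"
    have A: "((\<lambda>s. ?A (y s)) \<longlongrightarrow> ?A x) (at 0)"
      unfolding y_def by (intro tendsto_intros tendsto_ev x(2) jd)
    have B: "((\<lambda>s. ?B (y s)) \<longlongrightarrow> ?B x) (at 0)"
      unfolding y_def quad_val_def
      by (intro tendsto_intros tendsto_ev) (use x(2) jd in auto)
    \<comment> \<open>Clearing the double pole gives \<open>q d d\<close> in the limit; once this is
      zero, division by \<open>s\<close> gives the next coefficient.\<close>
    have e1: "\<forall>\<^sub>F s in at 0. q d d + s * ?A (y s) + s * s * ?B (y s) = 0"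
      using ev_c eventually_neq_at_within[of 0 0]
    proof eventually_elim
      case (elim s)
      have "0 = s\<^sup>2 * (q d d / s\<^sup>2 + ?A (y s) / s + ?B (y s))"
        using insert.prems[OF elim(1)] unfolding val yd by simp
      also have "\<dots> = q d d + s * ?A (y s) + s * s * ?B (y s)"
        using elim(2) by (simp add: distrib_left power2_eq_square)
      finally show ?case by simp
    qed
    have "((\<lambda>s. q d d + s * ?A (y s) + s * s * ?B (y s)) \<longlongrightarrow> q d d + 0 * ?A x + 0 * 0 * ?B x) (at 0)"
      by (intro tendsto_intros A B)
    then have "((\<lambda>s::complex. 0) \<longlongrightarrow> q d d) (at 0)" using tendsto_cong[OF e1] by simp
    then have q0: "q d d = 0" by (metis tendsto_const_iff at_neq_bot)
    have e2: "\<forall>\<^sub>F s in at 0. ?A (y s) + s * ?B (y s) = 0"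
      using e1 eventually_neq_at_within[of 0 0]
    proof eventually_elim
      case (elim s)
      have "s * (?A (y s) + s * ?B (y s)) = 0" using elim(1) q0 by (simp add: algebra_simps)
      then show ?case using elim(2) by simp
    qed
    have "((\<lambda>s. ?A (y s) + s * ?B (y s)) \<longlongrightarrow> ?A x + 0 * ?B x) (at 0)"
      by (intro tendsto_intros A B)
    then have "((\<lambda>s::complex. 0) \<longlongrightarrow> ?A x) (at 0)" using tendsto_cong[OF e2] by simp
    then have "?A x = 0" by (metis tendsto_const_iff at_neq_bot)
    with q0 show ?thesis by simp
  qed
  have q0: "q d d = 0" by (metis generic_point_on_line lim)
  obtain q' where q': "Var d * (\<Sum>j\<in>S. Const (r j) * Var j) - quad S q' \<in> OT_ideal \<alpha>"
      "\<And>x. x \<in> complement \<Longrightarrow> (\<Sum>j\<in>S. r j / \<ell> j x) / \<ell> d x = quad_val S q' x"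
    using eliminate_variable[OF insert.hyps(2) order_refl, of r] lim by blast
  have "quad S (\<lambda>i j. q i j + q' i j) \<in> OT_ideal \<alpha>"
  proof (rule insert.IH)
    fix x assume x: "x \<in> complement"
    show "quad_val S (\<lambda>i j. q i j + q' i j) x = 0"
      using insert.prems[OF x] unfolding val quad_val_add q'(2)[OF x] q0 by (simp add: add.commute)
  qed
  moreover have "quad (insert d S) q = (Var d * (\<Sum>j\<in>S. Const (r j) * Var j) - quad S q')
      + quad S (\<lambda>i j. q i j + q' i j)"
  proof -
    have "quad (insert d S) q = Const (q d d) * (Var d * Var d) + Var d * (\<Sum>j\<in>S. Const (r j) * Var j) + quad S q"
      using insert.hyps
      by (simp add: quad_def r_def sum.distrib sum_distrib_left Const_add algebra_simps)
    then show ?thesis by (simp add: q0 quad_add)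
  qed
  ultimately show ?case using OT_add[OF q'(1)] by simp
qed

end

section \<open>Ternary forms\<close>

text \<open>Homogeneous polynomials in three variables, as functions. The recursion on the degree
  replaces coefficient families, so that closure properties and division by a linear form are simple
  inductions.\<close>

fun ternary_forms :: "nat \<Rightarrow> ((nat \<Rightarrow> complex) \<Rightarrow> complex) set" where
  "ternary_forms 0 = {\<lambda>_. c | c. True}"
| "ternary_forms (Suc e) = {\<lambda>x. \<Sum>i<3. x i * f i x | f. \<forall>i<3. f i \<in> ternary_forms e}"

lemma ternary_forms_add:
  "f \<in> ternary_forms e \<Longrightarrow> g \<in> ternary_forms e \<Longrightarrow> (\<lambda>x. f x + g x) \<in> ternary_forms e"
proof (induction e arbitrary: f g)
  case 0
  then obtain a b where "f = (\<lambda>_. a)" "g = (\<lambda>_. b)" by auto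
  then show ?case by auto
next
  case (Suc e)
  then obtain f' g' where f: "f = (\<lambda>x. \<Sum>i<3. x i * f' i x)" "\<And>i. i < 3 \<Longrightarrow> f' i \<in> ternary_forms e"
    and g: "g = (\<lambda>x. \<Sum>i<3. x i * g' i x)" "\<And>i. i < 3 \<Longrightarrow> g' i \<in> ternary_forms e"
    by auto
  have "(\<lambda>x. f x + g x) = (\<lambda>x. \<Sum>i<3. x i * (f' i x + g' i x))"
    by (simp add: f(1) g(1) distrib_left sum.distrib)
  moreover have "\<forall>i<3. (\<lambda>x. f' i x + g' i x) \<in> ternary_forms e"
    using Suc.IH f(2) g(2) by blast
  ultimately show ?case
    unfolding ternary_forms.simps by (intro CollectI exI[of _ "\<lambda>i x. f' i x + g' i x"]) blast
qed

lemma ternary_forms_scale: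
  "f \<in> ternary_forms e \<Longrightarrow> (\<lambda>x. c * f x) \<in> ternary_forms e"
proof (induction e arbitrary: f)
  case 0
  then obtain a where "f = (\<lambda>_. a)" by auto
  then show ?case by auto
next
  case (Suc e)
  then obtain f' where f: "f = (\<lambda>x. \<Sum>i<3. x i * f' i x)" "\<And>i. i < 3 \<Longrightarrow> f' i \<in> ternary_forms e"
    by auto
  have "(\<lambda>x. c * f x) = (\<lambda>x. \<Sum>i<3. x i * (c * f' i x))"
    by (simp add: f(1) sum_distrib_left mult.left_commute)
  moreover have "\<forall>i<3. (\<lambda>x. c * f' i x) \<in> ternary_forms e"
    using Suc.IH f(2) by blast
  ultimately show ?case
    unfolding ternary_forms.simps by (intro CollectI exI[of _ "\<lambda>i x. c * f' i x"]) blast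
qed

lemma ternary_forms_diff:
  "f \<in> ternary_forms e \<Longrightarrow> g \<in> ternary_forms e \<Longrightarrow> (\<lambda>x. f x - g x) \<in> ternary_forms e"
  using ternary_forms_add[OF _ ternary_forms_scale[of g e "-1"], of f] by simp

lemma ternary_forms_linear_comb:
  fixes b :: "nat \<Rightarrow> complex"
  assumes "\<And>i. i < 3 \<Longrightarrow> f i \<in> ternary_forms e"
  shows "(\<lambda>x. \<Sum>i<3. b i * f i x) \<in> ternary_forms e"
proof -
  have "(\<lambda>x. b 0 * f 0 x + b 1 * f 1 x + b 2 * f 2 x) \<in> ternary_forms e"
    by (intro ternary_forms_add ternary_forms_scale assms) auto
  then show ?thesis by (simp add: numeral_3_eq_3 numeral_2_eq_2)
qed

lemma ternary_forms_ev_mult: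
  assumes "f \<in> ternary_forms e"
  shows "(\<lambda>x. ev a x * f x) \<in> ternary_forms (Suc e)"
proof -
  have "(\<lambda>x. ev a x * f x) = (\<lambda>x. \<Sum>i<3. x i * (a $ i * f x))"
    unfolding ev_def sum_distrib_right by (intro ext sum.cong refl) (simp add: mult_ac)
  moreover have "\<forall>i<3. (\<lambda>x. a $ i * f x) \<in> ternary_forms e"
    using assms ternary_forms_scale by blast
  ultimately show ?thesis
    unfolding ternary_forms.simps by (intro CollectI exI[of _ "\<lambda>i x. a $ i * f x"]) blast
qed

lemma ternary_forms_prod:
  assumes "finite S"
  shows "(\<lambda>x. \<Prod>j\<in>S. ev (\<beta> j) x) \<in> ternary_forms (card S)"
  using assms
proof induction
  case empty
  have "(\<lambda>_. 1) \<in> {\<lambda>_. c | c. True}" by blast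
  then show ?case by simp
qed (simp add: ternary_forms_ev_mult del: ternary_forms.simps)

text \<open>The substituted map is linear; if \<open>ev a b = 1\<close> it is the projection along
  \<open>b\<close> onto the plane \<open>ev a = 0\<close>.\<close>

lemma ternary_forms_project:
  assumes "f \<in> ternary_forms e"
  shows "(\<lambda>x. f (\<lambda>i. x i - ev a x * b i)) \<in> ternary_forms e"
  using assms
proof (induction e arbitrary: f)
  case (Suc e)
  then obtain f' where f: "f = (\<lambda>x. \<Sum>i<3. x i * f' i x)" "\<And>i. i < 3 \<Longrightarrow> f' i \<in> ternary_forms e"
    by auto
  define g where "g i x = f' i (\<lambda>k. x k - ev a x * b k)" for i x
  have g: "g i \<in> ternary_forms e" if "i < 3" for i
    unfolding g_def using Suc.IH[OF f(2)[OF that]] .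
  have "(\<lambda>x. f (\<lambda>i. x i - ev a x * b i)) = (\<lambda>x. (\<Sum>i<3. x i * g i x) - ev a x * (\<Sum>i<3. b i * g i x))"
    by (simp add: f(1) g_def left_diff_distrib sum_subtractf sum_distrib_left mult.assoc)
  moreover have "(\<lambda>x. \<Sum>i<3. x i * g i x) \<in> ternary_forms (Suc e)"
    using g by auto
  ultimately show ?case
    using ternary_forms_diff[OF _ ternary_forms_ev_mult[OF ternary_forms_linear_comb[of g e b, OF g]]]
    by (simp del: ternary_forms.simps)
qed auto

text \<open>With \<open>x'\<close> the substituted point,
  \<open>x i * f' i x - x' i * f' i x'\<close> is \<open>x i * (f' i x - f' i x')\<close> plus
  \<open>ev a x * b i * f' i x'\<close>, and the first difference is divisible by induction.\<close>

lemma ternary_forms_quotient: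
  assumes "f \<in> ternary_forms (Suc e)"
  shows "\<exists>h\<in>ternary_forms e. \<forall>x. f x - f (\<lambda>i. x i - ev a x * b i) = ev a x * h x"
  using assms
proof (induction e arbitrary: f)
  case 0
  then obtain f' where f: "f = (\<lambda>x. \<Sum>i<3. x i * f' i x)" "\<And>i. i < 3 \<Longrightarrow> f' i \<in> ternary_forms 0"
    by auto
  then have "\<forall>i. \<exists>c. i < 3 \<longrightarrow> f' i = (\<lambda>_. c)" by auto
  then obtain c where c: "\<And>i. i < 3 \<Longrightarrow> f' i = (\<lambda>_. c i)" by metis
  have "f = (\<lambda>x. \<Sum>i<3. x i * c i)" using c by (simp add: f(1))
  then have "f x - f (\<lambda>i. x i - ev a x * b i) = ev a x * (\<Sum>i<3. b i * c i)" for x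
    by (simp add: left_diff_distrib sum_subtractf sum_distrib_left mult.assoc)
  then show ?case by auto
next
  case (Suc e)
  then obtain f' where f: "f = (\<lambda>x. \<Sum>i<3. x i * f' i x)" "\<And>i. i < 3 \<Longrightarrow> f' i \<in> ternary_forms (Suc e)"
    by (auto simp del: ternary_forms.simps simp: ternary_forms.simps(2)[of "Suc e"])
  define g where "g i x = f' i (\<lambda>k. x k - ev a x * b k)" for i x
  have g: "g i \<in> ternary_forms (Suc e)" if "i < 3" for i
    unfolding g_def by (rule ternary_forms_project[OF f(2)[OF that]])
  have "\<forall>i. \<exists>h. i < 3 \<longrightarrow> h \<in> ternary_forms e \<and> (\<forall>x. f' i x - g i x = ev a x * h x)"
    using Suc.IH[OF f(2)] unfolding g_def by blast
  then obtain h where h: "\<And>i. i < 3 \<Longrightarrow> h i \<in> ternary_forms e"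
      "\<And>i x. i < 3 \<Longrightarrow> f' i x - g i x = ev a x * h i x" by metis
  have "(\<lambda>x. \<Sum>i<3. x i * h i x) \<in> ternary_forms (Suc e)" using h(1) by auto
  then have "(\<lambda>x. (\<Sum>i<3. x i * h i x) + (\<Sum>i<3. b i * g i x)) \<in> ternary_forms (Suc e)"
    by (intro ternary_forms_add ternary_forms_linear_comb g)
  moreover have "f x - f (\<lambda>i. x i - ev a x * b i) = ev a x * ((\<Sum>i<3. x i * h i x) + (\<Sum>i<3. b i * g i x))" for x
  proof -
    have "f x - f (\<lambda>i. x i - ev a x * b i) = (\<Sum>i<3. x i * (f' i x - g i x)) + ev a x * (\<Sum>i<3. b i * g i x)"
      by (simp add: f(1) g_def left_diff_distrib right_diff_distrib sum_subtractf sum_distrib_left mult.assoc)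
    also have "(\<Sum>i<3. x i * (f' i x - g i x)) = ev a x * (\<Sum>i<3. x i * h i x)"
      unfolding sum_distrib_left by (intro sum.cong refl) (simp add: h(2) mult.left_commute)
    finally show ?thesis by (simp add: distrib_left)
  qed
  ultimately show ?case
    by (intro bexI[of _ "\<lambda>x. (\<Sum>i<3. x i * h i x) + (\<Sum>i<3. b i * g i x)"] allI)
qed

text \<open>By \<open>ev a b = 1\<close> the projected point lies in the plane where
  \<open>f\<close> vanishes, so the subtracted value is zero.\<close>

lemma ternary_forms_divide:
  assumes f: "f \<in> ternary_forms (Suc e)" and van: "\<And>x. ev a x = 0 \<Longrightarrow> f x = 0" and b: "ev a b = 1"
  shows "\<exists>h\<in>ternary_forms e. \<forall>x. f x = ev a x * h x"
proof -
  obtain h where h: "h \<in> ternary_forms e" "\<And>x. f x - f (\<lambda>i. x i - ev a x * b i) = ev a x * h x"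
    using ternary_forms_quotient[OF f] by blast
  have "f (\<lambda>i. x i - ev a x * b i) = 0" for x
    by (rule van) (simp add: ev_scale b)
  with h show ?thesis by auto
qed

section \<open>Counting monomials, and homogeneous linear systems\<close>

definition exponents :: "nat \<Rightarrow> (nat \<times> nat) set" where
  "exponents e = Sigma {..e} (\<lambda>a. {..e - a})"

definition monomial :: "nat \<Rightarrow> nat \<times> nat \<Rightarrow> (nat \<Rightarrow> complex) \<Rightarrow> complex" where
  "monomial e p x = x 0 ^ fst p * x 1 ^ snd p * x 2 ^ (e - fst p - snd p)"

lemma finite_exponents [simp]: "finite (exponents e)"
  by (simp add: exponents_def)

lemma card_exponents: "card (exponents e) = (e + 2) choose 2"
proof -
  have "card (exponents e) = (\<Sum>a\<le>e. Suc (e - a))"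
    by (simp add: exponents_def)
  also have "\<dots> = (e + 2) choose 2"
  proof (induction e)
    case (Suc e)
    have "(\<Sum>a\<le>Suc e. Suc (Suc e - a)) = Suc (Suc e) + (\<Sum>a\<le>e. Suc (e - a))"
      by (subst sum.atMost_Suc_shift) simp
    then show ?case using Suc by (simp add: numeral_2_eq_2)
  qed (simp add: numeral_2_eq_2)
  finally show ?thesis .
qed

lemma monomial_shift:
  assumes "p \<in> exponents e"
  shows "x 0 * monomial e p x = monomial (Suc e) (Suc (fst p), snd p) x"
    "x 1 * monomial e p x = monomial (Suc e) (fst p, Suc (snd p)) x"
    "x 2 * monomial e p x = monomial (Suc e) p x"
proof -
  have "Suc e - fst p - snd p = Suc (e - fst p - snd p)" using assms by (auto simp: exponents_def)
  then show "x 0 * monomial e p x = monomial (Suc e) (Suc (fst p), snd p) x"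
    "x 1 * monomial e p x = monomial (Suc e) (fst p, Suc (snd p)) x"
    "x 2 * monomial e p x = monomial (Suc e) p x"
    by (simp_all add: monomial_def)
qed

lemma monomial_span_reindex:
  assumes inj: "inj_on s (exponents e)" and im: "s ` exponents e \<subseteq> exponents e'"
  shows "\<exists>c'. \<forall>x. (\<Sum>p\<in>exponents e. c p * monomial e' (s p) x) = (\<Sum>p\<in>exponents e'. c' p * monomial e' p x)"
proof (intro exI allI)
  fix x
  let ?c = "\<lambda>p. if p \<in> s ` exponents e then c (the_inv_into (exponents e) s p) else 0"
  have "(\<Sum>p\<in>exponents e'. ?c p * monomial e' p x)
      = (\<Sum>p\<in>s ` exponents e. c (the_inv_into (exponents e) s p) * monomial e' p x)"
    by (rule sum.mono_neutral_cong_right) (use im in auto)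
  also have "\<dots> = (\<Sum>p\<in>exponents e. c p * monomial e' (s p) x)"
    by (subst sum.reindex[OF inj]) (simp add: the_inv_into_f_f[OF inj])
  finally show "(\<Sum>p\<in>exponents e. c p * monomial e' (s p) x) = (\<Sum>p\<in>exponents e'. ?c p * monomial e' p x)" ..
qed

text \<open>The monomials bound the number of linear conditions under which a combination of forms
  vanishes: \<open>(e + 2) choose 2\<close>, which is \<open>(m + 1) choose 2\<close> for
  \<open>e = m - 1\<close>.\<close>

lemma ternary_forms_monomials:
  "f \<in> ternary_forms e \<Longrightarrow> \<exists>c. \<forall>x. f x = (\<Sum>p\<in>exponents e. c p * monomial e p x)"
proof (induction e arbitrary: f)
  case 0
  then obtain c where "f = (\<lambda>_. c)" by auto
  then show ?case by (intro exI[of _ "\<lambda>_. c"]) (simp add: exponents_def monomial_def)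
next
  case (Suc e)
  then obtain f' where f: "f = (\<lambda>x. \<Sum>i<3. x i * f' i x)" "\<And>i. i < 3 \<Longrightarrow> f' i \<in> ternary_forms e"
    by auto
  obtain c0 where c0: "\<And>x. f' 0 x = (\<Sum>p\<in>exponents e. c0 p * monomial e p x)" using Suc.IH[OF f(2)[of 0]] by auto
  obtain c1 where c1: "\<And>x. f' 1 x = (\<Sum>p\<in>exponents e. c1 p * monomial e p x)" using Suc.IH[OF f(2)[of 1]] by auto
  obtain c2 where c2: "\<And>x. f' 2 x = (\<Sum>p\<in>exponents e. c2 p * monomial e p x)" using Suc.IH[OF f(2)[of 2]] by auto
  have 0: "x 0 * f' 0 x = (\<Sum>p\<in>exponents e. c0 p * monomial (Suc e) (Suc (fst p), snd p) x)" for x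
    unfolding c0 sum_distrib_left by (intro sum.cong refl) (simp add: monomial_shift(1)[symmetric])
  have 1: "x 1 * f' 1 x = (\<Sum>p\<in>exponents e. c1 p * monomial (Suc e) (fst p, Suc (snd p)) x)" for x
    unfolding c1 sum_distrib_left by (intro sum.cong refl) (simp add: monomial_shift(2)[symmetric])
  have 2: "x 2 * f' 2 x = (\<Sum>p\<in>exponents e. c2 p * monomial (Suc e) p x)" for x
    unfolding c2 sum_distrib_left by (intro sum.cong refl) (simp add: monomial_shift(3)[symmetric])
  have inj0: "inj_on (\<lambda>p. (Suc (fst p), snd p)) (exponents e)" by (auto simp: inj_on_def prod_eq_iff)
  have im0: "(\<lambda>p. (Suc (fst p), snd p)) ` exponents e \<subseteq> exponents (Suc e)" by (auto simp: exponents_def)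
  obtain d0 where d0: "\<And>x. x 0 * f' 0 x = (\<Sum>p\<in>exponents (Suc e). d0 p * monomial (Suc e) p x)"
    using monomial_span_reindex[OF inj0 im0, of c0] unfolding 0 by blast
  have inj1: "inj_on (\<lambda>p. (fst p, Suc (snd p))) (exponents e)" by (auto simp: inj_on_def prod_eq_iff)
  have im1: "(\<lambda>p. (fst p, Suc (snd p))) ` exponents e \<subseteq> exponents (Suc e)" by (auto simp: exponents_def)
  obtain d1 where d1: "\<And>x. x 1 * f' 1 x = (\<Sum>p\<in>exponents (Suc e). d1 p * monomial (Suc e) p x)"
    using monomial_span_reindex[OF inj1 im1, of c1] unfolding 1 by blast
  have inj2: "inj_on (\<lambda>p. p) (exponents e)" by (auto simp: inj_on_def prod_eq_iff)
  have im2: "(\<lambda>p. p) ` exponents e \<subseteq> exponents (Suc e)" by (auto simp: exponents_def)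
  obtain d2 where d2: "\<And>x. x 2 * f' 2 x = (\<Sum>p\<in>exponents (Suc e). d2 p * monomial (Suc e) p x)"
    using monomial_span_reindex[OF inj2 im2, of c2] unfolding 2 by blast
  have "f x = x 0 * f' 0 x + x 1 * f' 1 x + x 2 * f' 2 x" for x
    by (simp add: f(1) numeral_3_eq_3 numeral_2_eq_2)
  then show ?case
    unfolding d0 d1 d2 by (intro exI[of _ "\<lambda>p. d0 p + d1 p + d2 p"]) (simp add: sum.distrib distrib_right)
qed

text \<open>Gaussian elimination: an equation with a nonzero coefficient serves as pivot and is
  removed together with its unknown.\<close>

lemma underdetermined:
  fixes A :: "'e \<Rightarrow> 'i \<Rightarrow> 'a::field"
  assumes "finite E" "finite I" "card E < card I"
  shows "\<exists>t. (\<forall>e\<in>E. (\<Sum>i\<in>I. A e i * t i) = 0) \<and> (\<exists>i\<in>I. t i \<noteq> 0)"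
  using assms
proof (induction E arbitrary: I A)
  case empty
  then have "I \<noteq> {}" by auto
  then show ?case by (intro exI[of _ "\<lambda>_. 1"]) auto
next
  case (insert e E)
  show ?case
  proof (cases "\<forall>i\<in>I. A e i = 0")
    case True
    have "card E < card I" using insert by simp
    then obtain t where "\<forall>e\<in>E. (\<Sum>i\<in>I. A e i * t i) = 0" "\<exists>i\<in>I. t i \<noteq> 0"
      using insert.IH[OF insert.prems(1), of A] by blast
    then show ?thesis using True by (intro exI[of _ t]) auto
  next
    case False
    then obtain k where k: "k \<in> I" "A e k \<noteq> 0" by blast
    define B where "B f i = A f i - A f k * A e i / A e k" for f i
    have "card E < card (I - {k})" using insert k by (simp add: card_Diff_singleton)
    then obtain t where t: "\<forall>f\<in>E. (\<Sum>i\<in>I - {k}. B f i * t i) = 0" "\<exists>i\<in>I - {k}. t i \<noteq> 0"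
      using insert.IH[of "I - {k}" B] insert.prems(1) by auto
    let ?s = "\<Sum>i\<in>I - {k}. A e i * t i"
    define t' where "t' = t(k := - ?s / A e k)"
    have sum: "(\<Sum>i\<in>I. A f i * t' i) = A f k * (- ?s / A e k) + (\<Sum>i\<in>I - {k}. A f i * t i)" for f
    proof -
      have "(\<Sum>i\<in>I. A f i * t' i) = A f k * t' k + (\<Sum>i\<in>I - {k}. A f i * t' i)"
        by (rule sum.remove) (use insert.prems k in auto)
      also have "(\<Sum>i\<in>I - {k}. A f i * t' i) = (\<Sum>i\<in>I - {k}. A f i * t i)"
        by (rule sum.cong) (auto simp: t'_def)
      finally show ?thesis by (simp add: t'_def)
    qed
    have "(\<Sum>i\<in>I. A f i * t' i) = 0" if "f \<in> E" for f
    proof -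
      have "0 = (\<Sum>i\<in>I - {k}. A f i * t i - A f k / A e k * (A e i * t i))"
      proof -
        have "(\<Sum>i\<in>I - {k}. B f i * t i) = (\<Sum>i\<in>I - {k}. A f i * t i - A f k / A e k * (A e i * t i))"
          by (intro sum.cong refl) (simp add: B_def left_diff_distrib)
        then show ?thesis using t(1) that by simp
      qed
      also have "\<dots> = (\<Sum>i\<in>I - {k}. A f i * t i) - A f k / A e k * ?s"
        by (simp add: sum_subtractf sum_distrib_left)
      finally show ?thesis unfolding sum by simp
    qed
    moreover have "(\<Sum>i\<in>I. A e i * t' i) = 0" unfolding sum using k by simp
    moreover have "\<exists>i\<in>I. t' i \<noteq> 0" using t(2) by (auto simp: t'_def)
    ultimately show ?thesis by blast
  qed
qed

lemma prod_linear_degree: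
  assumes "finite S"
  shows "degree (\<Prod>l\<in>S. [:a l, b l:]) \<le> card S \<and> coeff (\<Prod>l\<in>S. [:a l, b l:]) (card S) = (\<Prod>l\<in>S. b l)"
  using assms
proof induction
  case (insert l S)
  let ?p = "\<Prod>l\<in>S. [:a l, b l:]"
  have "degree ([:a l, b l:] * ?p) \<le> 1 + card S"
    by (rule order_trans[OF degree_mult_le add_mono]) (use insert.IH in auto)
  moreover have "coeff ?p (Suc (card S)) = 0" using insert.IH by (intro coeff_eq_0) auto
  ultimately show ?case using insert by simp
qed simp

section \<open>The pencil of a net\<close>

text \<open>What the construction uses of the net: two blocks of \<open>m\<close> lines, and on
  every line \<open>m\<close> different points, given by vectors, each lying on a line of both
  blocks. \<open>C\<close> is an index set for these points; for an actual net it will be a block of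
  lines.\<close>

locale net_arrangement = line_arrangement \<alpha> for \<alpha> :: "'n::finite \<Rightarrow> complex vec" +
  fixes B0 B1 :: "'n set" and m :: nat
  assumes disjoint: "B0 \<inter> B1 = {}" and card_B: "card B0 = m" "card B1 = m" and m: "1 \<le> m"
    and base_points: "\<And>i. \<exists>C q. card (C :: 'n set) = m \<and>
      (\<forall>j\<in>C. \<ell> i (q j) = 0 \<and> (\<exists>l\<in>B0. \<ell> l (q j) = 0) \<and> (\<exists>l\<in>B1. \<ell> l (q j) = 0) \<and> (\<exists>r<3. q j r \<noteq> 0)) \<and>
      (\<forall>j\<in>C. \<forall>k\<in>C. \<forall>s. j \<noteq> k \<longrightarrow> s \<noteq> 0 \<longrightarrow> (\<exists>r<3. q j r \<noteq> s * q k r))"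
begin

definition Q0 :: "(nat \<Rightarrow> complex) \<Rightarrow> complex" where "Q0 x = (\<Prod>l\<in>B0. \<ell> l x)"
definition Q1 :: "(nat \<Rightarrow> complex) \<Rightarrow> complex" where "Q1 x = (\<Prod>l\<in>B1. \<ell> l x)"

lemma Q0_eq_0_iff: "Q0 x = 0 \<longleftrightarrow> (\<exists>l\<in>B0. \<ell> l x = 0)" by (simp add: Q0_def)
lemma Q1_eq_0_iff: "Q1 x = 0 \<longleftrightarrow> (\<exists>l\<in>B1. \<ell> l x = 0)" by (simp add: Q1_def)

lemma line_poly_Q: "line_poly Q0" "line_poly Q1"
  unfolding Q0_def Q1_def by (intro line_poly_prod line_poly_ev)+

text \<open>At a general point of a line of one block the product of that block vanishes and the
  other does not, which tests the two coefficients separately.\<close>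

lemma pencil_nonzero:
  assumes "(a, b) \<noteq> (0, 0)"
  shows "\<exists>x. a * Q0 x + b * Q1 x \<noteq> 0"
proof -
  have "B0 \<noteq> {}" "B1 \<noteq> {}" using card_B m by auto
  then obtain i j where ij: "i \<in> B0" "j \<in> B1" by blast
  obtain x where x: "\<ell> i x = 0" "\<And>k. k \<noteq> i \<Longrightarrow> \<ell> k x \<noteq> 0" using generic_point_on_line by blast
  obtain y where y: "\<ell> j y = 0" "\<And>k. k \<noteq> j \<Longrightarrow> \<ell> k y \<noteq> 0" using generic_point_on_line by blast
  have "l \<noteq> i" if "l \<in> B1" for l using that ij disjoint by auto
  then have Qx: "Q0 x = 0" "Q1 x \<noteq> 0" using x ij by (auto simp: Q0_eq_0_iff Q1_eq_0_iff)
  have "l \<noteq> j" if "l \<in> B0" for l using that ij disjoint by auto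
  then have Qy: "Q1 y = 0" "Q0 y \<noteq> 0" using y ij by (auto simp: Q0_eq_0_iff Q1_eq_0_iff)
  show ?thesis
  proof (cases "b = 0")
    case True
    then show ?thesis using assms Qy by (intro exI[of _ y]) simp
  next
    case False
    then show ?thesis using Qx by (intro exI[of _ x]) simp
  qed
qed

text \<open>The member of the pencil through a further point of a line contains the whole line, as it has
  degree \<open>m\<close> and meets the line in the \<open>m\<close> base points as well.\<close>

lemma vanishes_on_line:
  assumes x0: "\<ell> i x0 = 0" "Q0 x0 \<noteq> 0" and y: "\<ell> i y = 0"
  shows "Q0 x0 * Q1 y - Q1 x0 * Q0 y = 0"
proof (cases "\<exists>t. \<forall>r<3. y r = t * x0 r")
  \<comment> \<open>At a multiple of \<open>x0\<close> the claim is homogeneity: both products scale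
    by \<open>t ^ m\<close>.\<close>
  case True
  then obtain t where "\<And>r. r < 3 \<Longrightarrow> y r = t * x0 r" by blast
  then have "\<ell> l y = t * \<ell> l x0" for l using ev_eqI[of y "\<lambda>r. t * x0 r"] by (simp add: ev_scale)
  then have "Q0 y = t ^ m * Q0 x0" "Q1 y = t ^ m * Q1 x0"
    by (simp_all add: Q0_def Q1_def prod.distrib card_B)
  then show ?thesis by simp
next
  case y_indep: False
  \<comment> \<open>The pencil member on the line through \<open>x0\<close> and \<open>y\<close>,
    with \<open>x0\<close> placed at infinity: its coefficient of degree \<open>m\<close> is its
    value at \<open>x0\<close>, which is zero. The degree is therefore below \<open>m\<close>, too
    small for \<open>m\<close> roots.\<close>
  define P where "P = smult (Q0 x0) (\<Prod>l\<in>B1. [:\<ell> l y, \<ell> l x0:]) - smult (Q1 x0) (\<Prod>l\<in>B0. [:\<ell> l y, \<ell> l x0:])"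
  have poly_P: "poly P s = Q0 x0 * Q1 (\<lambda>i. y i + s * x0 i) - Q1 x0 * Q0 (\<lambda>i. y i + s * x0 i)" for s
    by (simp add: P_def Q0_def Q1_def poly_prod)
  obtain C :: "'n set" and q where Cq: "card C = m \<and>
      (\<forall>j\<in>C. \<ell> i (q j) = 0 \<and> (\<exists>l\<in>B0. \<ell> l (q j) = 0) \<and> (\<exists>l\<in>B1. \<ell> l (q j) = 0) \<and> (\<exists>r<3. q j r \<noteq> 0)) \<and>
      (\<forall>j\<in>C. \<forall>k\<in>C. \<forall>s. j \<noteq> k \<longrightarrow> s \<noteq> 0 \<longrightarrow> (\<exists>r<3. q j r \<noteq> s * q k r))"
    using base_points[of i] by (elim exE) (rule that)
  then have C: "card C = m" by blast
  have q: "\<ell> i (q j) = 0" "\<exists>l\<in>B0. \<ell> l (q j) = 0" "\<exists>l\<in>B1. \<ell> l (q j) = 0" "\<exists>r<3. q j r \<noteq> 0"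
    if "j \<in> C" for j
    using Cq that by blast+
  have q_dist: "\<exists>r<3. q j r \<noteq> s * q k r" if "j \<in> C" "k \<in> C" "j \<noteq> k" "s \<noteq> 0" for j k s
    using Cq that by blast
  have "\<exists>s c. c \<noteq> 0 \<and> (\<forall>r<3. q j r = c * (y r + s * x0 r))" if j: "j \<in> C" for j
  proof -
    obtain a where a: "\<ell> i a = 1" by (rule form_eq_1)
    \<comment> \<open>Four vectors in three-space are dependent. Among them \<open>\<ell> i\<close>
      is nonzero on \<open>a\<close> alone, so \<open>a\<close> drops out and the base point is a
      combination of \<open>x0\<close> and \<open>y\<close>.\<close>
    define M where "M r k = (if k = 0 then a r else if k = 1 then x0 r else if k = 2 then y r else q j r)"
      for r k :: nat
    obtain t where t: "\<And>r. r < 3 \<Longrightarrow> (\<Sum>k<4. M r k * t k) = 0" "\<exists>k<4. t k \<noteq> 0"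
      using underdetermined[of "{..<3::nat}" "{..<4::nat}" M] by auto
    define A B C' D where "A = t 0" and "B = t 1" and "C' = t 2" and "D = t 3"
    have rel: "a r * A + x0 r * B + y r * C' + q j r * D = 0" if "r < 3" for r
      using t(1)[OF that] by (simp add: M_def eval_nat_numeral A_def B_def C'_def D_def)
    have nz: "A \<noteq> 0 \<or> B \<noteq> 0 \<or> C' \<noteq> 0 \<or> D \<noteq> 0"
    proof -
      obtain k where k: "k < 4" "t k \<noteq> 0" using t(2) by blast
      then have "k = 0 \<or> k = 1 \<or> k = 2 \<or> k = 3" by arith
      then show ?thesis using k(2) by (auto simp: A_def B_def C'_def D_def)
    qed
    have "(\<Sum>r<3. \<alpha> i $ r * (a r * A + x0 r * B + y r * C' + q j r * D)) = 0"
      by (rule sum.neutral) (simp add: rel)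
    moreover have "(\<Sum>r<3. \<alpha> i $ r * (a r * A + x0 r * B + y r * C' + q j r * D))
        = \<ell> i a * A + \<ell> i x0 * B + \<ell> i y * C' + \<ell> i (q j) * D"
      unfolding ev_def sum_distrib_right sum.distrib[symmetric] by (intro sum.cong refl) (simp add: algebra_simps)
    ultimately have A: "A = 0" using a x0 y q(1)[OF j] by simp
    have rel': "x0 r * B + y r * C' + q j r * D = 0" if "r < 3" for r
      using rel[OF that] A by simp
    have x0_nz: "\<exists>r<3. x0 r \<noteq> 0"
    proof (rule ccontr)
      assume "\<not> ?thesis"
      then have "\<ell> l x0 = 0" for l using ev_eqI[of x0 "\<lambda>_. 0"] by simp
      moreover have "B0 \<noteq> {}" using card_B m by auto
      ultimately show False using x0(2) by (auto simp: Q0_eq_0_iff)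
    qed
    have D: "D \<noteq> 0"
    proof
      assume D: "D = 0"
      show False
      proof (cases "C' = 0")
        case True
        then have "B = 0" using rel' D x0_nz by auto
        with A D True nz show False by simp
      next
        case False
        have "y r = (- B / C') * x0 r" if "r < 3" for r
          using rel'[OF that] D False by (simp add: field_simps eq_neg_iff_add_eq_0)
        then show False using y_indep by blast
      qed
    qed
    have q_eq: "q j r = - B / D * x0 r + - C' / D * y r" if "r < 3" for r
      using rel'[OF that] D by (simp add: field_simps eq_neg_iff_add_eq_0)
    \<comment> \<open>A base point is not a multiple of \<open>x0\<close>, since \<open>Q0\<close>
      vanishes at the one and not at the other.\<close>
    have C': "C' \<noteq> 0"
    proof
      assume "C' = 0"
      then have q': "q j r = - B / D * x0 r" if "r < 3" for r using q_eq[OF that] by simp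
      then have "\<ell> l (q j) = - B / D * \<ell> l x0" for l
        using ev_eqI[of "q j" "\<lambda>r. - B / D * x0 r"] by (simp only: ev_scale)
      moreover obtain l where "l \<in> B0" "\<ell> l (q j) = 0" using q(2)[OF j] by blast
      moreover have "\<ell> l x0 \<noteq> 0" using x0(2) \<open>l \<in> B0\<close> by (auto simp: Q0_eq_0_iff)
      ultimately have "B = 0" using D by simp
      then show False using q' q(4)[OF j] by auto
    qed
    show ?thesis
    proof (intro exI conjI allI impI)
      show "- C' / D \<noteq> 0" using C' D by simp
      show "q j r = - C' / D * (y r + B / C' * x0 r)" if "r < 3" for r
        using q_eq[OF that] C' by (simp add: distrib_left)
    qed
  qed
  then obtain s c where sc: "\<And>j. j \<in> C \<Longrightarrow> c j \<noteq> 0"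
      "\<And>j r. j \<in> C \<Longrightarrow> r < 3 \<Longrightarrow> q j r = c j * (y r + s j * x0 r)" by metis
  have "inj_on s C"
  proof (rule inj_onI, rule ccontr)
    fix j k assume jk: "j \<in> C" "k \<in> C" "s j = s k" "j \<noteq> k"
    then have "q j r = c j / c k * q k r" if "r < 3" for r using sc that by simp
    then show False using q_dist[of j k "c j / c k"] jk sc(1) by auto
  qed
  then have card_s: "card (s ` C) = m" by (simp add: card_image C)
  have roots: "poly P (s j) = 0" if j: "j \<in> C" for j
  proof -
    have "\<ell> l (q j) = c j * \<ell> l (\<lambda>r. y r + s j * x0 r)" for l
      using ev_eqI[of "q j" "\<lambda>r. c j * (y r + s j * x0 r)"] sc(2)[OF j] by (simp only: ev_scale)
    then have "Q0 (\<lambda>i. y i + s j * x0 i) = 0" "Q1 (\<lambda>i. y i + s j * x0 i) = 0"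
      unfolding Q0_eq_0_iff Q1_eq_0_iff using q(2,3)[OF j] sc(1)[OF j] by auto
    then show ?thesis by (simp add: poly_P)
  qed
  have "P = 0"
  proof (rule ccontr)
    assume nz: "P \<noteq> 0"
    have "degree P \<le> m"
      unfolding P_def
      by (intro degree_diff_le order_trans[OF degree_smult_le])
         (use prod_linear_degree[of B0 "\<lambda>l. \<ell> l y" "\<lambda>l. \<ell> l x0"]
            prod_linear_degree[of B1 "\<lambda>l. \<ell> l y" "\<lambda>l. \<ell> l x0"] card_B in auto)
    moreover have "coeff P m = 0"
      using prod_linear_degree[of B0 "\<lambda>l. \<ell> l y" "\<lambda>l. \<ell> l x0"]
        prod_linear_degree[of B1 "\<lambda>l. \<ell> l y" "\<lambda>l. \<ell> l x0"] card_B
      by (simp add: P_def Q0_def Q1_def)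
    ultimately have "degree P < m" using nz by (metis leading_coeff_0_iff le_neq_implies_less)
    moreover have "m \<le> card {x. poly P x = 0}"
      unfolding card_s[symmetric] by (rule card_mono) (use roots poly_roots_finite[OF nz] in auto)
    ultimately show False using card_poly_roots_bound[OF nz] by simp
  qed
  then show ?thesis using poly_P[of 0] by simp
qed

text \<open>On a line of the first block \<open>Q0\<close> itself vanishes; for any other line
  \<open>(u, w)\<close> are the values of \<open>Q0\<close> and \<open>Q1\<close> at a general point
  of it. The resulting member of degree \<open>m\<close> contains the line, and division by
  \<open>\<ell> i\<close> leaves degree \<open>m - 1\<close>.\<close>

lemma line_data:
  "\<exists>u w h. (u, w) \<noteq> (0, 0) \<and> h \<in> ternary_forms (m - 1) \<and> (\<forall>x. u * Q1 x - w * Q0 x = \<ell> i x * h x)"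
proof -
  have "\<exists>u w. (u, w) \<noteq> (0, 0) \<and> (\<forall>x. \<ell> i x = 0 \<longrightarrow> u * Q1 x - w * Q0 x = 0)"
  proof (cases "i \<in> B0")
    case True
    then show ?thesis by (intro exI[of _ 0] exI[of _ 1]) (auto simp: Q0_eq_0_iff)
  next
    case False
    obtain x0 where x0: "\<ell> i x0 = 0" "\<And>j. j \<noteq> i \<Longrightarrow> \<ell> j x0 \<noteq> 0"
      using generic_point_on_line by blast
    have "Q0 x0 \<noteq> 0" unfolding Q0_eq_0_iff using x0(2) False by metis
    then show ?thesis
      using vanishes_on_line[OF x0(1)] by (intro exI[of _ "Q0 x0"] exI[of _ "Q1 x0"]) auto
  qed
  then obtain u w where uw: "(u, w) \<noteq> (0, 0)" "\<And>x. \<ell> i x = 0 \<Longrightarrow> u * Q1 x - w * Q0 x = 0" by blast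
  have Q: "Q0 \<in> ternary_forms m" "Q1 \<in> ternary_forms m"
    using ternary_forms_prod[of B0 \<alpha>] ternary_forms_prod[of B1 \<alpha>] card_B by (simp_all add: Q0_def[abs_def] Q1_def[abs_def])
  have "(\<lambda>x. u * Q1 x - w * Q0 x) \<in> ternary_forms (Suc (m - 1))"
    using ternary_forms_diff[OF ternary_forms_scale[OF Q(2), of u] ternary_forms_scale[OF Q(1), of w]] m
    by (simp del: ternary_forms.simps)
  moreover obtain b where "\<ell> i b = 1" by (rule form_eq_1)
  ultimately have "\<exists>h\<in>ternary_forms (m - 1). \<forall>x. u * Q1 x - w * Q0 x = \<ell> i x * h x"
    using uw(2) by (intro ternary_forms_divide)
  with uw(1) show ?thesis by blast
qed

section \<open>Solutions, their rows, and values at reciprocals\<close>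

definition line_choice :: "'n \<Rightarrow> complex \<times> complex \<times> ((nat \<Rightarrow> complex) \<Rightarrow> complex)" where
  "line_choice i = (SOME (u, w, h). (u, w) \<noteq> (0, 0) \<and> h \<in> ternary_forms (m - 1) \<and>
     (\<forall>x. u * Q1 x - w * Q0 x = \<ell> i x * h x))"

definition u where "u i = fst (line_choice i)"
definition w where "w i = fst (snd (line_choice i))"
definition h where "h i = snd (snd (line_choice i))"

lemma uwh: "(u i, w i) \<noteq> (0, 0)" "h i \<in> ternary_forms (m - 1)" "u i * Q1 x - w i * Q0 x = \<ell> i x * h i x"
proof -
  have "case line_choice i of (a, b, g) \<Rightarrow> (a, b) \<noteq> (0, 0) \<and> g \<in> ternary_forms (m - 1) \<and>
     (\<forall>x. a * Q1 x - b * Q0 x = \<ell> i x * g x)"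
    unfolding line_choice_def by (rule someI_ex) (use line_data[of i] in auto)
  then show "(u i, w i) \<noteq> (0, 0)" "h i \<in> ternary_forms (m - 1)" "u i * Q1 x - w i * Q0 x = \<ell> i x * h i x"
    by (auto simp: u_def w_def h_def split: prod.splits)
qed

text \<open>With \<open>y\<^sub>i\<close> read as \<open>1 / \<ell> i\<close>, a solution \<open>t\<close> gives the column \<open>(g Q0, g Q1)\<close> of the matrix,
  divided by the product of all forms; \<open>first_row t\<close> and \<open>second_row t\<close> are the coefficient vectors.\<close>

definition solutions :: "('n \<Rightarrow> complex) set" where
  "solutions = {t. \<forall>x. (\<Sum>i\<in>UNIV. t i * h i x) = 0}"

definition first_row :: "('n \<Rightarrow> complex) \<Rightarrow> 'n \<Rightarrow> complex" where "first_row t i = t i * u i"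
definition second_row :: "('n \<Rightarrow> complex) \<Rightarrow> 'n \<Rightarrow> complex" where "second_row t i = t i * w i"

text \<open>The value of \<open>linear_form a\<close> at
  \<open>y_i = 1 / \<ell> i x\<close>.\<close>

definition recip_val :: "('n \<Rightarrow> complex) \<Rightarrow> (nat \<Rightarrow> complex) \<Rightarrow> complex" where
  "recip_val a x = (\<Sum>i\<in>UNIV. a i / \<ell> i x)"

lemma recip_val_add: "recip_val (\<lambda>i. a i + b i) x = recip_val a x + recip_val b x"
  by (simp add: recip_val_def add_divide_distrib sum.distrib)
lemma recip_val_diff: "recip_val (\<lambda>i. a i - b i) x = recip_val a x - recip_val b x"
  by (simp add: recip_val_def diff_divide_distrib sum_subtractf)
lemma recip_val_scale: "recip_val (\<lambda>i. c * a i) x = c * recip_val a x"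
  by (simp add: recip_val_def sum_distrib_left)

lemma recip_val_nonzero:
  assumes "a \<noteq> (\<lambda>_. 0)"
  shows "\<exists>x\<in>complement. recip_val a x \<noteq> 0"
  using recip_forms_independent[of a] assms unfolding recip_val_def by (meson ext)

lemma Q_nonzero: "x \<in> complement \<Longrightarrow> Q0 x \<noteq> 0" "x \<in> complement \<Longrightarrow> Q1 x \<noteq> 0"
  by (auto simp: Q0_eq_0_iff Q1_eq_0_iff complement_def)

text \<open>After multiplication by \<open>Q0\<close> the difference of the two sides is, up to
  sign, the sum of the \<open>t i * h i\<close>, because
  \<open>(u i * Q1 - w i * Q0) / \<ell> i = h i\<close> off the arrangement.\<close>

lemma solution_rows:
  assumes t: "t \<in> solutions" and x: "x \<in> complement"
  shows "recip_val (second_row t) x = Q1 x / Q0 x * recip_val (first_row t) x"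
proof -
  have "Q1 x * recip_val (first_row t) x - Q0 x * recip_val (second_row t) x
      = (\<Sum>i\<in>UNIV. t i * ((u i * Q1 x - w i * Q0 x) / \<ell> i x))"
    by (simp add: recip_val_def first_row_def second_row_def sum_distrib_left sum_subtractf[symmetric]
        diff_divide_distrib algebra_simps)
  also have "\<dots> = (\<Sum>i\<in>UNIV. t i * h i x)"
    using complementD[OF x] by (intro sum.cong) (auto simp: uwh(3))
  also have "\<dots> = 0" using t by (simp add: solutions_def)
  finally show ?thesis using Q_nonzero[OF x] by (simp add: field_simps)
qed

text \<open>If the first row vanished everywhere, so would the second; independence of the
  reciprocals would then kill all \<open>t i * u i\<close> and \<open>t i * w i\<close>, while
  \<open>u i\<close> and \<open>w i\<close> are never both zero.\<close>

lemma solution_nonzero: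
  assumes t: "t \<in> solutions" and nz: "t i \<noteq> 0"
  shows "\<exists>x\<in>complement. recip_val (first_row t) x \<noteq> 0"
proof (rule ccontr)
  assume neg: "\<not> ?thesis"
  then have "recip_val (second_row t) x = 0" if "x \<in> complement" for x
    using solution_rows[OF t that] that by simp
  then have "second_row t = (\<lambda>_. 0)" "first_row t = (\<lambda>_. 0)"
    using recip_val_nonzero neg by blast+
  then have "t i * u i = 0" "t i * w i = 0" by (auto simp: first_row_def second_row_def fun_eq_iff)
  then show False using uwh(1)[of i] nz by simp
qed

lemma solution_nonzero_pencil:
  assumes "x0 \<in> complement" "recip_val a x0 \<noteq> 0"
    and "finite Ps" "(0, 0) \<notin> Ps"
  shows "\<exists>x\<in>complement. recip_val a x \<noteq> 0 \<and> (\<forall>(b, c)\<in>Ps. b * Q0 x + c * Q1 x \<noteq> 0)"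
proof -
  \<comment> \<open>\<open>None\<close> stands for the linear form at the reciprocals, multiplied by
    all forms so that it is polynomial along lines; \<open>Some\<close> stands for the members of
    the pencil that must not vanish.\<close>
  define f where "f o' x = (case o' of None \<Rightarrow> (\<Sum>i\<in>UNIV. a i * (\<Prod>l\<in>UNIV - {i}. \<ell> l x))
      | Some (b, c) \<Rightarrow> b * Q0 x + c * Q1 x)" for o' x
  have f0: "f None x = recip_val a x * (\<Prod>l\<in>UNIV. \<ell> l x)" if "x \<in> complement" for x
  proof -
    have eq: "(\<Prod>l\<in>UNIV. \<ell> l x) = \<ell> i x * (\<Prod>l\<in>UNIV - {i}. \<ell> l x)" for i
      by (rule prod.remove) auto
    have "a i * (\<Prod>l\<in>UNIV - {i}. \<ell> l x) = a i / \<ell> i x * (\<Prod>l\<in>UNIV. \<ell> l x)" for i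
      using complementD[OF that, of i] by (subst eq[of i]) simp
    then show ?thesis by (simp add: f_def recip_val_def sum_distrib_right)
  qed
  have "\<exists>x\<in>complement. \<forall>o'\<in>insert None (Some ` Ps). f o' x \<noteq> 0"
  proof (rule complement_nonzero)
    show "finite (insert None (Some ` Ps))" using assms(3) by simp
    fix o' assume o': "o' \<in> insert None (Some ` Ps)"
    have "line_poly (\<lambda>x. \<Sum>i\<in>UNIV. a i * (\<Prod>l\<in>UNIV - {i}. \<ell> l x))"
      by (intro line_poly_sum line_poly_mult line_poly_const line_poly_prod line_poly_ev)
    moreover have "line_poly (\<lambda>x. b * Q0 x + c * Q1 x)" for b c
      by (intro line_poly_add line_poly_mult line_poly_const line_poly_Q)
    ultimately show "line_poly (f o')" by (cases o') (auto simp: f_def[abs_def])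
    show "\<exists>x. f o' x \<noteq> 0"
    proof (cases o')
      case None
      have "(\<Prod>l\<in>UNIV. \<ell> l x0) \<noteq> 0" using complementD[OF assms(1)] by simp
      then have "f None x0 \<noteq> 0" using f0[OF assms(1)] assms(2) by simp
      then show ?thesis using None by blast
    next
      case (Some bc)
      then obtain b c where bc: "bc = (b, c)" "(b, c) \<noteq> (0, 0)" using o' assms(4) by (cases bc) auto
      then show ?thesis using pencil_nonzero[OF bc(2)] Some by (simp add: f_def)
    qed
  qed
  then obtain x where x: "x \<in> complement" "\<And>o'. o' \<in> insert None (Some ` Ps) \<Longrightarrow> f o' x \<noteq> 0" by blast
  have "recip_val a x \<noteq> 0" using x(2)[of None] f0[OF x(1)] by auto
  moreover have "b * Q0 x + c * Q1 x \<noteq> 0" if "(b, c) \<in> Ps" for b c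
    using x(2)[of "Some (b, c)"] that by (simp add: f_def)
  ultimately show ?thesis using x(1) by blast
qed

lemma solutions_diff_scale:
  "s \<in> solutions \<Longrightarrow> t \<in> solutions \<Longrightarrow> (\<lambda>i. s i - c * t i) \<in> solutions"
  by (simp add: solutions_def left_diff_distrib sum_subtractf mult.assoc sum_distrib_left[symmetric])

lemma solutions_scale: "t \<in> solutions \<Longrightarrow> (\<lambda>i. c * t i) \<in> solutions"
  by (simp add: solutions_def mult.assoc sum_distrib_left[symmetric])

lemma first_row_diff_scale:
  "recip_val (first_row (\<lambda>i. s i - c * t i)) x = recip_val (first_row s) x - c * recip_val (first_row t) x"
proof -
  have "first_row (\<lambda>i. s i - c * t i) = (\<lambda>i. first_row s i - c * first_row t i)"
    by (simp add: first_row_def fun_eq_iff left_diff_distrib mult.assoc)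
  then show ?thesis by (simp add: recip_val_diff recip_val_scale)
qed

lemma first_row_scale:
  "recip_val (first_row (\<lambda>i. c * t i)) x = c * recip_val (first_row t) x"
proof -
  have "first_row (\<lambda>i. c * t i) = (\<lambda>i. c * first_row t i)"
    by (simp add: first_row_def fun_eq_iff mult.assoc)
  then show ?thesis by (simp add: recip_val_scale)
qed

text \<open>One condition for each monomial of degree \<open>m - 1\<close> makes \<open>t\<close> a
  solution, one more is added for each point, and there is one unknown per line.\<close>

lemma solution_through_points:
  assumes n: "n < card (UNIV :: 'n set) - ((m + 1) choose 2)"
  shows "\<exists>t\<in>solutions. (\<exists>i. t i \<noteq> 0) \<and> (\<forall>k<n. recip_val (first_row t) (p k) = 0)"
proof -
  have "\<exists>c. \<forall>x. h i x = (\<Sum>q\<in>exponents (m - 1). c q * monomial (m - 1) q x)" for i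
    by (rule ternary_forms_monomials[OF uwh(2)])
  then obtain c where c: "\<And>i x. h i x = (\<Sum>q\<in>exponents (m - 1). c i q * monomial (m - 1) q x)" by metis
  define A where "A e i = (case e of Inl q \<Rightarrow> c i q | Inr k \<Rightarrow> u i / \<ell> i (p k))" for e i
  let ?E = "exponents (m - 1) <+> {..<n}"
  have "card (exponents (m - 1)) = (m + 1) choose 2" using m by (simp add: card_exponents)
  then have "card ?E < card (UNIV :: 'n set)" using n by (simp add: card_Plus)
  then obtain t where t: "\<And>e. e \<in> ?E \<Longrightarrow> (\<Sum>i\<in>UNIV. A e i * t i) = 0" "\<exists>i. t i \<noteq> 0"
    using underdetermined[of ?E "UNIV :: 'n set" A] by auto
  have "(\<Sum>i\<in>UNIV. t i * h i x) = 0" for x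
  proof -
    have "(\<Sum>i\<in>UNIV. t i * h i x) = (\<Sum>i\<in>UNIV. \<Sum>q\<in>exponents (m - 1). A (Inl q) i * t i * monomial (m - 1) q x)"
      by (simp add: c A_def sum_distrib_left mult_ac)
    also have "\<dots> = (\<Sum>q\<in>exponents (m - 1). (\<Sum>i\<in>UNIV. A (Inl q) i * t i) * monomial (m - 1) q x)"
      unfolding sum_distrib_right by (rule sum.swap)
    also have "\<dots> = 0" using t(1) by (intro sum.neutral) auto
    finally show ?thesis .
  qed
  then have "t \<in> solutions" by (simp add: solutions_def)
  moreover have "recip_val (first_row t) (p k) = 0" if "k < n" for k
    using t(1)[of "Inr k"] that by (auto simp: A_def recip_val_def first_row_def mult.commute)
  ultimately show ?thesis using t(2) by blast
qed

text \<open>A nonzero solution that vanishes at the earlier points is nonzero at some point with a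
  new value of \<open>Q1 / Q0\<close>. After normalisation, multiples of it are subtracted from the
  earlier solutions.\<close>

lemma dual_points:
  "n \<le> card (UNIV :: 'n set) - ((m + 1) choose 2) \<Longrightarrow> \<exists>p t. (\<forall>j<n. p j \<in> complement \<and> t j \<in> solutions) \<and>
     (\<forall>i<n. \<forall>j<n. recip_val (first_row (t j)) (p i) = (if i = j then 1 else 0)) \<and>
     inj_on (\<lambda>i. Q1 (p i) / Q0 (p i)) {..<n}"
proof (induction n)
  case (Suc n)
  then have "n \<le> card (UNIV :: 'n set) - ((m + 1) choose 2)" by simp
  from Suc.IH[OF this] obtain p t where IH': "\<forall>j<n. p j \<in> complement \<and> t j \<in> solutions"
      "\<forall>i<n. \<forall>j<n. recip_val (first_row (t j)) (p i) = (if i = j then 1 else 0)"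
      "inj_on (\<lambda>i. Q1 (p i) / Q0 (p i)) {..<n}" by blast
  note IH = IH'(1)[rule_format, THEN conjunct1] IH'(1)[rule_format, THEN conjunct2]
    IH'(2)[rule_format] IH'(3)
  obtain s where s: "s \<in> solutions" "\<exists>i. s i \<noteq> 0" "\<And>k. k < n \<Longrightarrow> recip_val (first_row s) (p k) = 0"
    using solution_through_points[of n p] Suc.prems by auto
  obtain x0 where x0: "x0 \<in> complement" "recip_val (first_row s) x0 \<noteq> 0" using solution_nonzero s by blast
  \<comment> \<open>If \<open>Q1 - c * Q0\<close> is nonzero for each earlier ratio
    \<open>c\<close>, the new ratio is different from all of them.\<close>
  let ?Ps = "(\<lambda>i. (- (Q1 (p i) / Q0 (p i)), 1)) ` {..<n}"
  have "\<exists>x\<in>complement. recip_val (first_row s) x \<noteq> 0 \<and> (\<forall>(b, c)\<in>?Ps. b * Q0 x + c * Q1 x \<noteq> 0)"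
    by (rule solution_nonzero_pencil[OF x0]) auto
  then obtain x where x: "x \<in> complement" "recip_val (first_row s) x \<noteq> 0"
      "\<forall>(b, c)\<in>?Ps. b * Q0 x + c * Q1 x \<noteq> 0" by blast
  have xi: "Q1 x / Q0 x \<noteq> Q1 (p i) / Q0 (p i)" if "i < n" for i
  proof
    assume "Q1 x / Q0 x = Q1 (p i) / Q0 (p i)"
    then have "Q1 x = Q1 (p i) / Q0 (p i) * Q0 x" using Q_nonzero[OF x(1)] by (simp add: field_simps)
    moreover have "- (Q1 (p i) / Q0 (p i)) * Q0 x + 1 * Q1 x \<noteq> 0" using x(3) that by auto
    ultimately show False by simp
  qed
  define s' where "s' = (\<lambda>i. (1 / recip_val (first_row s) x) * s i)"
  have s': "s' \<in> solutions" unfolding s'_def by (rule solutions_scale[OF s(1)])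
  have s'x: "recip_val (first_row s') x = 1" unfolding s'_def first_row_scale using x(2) by simp
  have s'p: "recip_val (first_row s') (p k) = 0" if "k < n" for k
    unfolding s'_def first_row_scale using s(3)[OF that] by simp
  define p' where "p' = p(n := x)"
  define t' where "t' j = (if j = n then s' else (\<lambda>i. t j i - recip_val (first_row (t j)) x * s' i))" for j
  show ?case
  proof (intro exI[of _ p'] exI[of _ t'] conjI allI impI)
    fix j assume "j < Suc n"
    then show "p' j \<in> complement" "t' j \<in> solutions"
      using IH(1,2) x(1) s' solutions_diff_scale by (auto simp: p'_def t'_def less_Suc_eq)
  next
    fix i j assume "i < Suc n" "j < Suc n"
    then show "recip_val (first_row (t' j)) (p' i) = (if i = j then 1 else 0)"
      using IH(3)[of i j] s'x s'p by (auto simp: p'_def t'_def less_Suc_eq first_row_diff_scale)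
  next
    show "inj_on (\<lambda>i. Q1 (p' i) / Q0 (p' i)) {..<Suc n}"
      using IH(4) xi by (force simp: p'_def inj_on_def less_Suc_eq)
  qed
qed simp

text \<open>For \<open>n = card UNIV\<close> the values at the points \<open>p i\<close> are linear coordinates on all linear forms.\<close>

lemma extend_dual_points:
  assumes "n0 \<le> n" "n \<le> card (UNIV :: 'n set)" "\<forall>i<n0. p0 i \<in> complement"
    and "\<forall>i<n0. \<forall>j<n0. recip_val (e0 j) (p0 i) = (if i = j then 1 else 0)"
  shows "\<exists>p e. (\<forall>i<n0. p i = p0 i) \<and> (\<forall>i<n. p i \<in> complement) \<and>
     (\<forall>i<n. \<forall>j<n. recip_val (e j) (p i) = (if i = j then 1 else 0))"
  using assms(1,2)
proof (induction n rule: dec_induct)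
  case base
  then show ?case using assms by blast
next
  case (step n)
  then have "n \<le> card (UNIV :: 'n set)" by simp
  from step.IH[OF this] obtain p e where IH': "\<forall>i<n0. p i = p0 i" "\<forall>i<n. p i \<in> complement"
      "\<forall>i<n. \<forall>j<n. recip_val (e j) (p i) = (if i = j then 1 else 0)" by blast
  note IH = IH'[rule_format]
  obtain s where s: "\<And>k. k < n \<Longrightarrow> (\<Sum>i\<in>UNIV. 1 / \<ell> i (p k) * s i) = 0" "\<exists>i. s i \<noteq> 0"
    using underdetermined[of "{..<n}" "UNIV :: 'n set" "\<lambda>k i. 1 / \<ell> i (p k)"] step.prems by auto
  then have "s \<noteq> (\<lambda>_. 0)" by auto
  then obtain x where x: "x \<in> complement" "recip_val s x \<noteq> 0" using recip_val_nonzero by blast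
  have sp: "recip_val s (p k) = 0" if "k < n" for k
    using s(1)[OF that] by (simp add: recip_val_def)
  define s' where "s' = (\<lambda>i. (1 / recip_val s x) * s i)"
  have s'x: "recip_val s' x = 1" unfolding s'_def recip_val_scale using x(2) by simp
  have s'p: "recip_val s' (p k) = 0" if "k < n" for k
    unfolding s'_def recip_val_scale using sp[OF that] by simp
  define p' where "p' = p(n := x)"
  define e' where "e' j = (if j = n then s' else (\<lambda>i. e j i - recip_val (e j) x * s' i))" for j
  show ?case
  proof (intro exI[of _ p'] exI[of _ e'] conjI allI impI)
    show "p' i = p0 i" if "i < n0" for i using IH(1)[OF that] that step.hyps by (simp add: p'_def)
    show "p' i \<in> complement" if "i < Suc n" for i using IH(2) x(1) that by (auto simp: p'_def less_Suc_eq)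
    fix i j assume "i < Suc n" "j < Suc n"
    then show "recip_val (e' j) (p' i) = (if i = j then 1 else 0)"
      using IH(3)[of i j] s'x s'p by (auto simp: p'_def e'_def less_Suc_eq recip_val_diff recip_val_scale)
  qed
qed

end

section \<open>The initial degree of the Orlik-Terao ideal\<close>

lemma order_ge_prod_Var: "finite S \<Longrightarrow> order_ge UNIV (card S) (\<Prod>j\<in>S. Var j)"
proof (induction S rule: finite_induct)
  case (insert j S)
  have "order_ge UNIV 1 (Var j)" by (simp add: order_ge_def Var_def)
  from order_ge_mult[OF this insert.IH] show ?case using insert.hyps by simp
qed simp

lemma order_ge_mult_left: "order_ge W k p \<Longrightarrow> order_ge W k (a * p)"
  using order_ge_mult[of W 0 a k p] by simp

lemma linear_form_mult:
  "linear_form a * linear_form b = (\<Sum>i\<in>UNIV. \<Sum>j\<in>UNIV. Const (a i * b j) * (Var i * Var j))"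
  unfolding linear_form_def sum_product by (intro sum.cong refl) (simp add: Const_mult mult_ac)

context line_arrangement
begin

lemma dependency_forms:
  assumes "dependency \<alpha> S c"
  shows "(\<Sum>i\<in>S. c i * \<ell> i x) = 0"
proof -
  have "(\<Sum>i\<in>S. c i * \<ell> i x) = (\<Sum>r<3. x r * (\<Sum>i\<in>S. c i * \<alpha> i $ r))"
    unfolding ev_def sum_distrib_left by (subst sum.swap) (simp add: mult_ac)
  then show ?thesis using assms by (simp add: dependency_def)
qed

text \<open>A zero of the other form, if there is one, that is not a zero of \<open>\<ell> i\<close>
  isolates the coefficient \<open>c i\<close>.\<close>

lemma dependency_trivial:
  assumes "dependency \<alpha> S c" "card S \<le> 2" "i \<in> S"
  shows "c i = 0"
proof -
  have fin: "finite (S - {i})" by simp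
  have "card (S - {i}) \<le> 1" using assms by simp
  then consider "S - {i} = {}" | j where "S - {i} = {j}"
    using fin by (metis One_nat_def card_0_eq card_1_singletonE le_Suc_eq le_zero_eq)
  then obtain x where x: "\<ell> i x \<noteq> 0" "\<forall>j\<in>S - {i}. \<ell> j x = 0"
  proof cases
    case 1
    obtain x where "\<ell> i x = 1" by (rule form_eq_1)
    then show ?thesis using that[of x] 1 by simp
  next
    case (2 j)
    then have "j \<noteq> i" by auto
    then show ?thesis using form_nonprop[of j i] that 2 by auto
  qed
  have "0 = c i * \<ell> i x + (\<Sum>j\<in>S - {i}. c j * \<ell> j x)"
    using dependency_forms[OF assms(1), of x] sum.remove[of S i "\<lambda>i. c i * \<ell> i x"] assms(3) by simp
  also have "(\<Sum>j\<in>S - {i}. c j * \<ell> j x) = 0" using x(2) by (intro sum.neutral) auto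
  finally show ?thesis using x(1) by simp
qed

text \<open>A relation on \<open>S\<close> has degree \<open>card S - 1\<close>, and relations on at
  most two forms are zero.\<close>

lemma OT_ideal_order:
  assumes "p \<in> OT_ideal \<alpha>"
  shows "order_ge UNIV 2 p"
proof -
  have sub: "ideal.subspace {p :: 'n ring_R. order_ge UNIV 2 p}"
    by (rule ideal.subspaceI) (auto intro: order_ge_add order_ge_mult_left)
  have "OT_relation S c \<in> {p. order_ge UNIV 2 p}" if dep: "dependency \<alpha> S c" for S c
  proof (cases "card S \<le> 2")
    case True
    then show ?thesis using dependency_trivial[OF dep] by (simp add: OT_relation_def)
  next
    case False
    have "order_ge UNIV 2 (Const (c i) * (\<Prod>j\<in>S - {i}. Var j))" if "i \<in> S" for i
    proof (rule order_ge_mult_left)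
      have "2 \<le> card (S - {i})" using False that by simp
      then show "order_ge UNIV 2 (\<Prod>j\<in>S - {i}. Var j)"
        using order_ge_prod_Var[of "S - {i}"] unfolding order_ge_def by force
    qed
    then show ?thesis by (auto simp: OT_relation_def intro: order_ge_sum)
  qed
  then have "OT_ideal \<alpha> \<subseteq> {p. order_ge UNIV 2 p}"
    unfolding OT_ideal_def by (intro ideal.span_minimal sub) auto
  then show ?thesis using assms by auto
qed

lemma linear_form_mult_quad: "linear_form a * linear_form b = quad UNIV (\<lambda>i j. a i * b j)"
  by (simp add: quad_def linear_form_mult)

end


section \<open>The matrix: minors, exactness and 1-genericity\<close>

context net_arrangement
begin

text \<open>At the reciprocals the combination equals the first row times
  \<open>(a * Q0 + b * Q1) / Q0\<close>, and some point makes both factors nonzero.\<close>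

lemma row_combination_nonzero:
  assumes ab: "(a, b) \<noteq> (0, 0)" and t: "t \<in> solutions"
    and x0: "x0 \<in> complement" "recip_val (first_row t) x0 \<noteq> 0"
  shows "linear_form (\<lambda>i. a * first_row t i + b * second_row t i) \<noteq> 0"
proof -
  obtain x where x: "x \<in> complement" "recip_val (first_row t) x \<noteq> 0" "a * Q0 x + b * Q1 x \<noteq> 0"
    using solution_nonzero_pencil[OF x0, of "{(a, b)}"] ab by auto
  have "recip_val (\<lambda>i. a * first_row t i + b * second_row t i) x
      = recip_val (first_row t) x * (a * Q0 x + b * Q1 x) / Q0 x"
    using Q_nonzero[OF x(1)] by (simp add: recip_val_add recip_val_scale solution_rows[OF t x(1)] field_simps)
  then have "recip_val (\<lambda>i. a * first_row t i + b * second_row t i) x \<noteq> 0"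
    using x Q_nonzero[OF x(1)] by simp
  then have "\<exists>i. a * first_row t i + b * second_row t i \<noteq> 0"
    by (rule contrapos_np) (simp add: recip_val_def)
  then obtain i where "a * first_row t i + b * second_row t i \<noteq> 0" by blast
  then show ?thesis by (rule linear_form_nonzero[where i = i])
qed

text \<open>Both columns have the same ratio \<open>Q1 / Q0\<close> of their rows at the
  reciprocals, so the minor is a quadric vanishing there.\<close>

lemma minor_in_OT_ideal:
  assumes "s \<in> solutions" "t \<in> solutions"
  shows "linear_form (first_row s) * linear_form (second_row t)
    - linear_form (first_row t) * linear_form (second_row s) \<in> OT_ideal \<alpha>"
proof -
  let ?q = "\<lambda>i j. first_row s i * second_row t j - first_row t i * second_row s j"
  have "quad UNIV ?q \<in> OT_ideal \<alpha>"
  proof (rule quad_in_OT_ideal)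
    fix x assume x: "x \<in> complement"
    have prod: "recip_val a x * recip_val b x = (\<Sum>i\<in>UNIV. \<Sum>j\<in>UNIV. a i * b j / (\<ell> i x * \<ell> j x))" for a b
      by (simp add: recip_val_def sum_product)
    have "quad_val UNIV ?q x = recip_val (first_row s) x * recip_val (second_row t) x
        - recip_val (first_row t) x * recip_val (second_row s) x"
      unfolding prod by (simp add: quad_val_def diff_divide_distrib sum_subtractf)
    then show "quad_val UNIV ?q x = 0"
      by (simp add: solution_rows[OF _ x] assms)
  qed simp
  moreover have "quad UNIV ?q = quad UNIV (\<lambda>i j. first_row s i * second_row t j)
      - quad UNIV (\<lambda>i j. first_row t i * second_row s j)"
    by (simp add: quad_def Const_diff left_diff_distrib sum_subtractf)
  ultimately show ?thesis by (simp add: linear_form_mult_quad)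
qed

text \<open>In coordinates dual to the completed set of points, the coefficients of a linear form
  are its values at these points. The columns then have the shape of the degeneration, and exactness
  is carried back by the inverse substitution.\<close>

lemma en_exact_rows:
  fixes N :: nat
  assumes N: "N \<le> card (UNIV :: 'n set)"
    and p: "\<And>i. i < N \<Longrightarrow> p i \<in> complement" and t: "\<And>j. j < N \<Longrightarrow> t j \<in> solutions"
    and dual: "\<And>i j. i < N \<Longrightarrow> j < N \<Longrightarrow> recip_val (first_row (t j)) (p i) = (if i = j then 1 else 0)"
    and inj: "inj_on (\<lambda>i. Q1 (p i) / Q0 (p i)) {..<N}"
  shows "en_exact N (\<lambda>j. linear_form (first_row (t j))) (\<lambda>j. linear_form (second_row (t j)))"
proof -
  let ?d = "card (UNIV :: 'n set)"
  obtain p' e where pe': "\<forall>i<N. p' i = p i" "\<forall>i<?d. p' i \<in> complement"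
      "\<forall>i<?d. \<forall>j<?d. recip_val (e j) (p' i) = (if i = j then 1 else 0)"
    using extend_dual_points[of N ?d p "\<lambda>j. first_row (t j)"] N p dual by auto
  note pe = pe'[rule_format]
  obtain \<iota> where "bij_betw \<iota> {0..<?d} (UNIV :: 'n set)"
    using ex_bij_betw_nat_finite[of "UNIV :: 'n set"] by auto
  then have \<iota>: "bij_betw \<iota> {..<?d} (UNIV :: 'n set)" by (simp add: atLeast0LessThan)
  have \<iota>_inj: "\<iota> i = \<iota> j \<longleftrightarrow> i = j" if "i < ?d" "j < ?d" for i j
    using \<iota> that by (auto simp: bij_betw_def inj_on_def)
  have \<iota>_sum: "(\<Sum>l\<in>UNIV. f l) = (\<Sum>k<?d. f (\<iota> k))" for f :: "'n \<Rightarrow> complex"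
    using sum.reindex_bij_betw[OF \<iota>, of f] by simp
  define V where "V i l = 1 / \<ell> l (p' i)" for i l
  \<comment> \<open>Duality of points and forms makes one matrix a left inverse of the other; both
    being square, it is also a right inverse, which is the relation needed to invert the
    substitution.\<close>
  have inverse: "(\<Sum>i<?d. V i l * e i l') = (if l = l' then 1 else 0)" for l l'
  proof -
    define A where "A = mat ?d ?d (\<lambda>(j, k). e j (\<iota> k))"
    define B where "B = mat ?d ?d (\<lambda>(k, i). V i (\<iota> k))"
    have AB: "A \<in> carrier_mat ?d ?d" "B \<in> carrier_mat ?d ?d" by (simp_all add: A_def B_def)
    have "A * B = 1\<^sub>m ?d"
    proof (rule eq_matI)
      fix j i assume "j < dim_row (1\<^sub>m ?d :: complex mat)" "i < dim_col (1\<^sub>m ?d :: complex mat)"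
      then have ji: "j < ?d" "i < ?d" by auto
      have "(A * B) $$ (j, i) = (\<Sum>k<?d. e j (\<iota> k) * V i (\<iota> k))"
        using ji by (simp add: A_def B_def scalar_prod_def atLeast0LessThan)
      also have "\<dots> = recip_val (e j) (p' i)"
        unfolding recip_val_def V_def \<iota>_sum by simp
      finally show "(A * B) $$ (j, i) = (1\<^sub>m ?d) $$ (j, i)" using pe(3)[of i j] ji by auto
    qed (simp_all add: A_def B_def)
    then have BA: "B * A = 1\<^sub>m ?d" by (rule mat_mult_left_right_inverse[OF AB])
    have "l \<in> \<iota> ` {..<?d}" "l' \<in> \<iota> ` {..<?d}" using \<iota> by (simp_all add: bij_betw_def)
    then obtain k k' where k: "k < ?d" "l = \<iota> k" "k' < ?d" "l' = \<iota> k'" by auto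
    have "(B * A) $$ (k, k') = (\<Sum>i<?d. V i (\<iota> k) * e i (\<iota> k'))"
      using k by (simp add: A_def B_def scalar_prod_def atLeast0LessThan)
    then show ?thesis using BA k \<iota>_inj by auto
  qed
  \<comment> \<open>\<open>f\<close> expands each old variable in the new coordinates, coordinate
    \<open>i\<close> being stored in the variable \<open>\<iota> i\<close>; \<open>g\<close> undoes
    this.\<close>
  define f where "f l = (\<Sum>i<?d. Const (V i l) * Var (\<iota> i))" for l
  define g where "g l = linear_form (e (the_inv_into {..<?d} \<iota> l))" for l
  have g: "g (\<iota> i) = linear_form (e i)" if "i < ?d" for i
    using that \<iota> by (simp add: g_def the_inv_into_f_f bij_betw_def)
  have gf: "subst g (f l) = Var l" for l
  proof -
    have "subst g (f l) = (\<Sum>i<?d. Const (V i l) * linear_form (e i))"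
      by (simp add: f_def subst_sum subst_mult g)
    also have "\<dots> = linear_form (\<lambda>l'. \<Sum>i<?d. V i l * e i l')"
      by (simp add: linear_form_sum linear_form_scale)
    also have "\<dots> = linear_form (\<lambda>l'. if l = l' then 1 else 0)" by (simp only: inverse)
    also have "\<dots> = Var l"
      by (simp add: linear_form_def if_distrib[of Const] if_distrib[of "\<lambda>x. x * _"] cong: if_cong)
    finally show ?thesis .
  qed
  have f_lin: "subst f (linear_form a) = (\<Sum>i<?d. Const (recip_val a (p' i)) * Var (\<iota> i))" for a
  proof -
    have "subst f (linear_form a) = (\<Sum>l\<in>UNIV. \<Sum>i<?d. Const (a l * V i l) * Var (\<iota> i))"
      by (simp add: subst_linear_form f_def sum_distrib_left Const_mult mult.assoc)
    also have "\<dots> = (\<Sum>i<?d. \<Sum>l\<in>UNIV. Const (a l * V i l) * Var (\<iota> i))" by (rule sum.swap)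
    also have "\<dots> = (\<Sum>i<?d. Const (recip_val a (p' i)) * Var (\<iota> i))"
      by (simp add: recip_val_def V_def Const_sum sum_distrib_right)
    finally show ?thesis .
  qed
  define rest where "rest a = (\<Sum>i\<in>{N..<?d}. Const (recip_val a (p' i)) * Var (\<iota> i))" for a
  have split: "subst f (linear_form a) = Const (recip_val a (p' j)) * Var (\<iota> j) + rest a"
    if j: "j < N" and z: "\<And>i. i < N \<Longrightarrow> i \<noteq> j \<Longrightarrow> recip_val a (p' i) = 0" for a j
  proof -
    have "{..<?d} = {..<N} \<union> {N..<?d}" using N by auto
    then have "subst f (linear_form a) = (\<Sum>i<N. Const (recip_val a (p' i)) * Var (\<iota> i)) + rest a"
      unfolding f_lin rest_def by (simp add: sum.union_disjoint ivl_disj_int)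
    also have "(\<Sum>i<N. Const (recip_val a (p' i)) * Var (\<iota> i)) = Const (recip_val a (p' j)) * Var (\<iota> j)"
      using j z by (subst sum.remove[of _ j]) (auto intro!: sum.neutral)
    finally show ?thesis .
  qed
  \<comment> \<open>These values involve no further choice: they are those of the first row
    multiplied by \<open>Q1 / Q0\<close>.\<close>
  have second: "recip_val (second_row (t j)) (p' i) = Q1 (p i) / Q0 (p i) * (if i = j then 1 else 0)"
    if "i < N" "j < N" for i j
    using solution_rows[OF t p, of j i] dual that pe(1) by simp
  have first: "recip_val (first_row (t j)) (p' i) = (if i = j then 1 else 0)" if "i < N" "j < N" for i j
    using dual that pe(1) by simp
  have deg1: "degree_le 1 (\<Sum>i\<in>I. Const (b i) * Var (\<iota> i))" for b I
  proof (rule degree_le_sum)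
    fix i
    have "degree_le 0 (Const (b i))" "degree_le 1 (Var (\<iota> i))"
      by (simp_all add: degree_le_def Const_def Var_def)
    from degree_le_mult[OF this] show "degree_le 1 (Const (b i) * Var (\<iota> i))" by simp
  qed
  have ord1: "order_ge (\<iota> ` {N..<?d}) 1 (rest a)" for a
    unfolding rest_def
  proof (intro order_ge_sum order_ge_mult_left)
    fix i assume "i \<in> {N..<?d}"
    then show "order_ge (\<iota> ` {N..<?d}) 1 (Var (\<iota> i))" by (simp add: order_ge_def Var_def)
  qed
  interpret en_degeneration N \<iota> "\<iota> ` {N..<?d}" "\<lambda>i. Q1 (p i) / Q0 (p i)"
    "\<lambda>j. subst f (linear_form (first_row (t j)))" "\<lambda>j. subst f (linear_form (second_row (t j)))"
    "\<lambda>j. rest (first_row (t j))" "\<lambda>j. rest (second_row (t j))"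
  proof
    show "inj_on \<iota> {..<N}" using \<iota>_inj N by (auto simp: inj_on_def)
    show "\<iota> j \<notin> \<iota> ` {N..<?d}" if "j < N" for j using \<iota>_inj that N by auto
    show "inj_on (\<lambda>i. Q1 (p i) / Q0 (p i)) {..<N}" by (rule inj)
    show "subst f (linear_form (first_row (t j))) = Const 1 * Var (\<iota> j) + rest (first_row (t j))" if "j < N" for j
      using split[OF that, of "first_row (t j)"] first that by simp
    show "subst f (linear_form (second_row (t j)))
        = Const (Q1 (p j) / Q0 (p j)) * Var (\<iota> j) + rest (second_row (t j))" if "j < N" for j
      using split[OF that, of "second_row (t j)"] second that by simp
    show "degree_le 1 (subst f (linear_form (first_row (t j))))" for j unfolding f_lin by (rule deg1)
    show "degree_le 1 (subst f (linear_form (second_row (t j))))" for j unfolding f_lin by (rule deg1)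
  qed (rule ord1)+
  show ?thesis
    by (rule en_exact_ring_hom[OF is_ring_hom_subst is_ring_hom_subst subst_inverse[OF gf] en_exact])
qed

lemma ex_matrix:
  defines "N \<equiv> card (UNIV :: 'n set) - ((m + 1) choose 2)"
  shows "\<exists>M\<in>carrier_mat 2 N. linear_form_matrix M \<and> one_generic M \<and> minors2 M \<subseteq> OT_ideal \<alpha> \<and>
    en_exact N (\<lambda>j. M $$ (0, j)) (\<lambda>j. M $$ (1, j))"
proof -
  obtain p t where pt': "\<forall>j<N. p j \<in> complement \<and> t j \<in> solutions"
      "\<forall>i<N. \<forall>j<N. recip_val (first_row (t j)) (p i) = (if i = j then 1 else 0)"
      "inj_on (\<lambda>i. Q1 (p i) / Q0 (p i)) {..<N}"
    using dual_points[of N] unfolding N_def by blast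
  have p: "p j \<in> complement" and t: "t j \<in> solutions" if "j < N" for j using pt'(1) that by auto
  note dual = pt'(2)[rule_format] and inj = pt'(3)
  define M where "M = mat 2 N (\<lambda>(r, j). linear_form (if r = 0 then first_row (t j) else second_row (t j)))"
  have M: "M \<in> carrier_mat 2 N" "dim_row M = 2" "dim_col M = N" by (simp_all add: M_def)
  have M0: "M $$ (0, j) = linear_form (first_row (t j))" and M1: "M $$ (Suc 0, j) = linear_form (second_row (t j))"
    if "j < N" for j using that by (simp_all add: M_def)
  have lin: "linear_form_matrix M"
    by (simp add: linear_form_matrix_def M_def homogeneous_linear_form)
  \<comment> \<open>A combination of columns is the column of the solution \<open>s\<close>, whose
    first row has the value \<open>v k\<close> at \<open>p k\<close> and hence does not vanish
    identically.\<close>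
  have comb: "a \<noteq> (0, 0) \<Longrightarrow> k < N \<Longrightarrow> v k \<noteq> 0 \<Longrightarrow>
      (\<Sum>j<N. (Const (fst a) * M $$ (0, j) + Const (snd a) * M $$ (1, j)) * Const (v j)) \<noteq> 0" for a v k
  proof -
    assume a: "a \<noteq> (0, 0)" and k: "k < N" "v k \<noteq> 0"
    define s where "s i = (\<Sum>j<N. v j * t j i)" for i
    have s: "s \<in> solutions"
    proof -
      have "(\<Sum>i\<in>UNIV. s i * h i x) = (\<Sum>j<N. v j * (\<Sum>i\<in>UNIV. t j i * h i x))" for x
        unfolding s_def sum_distrib_right sum_distrib_left by (subst sum.swap) (simp add: mult.assoc)
      then show ?thesis using t by (simp add: solutions_def)
    qed
    have "first_row s = (\<lambda>i. \<Sum>j<N. v j * first_row (t j) i)"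
      by (simp add: first_row_def s_def sum_distrib_right mult.assoc fun_eq_iff)
    then have "recip_val (first_row s) (p k) = (\<Sum>j<N. v j * recip_val (first_row (t j)) (p k))"
      unfolding recip_val_def sum_distrib_left sum_divide_distrib
      by (simp add: sum_divide_distrib) (rule sum.swap)
    also have "\<dots> = (\<Sum>j<N. if k = j then v j else 0)"
      by (intro sum.cong refl) (use dual[OF k(1)] in \<open>auto split: if_splits\<close>)
    also have "\<dots> = v k" using k(1) by simp
    finally have "linear_form (\<lambda>i. fst a * first_row s i + snd a * second_row s i) \<noteq> 0"
      using row_combination_nonzero[of "fst a" "snd a" s "p k"] a k s p by (cases a) auto
    moreover have "linear_form (\<lambda>i. fst a * first_row s i + snd a * second_row s i)
        = (\<Sum>j<N. (Const (fst a) * M $$ (0, j) + Const (snd a) * M $$ (1, j)) * Const (v j))"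
    proof -
      have "(\<lambda>i. fst a * first_row s i + snd a * second_row s i)
          = (\<lambda>i. \<Sum>j<N. v j * (fst a * first_row (t j) i + snd a * second_row (t j) i))"
        by (simp add: first_row_def second_row_def s_def sum_distrib_left sum_distrib_right
            sum.distrib[symmetric] algebra_simps fun_eq_iff)
      then show ?thesis
        by (simp add: linear_form_sum linear_form_scale linear_form_add M0 M1 mult.commute)
    qed
    ultimately show "(\<Sum>j<N. (Const (fst a) * M $$ (0, j) + Const (snd a) * M $$ (1, j)) * Const (v j)) \<noteq> 0"
      by simp
  qed
  \<comment> \<open>An entry of the transformed matrix involves one row of \<open>P\<close> and one
    column of \<open>Q\<close>, and is nonzero as soon as these are. This covers the identity and
    all invertible matrices at once.\<close>
  have generic: "no_zero_entry (map_mat Const P * M * map_mat Const Q)"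
    if P: "P \<in> carrier_mat 2 2" "\<And>r. r < 2 \<Longrightarrow> \<exists>l<2. P $$ (r, l) \<noteq> 0"
      and Q: "Q \<in> carrier_mat N N" "\<And>c. c < N \<Longrightarrow> \<exists>k<N. Q $$ (k, c) \<noteq> 0" for P Q
    unfolding no_zero_entry_def
  proof (intro allI impI)
    fix r c assume "r < dim_row (map_mat Const P * M * map_mat Const Q)"
      "c < dim_col (map_mat Const P * M * map_mat Const Q)"
    then have rc: "r < 2" "c < N" using P(1) Q(1) by auto
    have "(map_mat Const P * M * map_mat Const Q) $$ (r, c)
        = (\<Sum>j<N. (Const (P $$ (r, 0)) * M $$ (0, j) + Const (P $$ (r, 1)) * M $$ (1, j)) * Const (Q $$ (j, c)))"
      using rc P(1) Q(1) M
      by (simp add: scalar_prod_def atLeast0LessThan numeral_2_eq_2 sum_distrib_left distrib_right sum.distrib mult.assoc)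
    moreover have "(P $$ (r, 0), P $$ (r, 1)) \<noteq> (0, 0)"
      using P(2)[OF rc(1)] by (auto simp: less_2_cases_iff)
    moreover obtain k where "k < N" "Q $$ (k, c) \<noteq> 0" using Q(2)[OF rc(2)] by blast
    ultimately show "(map_mat Const P * M * map_mat Const Q) $$ (r, c) \<noteq> 0"
      using comb[of "(P $$ (r, 0), P $$ (r, 1))" k "\<lambda>j. Q $$ (j, c)"] by simp
  qed
  have "one_generic M"
    unfolding one_generic_def M(2,3)
  proof (intro conjI allI impI)
    have one: "map_mat Const (1\<^sub>m n) = (1\<^sub>m n :: 'n ring_R mat)" for n
      by (rule eq_matI) auto
    have "map_mat Const (1\<^sub>m 2) * M * map_mat Const (1\<^sub>m N) = M"
      unfolding one using M(1) by simp
    moreover have "no_zero_entry (map_mat Const (1\<^sub>m 2) * M * map_mat Const (1\<^sub>m N))"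
      by (rule generic) auto
    ultimately show "no_zero_entry M" by simp
  next
    fix P Q :: "complex mat"
    assume PQ: "P \<in> carrier_mat 2 2 \<and> invertible_mat P \<and> Q \<in> carrier_mat N N \<and> invertible_mat Q"
    then have P: "P \<in> carrier_mat 2 2" and Q: "Q \<in> carrier_mat N N" by auto
    obtain B where B: "P * B = 1\<^sub>m 2" "B * P = 1\<^sub>m (dim_row B)"
      using PQ by (auto simp: invertible_mat_def inverts_mat_def)
    obtain C where C: "Q * C = 1\<^sub>m N" "C * Q = 1\<^sub>m (dim_row C)"
      using PQ by (auto simp: invertible_mat_def inverts_mat_def)
    have dB: "dim_col B = 2" "dim_row B = 2"
      using arg_cong[OF B(1), of dim_col] arg_cong[OF B(2), of dim_col] P by simp_all
    have dC: "dim_row C = N"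
      using arg_cong[OF C(2), of dim_col] Q by simp
    show "no_zero_entry (map_mat Const P * M * map_mat Const Q)"
    proof (rule generic[OF P _ Q])
      show "\<exists>l<2. P $$ (r, l) \<noteq> 0" if r: "r < 2" for r
      proof (rule ccontr)
        assume neg: "\<not> ?thesis"
        have "(P * B) $$ (r, r) = 0"
          using neg P r dB by (simp add: scalar_prod_def)
        then show False using B r by simp
      qed
      show "\<exists>k<N. Q $$ (k, c) \<noteq> 0" if c: "c < N" for c
      proof (rule ccontr)
        assume neg: "\<not> ?thesis"
        have "(C * Q) $$ (c, c) = 0"
          using neg Q c dC by (simp add: scalar_prod_def)
        then show False using C c dC by simp
      qed
    qed
  qed
  moreover have "minors2 M \<subseteq> OT_ideal \<alpha>"
  proof
    fix x assume "x \<in> minors2 M"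
    then obtain a b where x: "x = minor2 M a b" "a < b" "b < N" by (auto simp: minors2_def M)
    then show "x \<in> OT_ideal \<alpha>"
      using minor_in_OT_ideal[of "t a" "t b"] t by (simp add: minor2_def M0 M1)
  qed
  moreover have "en_exact N (\<lambda>j. M $$ (0, j)) (\<lambda>j. M $$ (1, j))"
  proof -
    have "en_exact N (\<lambda>j. linear_form (first_row (t j))) (\<lambda>j. linear_form (second_row (t j)))"
      by (rule en_exact_rows[OF _ p t dual inj]) (auto simp: N_def)
    moreover have "contr {..<N} (\<lambda>j. M $$ (0, j)) v T = contr {..<N} (\<lambda>j. linear_form (first_row (t j))) v T"
      "contr {..<N} (\<lambda>j. M $$ (1, j)) v T = contr {..<N} (\<lambda>j. linear_form (second_row (t j))) v T" for v T
      by (simp_all add: contr_def M0 M1)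
    ultimately show ?thesis unfolding en_exact_def en_diff_def by presburger
  qed
  ultimately show ?thesis using M(1) lin by blast
qed

end

section \<open>The arrangement of a net\<close>

definition point_of :: "complex vec \<Rightarrow> point" where
  "point_of v = {c \<cdot>\<^sub>v v | c. True}"

lemma proj_plane_iff: "p \<in> proj_plane \<longleftrightarrow> (\<exists>v\<in>carrier_vec 3. v \<noteq> 0\<^sub>v 3 \<and> p = point_of v)"
  by (auto simp: proj_plane_def point_of_def)

lemma point_of_in_line:
  assumes "v \<in> carrier_vec 3" "v \<noteq> 0\<^sub>v 3" "a \<in> carrier_vec 3"
  shows "point_of v \<in> proj_line a \<longleftrightarrow> ev a (\<lambda>i. v $ i) = 0"
proof -
  have ev: "ev a (\<lambda>i. v $ i) = a \<bullet> v"
    using assms by (simp add: ev_def scalar_prod_def atLeast0LessThan)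
  have "v = 1 \<cdot>\<^sub>v v" by simp
  then have "v \<in> point_of v" unfolding point_of_def by blast
  moreover have "a \<bullet> (c \<cdot>\<^sub>v v) = c * (a \<bullet> v)" for c using assms by simp
  ultimately show ?thesis
    using assms by (auto simp: proj_line_def proj_plane_iff ev point_of_def)
qed

lemma point_of_smult:
  assumes "s \<noteq> 0"
  shows "point_of (s \<cdot>\<^sub>v v) = point_of v"
proof (intro equalityI subsetI)
  fix x assume "x \<in> point_of (s \<cdot>\<^sub>v v)"
  then obtain c where "x = c \<cdot>\<^sub>v (s \<cdot>\<^sub>v v)" unfolding point_of_def by blast
  then have "x = (c * s) \<cdot>\<^sub>v v" by (simp add: smult_smult_assoc)
  then show "x \<in> point_of v" unfolding point_of_def by blast
next
  fix x assume "x \<in> point_of v"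
  then obtain c where "x = c \<cdot>\<^sub>v v" unfolding point_of_def by blast
  then have "x = (c / s) \<cdot>\<^sub>v (s \<cdot>\<^sub>v v)" using assms by (simp add: smult_smult_assoc)
  then show "x \<in> point_of (s \<cdot>\<^sub>v v)" unfolding point_of_def by blast
qed

lemma (in line_arrangement) inj_proj_line: "inj (\<lambda>i. proj_line (\<alpha> i))"
proof (rule injI, rule ccontr)
  fix i j assume eq: "proj_line (\<alpha> i) = proj_line (\<alpha> j)" and "i \<noteq> j"
  then obtain x where x: "\<ell> i x = 0" "\<ell> j x \<noteq> 0" using form_nonprop by blast
  define v where "v = vec 3 x"
  have v: "v \<in> carrier_vec 3" by (simp add: v_def)
  have ev: "\<ell> l (\<lambda>i. v $ i) = \<ell> l x" for l by (rule ev_eqI) (simp add: v_def)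
  have "v \<noteq> 0\<^sub>v 3"
  proof
    assume "v = 0\<^sub>v 3"
    then have "\<ell> j (\<lambda>i. v $ i) = \<ell> j (\<lambda>_. 0)" by (intro ev_eqI) simp
    then show False using ev x by simp
  qed
  then show False using eq x point_of_in_line[OF v _ carrier] by (simp add: ev set_eq_iff) metis
qed

text \<open>The base points on a line of block \<open>c\<close> are its intersections with the lines
  of another block \<open>c'\<close>, which therefore indexes them. They are distinct because a
  point of \<open>Z\<close> lies on only one line of \<open>c'\<close>, and each lies on a line of
  blocks 0 and 1 by the second net axiom.\<close>

lemma net_arrangementI:
  fixes \<alpha> :: "'n::finite \<Rightarrow> complex vec"
  assumes "line_arrangement \<alpha>" and net: "is_net k m (range (\<lambda>i. proj_line (\<alpha> i)))"
  shows "\<exists>B0 B1. net_arrangement \<alpha> B0 B1 m \<and> card (UNIV :: 'n set) = k * m"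
proof -
  interpret line_arrangement \<alpha> by fact
  obtain \<A> Z where "net k \<A> Z \<and> (\<Union>i<k. \<A> i) = range (\<lambda>i. proj_line (\<alpha> i)) \<and> (\<forall>i<k. card (\<A> i) = m)"
    using net unfolding is_net_def by (elim exE) (rule that)
  then have AZ: "net k \<A> Z" and cover: "(\<Union>i<k. \<A> i) = range (\<lambda>i. proj_line (\<alpha> i))"
    and card_A: "\<forall>i<k. card (\<A> i) = m" by - (elim conjE, assumption)+
  have k: "k \<ge> 3" and ne': "\<forall>i<k. finite (\<A> i) \<and> \<A> i \<noteq> {} \<and> (\<forall>L\<in>\<A> i. is_proj_line L)"
    and disj': "\<forall>i<k. \<forall>j<k. i \<noteq> j \<longrightarrow> \<A> i \<inter> \<A> j = {}"
    and Z: "Z \<subseteq> proj_plane"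
    and meet': "\<forall>i<k. \<forall>j<k. i \<noteq> j \<longrightarrow> (\<forall>L\<in>\<A> i. \<forall>L'\<in>\<A> j. \<exists>p\<in>Z. L \<inter> L' = {p})"
    and uniq': "\<forall>p\<in>Z. \<forall>i<k. \<exists>!L. L \<in> \<A> i \<and> p \<in> L"
    using AZ[unfolded net_def] by - (elim conjE, assumption)+
  note ne = ne'[rule_format] and disj = disj'[rule_format] and meet = meet'[rule_format]
    and uniq = uniq'[rule_format]
  define blk where "blk c = {i. proj_line (\<alpha> i) \<in> \<A> c}" for c
  have blk_image: "(\<lambda>i. proj_line (\<alpha> i)) ` blk c = \<A> c" if "c < k" for c
  proof -
    have "\<A> c \<subseteq> range (\<lambda>i. proj_line (\<alpha> i))" using cover that by blast
    then show ?thesis unfolding blk_def by blast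
  qed
  have card_blk: "card (blk c) = m" if "c < k" for c
  proof -
    have "card ((\<lambda>i. proj_line (\<alpha> i)) ` blk c) = card (blk c)"
      by (rule card_image) (rule inj_on_subset[OF inj_proj_line subset_UNIV])
    then show ?thesis using blk_image[OF that] card_A that by simp
  qed
  have blk_disj: "blk c \<inter> blk c' = {}" if "c < k" "c' < k" "c \<noteq> c'" for c c'
    using disj[OF that] unfolding blk_def by blast
  have blk_cover: "(\<Union>c<k. blk c) = UNIV" using cover unfolding blk_def by blast
  have card_UNIV: "card (UNIV :: 'n set) = k * m"
  proof -
    have "card (\<Union>c<k. blk c) = (\<Sum>c<k. card (blk c))"
      by (rule card_UN_disjoint) (use blk_disj in auto)
    then show ?thesis using blk_cover card_blk by simp
  qed
  have in_block: "\<exists>l\<in>blk c. \<ell> l (\<lambda>r. v $ r) = 0"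
    if v: "point_of v \<in> Z" "v \<in> carrier_vec 3" "v \<noteq> 0\<^sub>v 3" and c: "c < k" for v c
  proof -
    obtain L where L: "L \<in> \<A> c" "point_of v \<in> L" using uniq[OF v(1) c] by blast
    then obtain l where "l \<in> blk c" "L = proj_line (\<alpha> l)" using blk_image[OF c] by blast
    then show ?thesis using point_of_in_line[OF v(2,3) carrier] L by blast
  qed
  have "net_arrangement \<alpha> (blk 0) (blk 1) m"
  proof unfold_locales
    show "blk 0 \<inter> blk 1 = {}" using blk_disj[of 0 1] k by simp
    show "card (blk 0) = m" "card (blk 1) = m" using card_blk k by auto
    have "card (\<A> 0) \<noteq> 0" using ne[of 0] k by simp
    moreover have "card (\<A> 0) = m" using card_A k by simp
    ultimately show "1 \<le> m" by simp
    fix i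
    obtain c where c: "c < k" "i \<in> blk c" using blk_cover by blast
    have "\<exists>c'. c' < k \<and> c' \<noteq> c" by (rule exI[of _ "if c = 0 then 1 else 0"]) (use k in auto)
    then obtain c' where c': "c' < k" "c' \<noteq> c" by blast
    have "\<exists>v. v \<in> carrier_vec 3 \<and> v \<noteq> 0\<^sub>v 3 \<and> point_of v \<in> Z \<and>
        point_of v \<in> proj_line (\<alpha> i) \<and> point_of v \<in> proj_line (\<alpha> j)" if j: "j \<in> blk c'" for j
    proof -
      have "proj_line (\<alpha> i) \<in> \<A> c" "proj_line (\<alpha> j) \<in> \<A> c'" using c j by (auto simp: blk_def)
      then obtain p where p: "p \<in> Z" "proj_line (\<alpha> i) \<inter> proj_line (\<alpha> j) = {p}"
        using meet[OF c(1) c'(1) c'(2)[symmetric]] by blast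
      have "p \<in> proj_plane" using p(1) Z by (rule set_mp[rotated])
      then obtain v where v: "v \<in> carrier_vec 3" "v \<noteq> 0\<^sub>v 3" "p = point_of v"
        unfolding proj_plane_iff by (elim bexE conjE) (rule that)
      have "p \<in> proj_line (\<alpha> i)" "p \<in> proj_line (\<alpha> j)" using p(2) by auto
      then show ?thesis using v p(1) by (intro exI[of _ v]) simp
    qed
    then have "\<forall>j\<in>blk c'. \<exists>v. v \<in> carrier_vec 3 \<and> v \<noteq> 0\<^sub>v 3 \<and> point_of v \<in> Z \<and>
        point_of v \<in> proj_line (\<alpha> i) \<and> point_of v \<in> proj_line (\<alpha> j)" by (rule ballI)
    from bchoice[OF this] obtain v where v': "\<forall>j\<in>blk c'. v j \<in> carrier_vec 3 \<and> v j \<noteq> 0\<^sub>v 3 \<and>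
        point_of (v j) \<in> Z \<and> point_of (v j) \<in> proj_line (\<alpha> i) \<and> point_of (v j) \<in> proj_line (\<alpha> j)" ..
    have v: "v j \<in> carrier_vec 3" "v j \<noteq> 0\<^sub>v 3" "point_of (v j) \<in> Z"
        "point_of (v j) \<in> proj_line (\<alpha> i)" "point_of (v j) \<in> proj_line (\<alpha> j)" if "j \<in> blk c'" for j
      using v' that by simp_all
    show "\<exists>C q. card (C :: 'n set) = m \<and>
      (\<forall>j\<in>C. \<ell> i (q j) = 0 \<and> (\<exists>l\<in>blk 0. \<ell> l (q j) = 0) \<and> (\<exists>l\<in>blk 1. \<ell> l (q j) = 0) \<and> (\<exists>r<3. q j r \<noteq> 0)) \<and>
      (\<forall>j\<in>C. \<forall>k\<in>C. \<forall>s. j \<noteq> k \<longrightarrow> s \<noteq> 0 \<longrightarrow> (\<exists>r<3. q j r \<noteq> s * q k r))"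
    proof (intro exI[of _ "blk c'"] exI[of _ "\<lambda>j r. v j $ r"] conjI ballI allI impI)
      show "card (blk c') = m" by (rule card_blk[OF c'(1)])
    next
      fix j assume j: "j \<in> blk c'"
      show "\<ell> i (\<lambda>r. v j $ r) = 0" using v(4)[OF j] point_of_in_line[OF v(1,2)[OF j] carrier] by blast
      show "\<exists>l\<in>blk 0. \<ell> l (\<lambda>r. v j $ r) = 0" "\<exists>l\<in>blk 1. \<ell> l (\<lambda>r. v j $ r) = 0"
        using in_block[OF v(3,1,2)[OF j]] k by auto
      show "\<exists>r<3. v j $ r \<noteq> 0"
      proof (rule ccontr)
        assume neg: "\<not> ?thesis"
        have "v j = 0\<^sub>v 3" by (rule eq_vecI) (use neg v(1)[OF j] in auto)
        then show False using v(2)[OF j] by simp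
      qed
    next
      fix j l s assume jl: "j \<in> blk c'" "l \<in> blk c'" "j \<noteq> l" and s: "s \<noteq> (0 :: complex)"
      show "\<exists>r<3. v j $ r \<noteq> s * v l $ r"
      proof (rule ccontr)
        assume neg: "\<not> ?thesis"
        have "v j = s \<cdot>\<^sub>v v l"
          by (rule eq_vecI) (use neg v(1)[OF jl(1)] v(1)[OF jl(2)] in auto)
        then have "point_of (v j) = point_of (v l)" using point_of_smult[OF s] by simp
        then have "proj_line (\<alpha> j) = proj_line (\<alpha> l)"
          using uniq[OF v(3)[OF jl(1)] c'(1)] v(5)[OF jl(1)] v(5)[OF jl(2)] jl(1,2) unfolding blk_def by auto
        then show False using inj_proj_line jl(3) by (auto dest: injD)
      qed
    qed
  qed
  then show ?thesis using card_UNIV by blast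
qed

theorem corollary4p11:
  fixes \<alpha> :: "'n::finite \<Rightarrow> complex vec" and k m :: nat
  assumes "\<And>i. \<alpha> i \<in> carrier_vec 3"
    and "\<And>i. \<alpha> i \<noteq> 0\<^sub>v 3"
    and "\<And>i j c. i \<noteq> j \<Longrightarrow> \<alpha> i \<noteq> c \<cdot>\<^sub>v \<alpha> j"
    and "is_net k m (range (\<lambda>i. proj_line (\<alpha> i)))"
    and "k \<ge> m"
  shows "\<exists>M \<in> carrier_mat 2 (k * m - ((m + 1) choose 2)).
           linear_form_matrix M \<and> one_generic M \<and> minors2 M \<subseteq> OT_ideal \<alpha> \<and>
           graded_free_resolution (eagon_northcott M) (ideal.span (minors2 M)) \<and>
           (\<forall>F :: (nat, 'n) free_seq. minimal_graded_free_resolution F (OT_ideal \<alpha>) \<longrightarrow>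
              embeds_as_subcomplex (eagon_northcott M) F)"
proof -
  have lines: "line_arrangement \<alpha>" using assms(1-3) by unfold_locales
  then interpret line_arrangement \<alpha> .
  obtain B0 B1 where net: "net_arrangement \<alpha> B0 B1 m" and card: "card (UNIV :: 'n set) = k * m"
    using net_arrangementI[OF lines assms(4)] by blast
  let ?N = "k * m - ((m + 1) choose 2)"
  obtain M where M: "M \<in> carrier_mat 2 ?N" "linear_form_matrix M" "one_generic M" "minors2 M \<subseteq> OT_ideal \<alpha>"
      "en_exact ?N (\<lambda>j. M $$ (0, j)) (\<lambda>j. M $$ (1, j))"
    using net_arrangement.ex_matrix[OF net] unfolding card by blast
  have res: "graded_free_resolution (eagon_northcott M) (ideal.span (minors2 M))"
    by (rule graded_free_resolution_en[OF M(1,2,5)])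
  have sub: "ideal.span (minors2 M) \<subseteq> OT_ideal \<alpha>"
    using M(4) unfolding OT_ideal_def by (rule ideal.span_minimal) (rule ideal.subspace_span)
  have "embeds_as_subcomplex (eagon_northcott M) F" if "minimal_graded_free_resolution F (OT_ideal \<alpha>)"
    for F :: "(nat, 'n) free_seq"
  proof (rule linear_resolution_embeds[OF res _ _ _ that sub])
    show "gens (eagon_northcott M) 0 = {({}, 0)}" "gdeg (eagon_northcott M) 0 ({}, 0) = 0" by simp_all
    show "gdeg (eagon_northcott M) (Suc i) c = int (Suc (Suc i))" for i c by simp
    show "2 \<le> total_deg t" if "p \<in> OT_ideal \<alpha>" "t \<in> Poly_Mapping.keys p" for p t
      using OT_ideal_order[OF that(1)] that(2) by (auto simp: order_ge_def total_deg_eq_wdeg)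
  qed
  with M res show ?thesis by blast
qed

end
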